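(* Let $p_1,p_2\ge2$, $p=p_1p_2$, and let $r$ be an integer with $p_1/p_2+p_2/p_1<r\le p$. Let $f$ be a scalar-valued smooth function on $(\mathcal{C}_{p_1,p_2,r},g^E)$, where $g^E$ is the Euclidean metric $g^E_A(U,V)=\mathrm{tr}(U^\top V)$. Let $A\in\mathcal{C}_{p_1,p_2,r}$ and $V\in T_A\mathcal{C}_{p_1,p_2,r}$, and put $\tilde A=\varphi_{p_1,p_2,r}^{-1}(A)$, $\tilde V=\varphi_{p_1,p_2,r}^{-1}(V)$. Then the Riemannian gradient and Riemannian Hessian operator of $f$ satisfy $$\mathrm{vec}(\mathrm{grad} f(A))=(I-J(\tilde A)^\dagger J(\tilde A))\,\mathrm{vec}(\nabla f(A)),$$ $$\mathrm{vec}(\mathrm{Hess} f(A)[V])=(I-J(\tilde A)^\dagger J(\tilde A))\,\mathrm{vec}(\nabla^2f(A)[V])-(I-J(\tilde A)^\dagger J(\tilde A))J(\tilde V)^\top(J(\tilde A)^\dagger)^\top J(\tilde A)^\dagger J(\tilde A)\,\mathrm{vec}(\nabla f(A)).$$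
   Context: $\varphi_{p_1,p_2,r}(A_1,\dots,A_r)=[\mathrm{vec}(A_1),\dots,\mathrm{vec}(A_r)]\in\mathbb{R}^{p\times r}$ for $(A_1,\dots,A_r)\in(\mathbb{R}^{p_1\times p_2})^r$ (a linear bijection). $M^\dagger$ is the Moore–Penrose pseudoinverse. $K_{(m,m)}$ is the $m^2\times m^2$ commutation matrix: $K_{(m,m)}\mathrm{vec}(B^\top)=\mathrm{vec}(B)$ for $B\in\mathbb{R}^{m\times m}$. $(A_1,\dots,A_r)$ is canonically decomposable if there exist $(P,Q)\in GL_{p_1}\times GL_{p_2}$ and $1\le a\le p_1-1$, $1\le b\le p_2-1$ such that every $PA_iQ^{-1}$ is block diagonal with diagonal blocks of sizes $a\times b$ and $(p_1-a)\times(p_2-b)$; otherwise it is canonically indecomposable. $\mathcal{D}_{p_1,p_2,r}$ is the set of canonically indecomposable $(A_1,\dots,A_r)$ with $\mathrm{rank}\,\varphi_{p_1,p_2,r}(A_1,\dots,A_r)=r$, $\sum_iA_iA_i^\top=p_2I_{p_1}$ and $\sum_iA_i^\top A_i=p_1I_{p_2}$; $\mathcal{C}_{p_1,p_2,r}=\varphi_{p_1,p_2,r}(\mathcal{D}_{p_1,p_2,r})$, an embedded submanifold of the $p\times r$ matrices of rank $r$. For $A=(A_1,\dots,A_r)\in(\mathbb{R}^{p_1\times p_2})^r$ with $a=[\mathrm{vec}(A_1)^\top,\dots,\mathrm{vec}(A_r)^\top]^\top$, the matrix $J(A)$, linear in $A$, is the vertical stack of $J_1(A)=\frac1p(I_{p_1^2}+K_{(p_1,p_1)})[A_1\otimes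 I_{p_1},\dots,A_r\otimes I_{p_1}]-\frac{2}{p_1^2p_2}\mathrm{vec}(I_{p_1})a^\top$, $J_2(A)=\frac1p(I_{p_2^2}+K_{(p_2,p_2)})[I_{p_2}\otimes A_1^\top,\dots,I_{p_2}\otimes A_r^\top]-\frac{2}{p_1p_2^2}\mathrm{vec}(I_{p_2})a^\top$, $J_3(A)=2a^\top$. The tangent space is $T_A\mathcal{C}_{p_1,p_2,r}=\{B\in\mathbb{R}^{p\times r}:J(\tilde A)\mathrm{vec}(B)=0\}$. $\nabla f(A)$ and $\nabla^2f(A)[V]$ are the Euclidean gradient and Euclidean Hessian operator applied to $V$ (of a smooth extension of $f$ to a neighbourhood in $\mathbb{R}^{p\times r}$). The Riemannian Hessian operator is the Levi-Civita covariant derivative of the Riemannian gradient. *)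

theory Defs
  imports "HOL-Analysis.Analysis"
begin

section \<open>Matrices\<close>

text \<open>
  A \<open>p\<^sub>1 \<times> p\<^sub>2\<close> matrix is an element of \<open>real^'n^'m\<close> with \<open>CARD('m) = p\<^sub>1\<close>, \<open>CARD('n) = p\<^sub>2\<close>.
  Column stacking is expressed by the index pair (column, row): read lexicographically, the
  pairs enumerate the entries column by column.  The index pairs of the Kronecker product are
  (block, position inside the block), so the usual identity
  \<open>vec (A X B) = (B\<^sup>T \<otimes> A) vec X\<close> holds.
\<close>

definition vectorize :: "real^'c::finite^'d::finite \<Rightarrow> real^('c \<times> 'd)" where
  "vectorize A = (\<chi> q. A $ snd q $ fst q)"

definition kron :: "real^'b::finite^'a::finite \<Rightarrow> real^'d::finite^'c::finite \<Rightarrow> real^('b \<times> 'd)^('a \<times> 'c)" where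
  "kron A B = (\<chi> s t. A $ fst s $ fst t * B $ snd s $ snd t)"

definition commutation_matrix :: "real^('k::finite \<times> 'k)^('k \<times> 'k)" where
  "commutation_matrix = (\<chi> s t. if fst s = snd t \<and> snd s = fst t then 1 else 0)"

definition hcat :: "('r::finite \<Rightarrow> real^'c::finite^'d) \<Rightarrow> real^('r \<times> 'c)^'d" where
  "hcat M = (\<chi> s t. M (fst t) $ s $ snd t)"

definition vcat :: "real^'c^'d::finite \<Rightarrow> real^'c^'e::finite \<Rightarrow> real^'c^('d + 'e)" where
  "vcat M N = (\<chi> s. case s of Inl i \<Rightarrow> M $ i | Inr j \<Rightarrow> N $ j)"

definition outer :: "real^'d \<Rightarrow> real^'c \<Rightarrow> real^'c^'d" where
  "outer x y = (\<chi> s t. x $ s * y $ t)"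

text \<open>The Moore--Penrose pseudoinverse, by the four Penrose conditions.\<close>

definition pinv :: "real^'c^'d \<Rightarrow> real^'d^'c" where
  "pinv M = (THE X. M ** X ** M = M \<and> X ** M ** X = X \<and>
     transpose (M ** X) = M ** X \<and> transpose (X ** M) = X ** M)"

lemma commutation_matrix_vectorize:
  fixes B :: "real^'k^'k"
  shows "commutation_matrix *v vectorize (transpose B) = vectorize B"
proof -
  have "(\<Sum>t\<in>UNIV. (if fst s = snd t \<and> snd s = fst t then 1 else 0) *
      B $ fst t $ snd t) = B $ snd s $ fst s" for s :: "'k \<times> 'k"
  proof -
    have eq: "(if fst s = snd t \<and> snd s = fst t then 1 else 0) * B $ fst t $ snd t =
        (if t = (snd s, fst s) then B $ fst t $ snd t else 0)" for t :: "'k \<times> 'k"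
      by (cases t) auto
    show ?thesis
      unfolding eq by simp
  qed
  then show ?thesis
    by (simp add: vec_eq_iff matrix_vector_mult_def commutation_matrix_def vectorize_def
        transpose_def)
qed

section \<open>The manifold of core matrices\<close>

definition phi :: "real^'n::finite^'m::finite^'r::finite \<Rightarrow> real^'r^('n \<times> 'm)" where
  "phi A = (\<chi> q k. vectorize (A $ k) $ q)"

lemma bij_phi: "bij (phi :: real^'n::finite^'m::finite^'r \<Rightarrow> real^'r^('n \<times> 'm))"
proof (rule bijI)
  show "inj (phi :: real^'n::finite^'m::finite^'r \<Rightarrow> real^'r^('n \<times> 'm))"
    by (auto simp: inj_def phi_def vectorize_def vec_eq_iff)
  show "surj (phi :: real^'n::finite^'m::finite^'r \<Rightarrow> real^'r^('n \<times> 'm))"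
    unfolding surj_def
  proof
    fix B :: "real^'r^('n \<times> 'm)"
    have "B = phi (\<chi> k i j. B $ (j, i) $ k)"
      by (simp add: phi_def vectorize_def vec_eq_iff)
    then show "\<exists>A. B = phi A" ..
  qed
qed

text \<open>\<open>card {..<i}\<close> is the (zero-based) position of the index \<open>i\<close>.\<close>

definition block_diagonal ::
  "nat \<Rightarrow> nat \<Rightarrow> real^'n::{finite,linorder}^'m::{finite,linorder} \<Rightarrow> bool" where
  "block_diagonal a b M \<longleftrightarrow>
     (\<forall>i j. (card {..<i} < a) \<noteq> (card {..<j} < b) \<longrightarrow> M $ i $ j = 0)"

definition canonically_decomposable ::
  "real^'n::{finite,linorder}^'m::{finite,linorder}^'r \<Rightarrow> bool" where
  "canonically_decomposable A \<longleftrightarrow>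
     (\<exists>(P :: real^'m::{finite,linorder}^'m::{finite,linorder})
        (Q :: real^'n::{finite,linorder}^'n::{finite,linorder}) a b.
        invertible P \<and> invertible Q \<and>
        1 \<le> a \<and> a \<le> CARD('m) - 1 \<and> 1 \<le> b \<and> b \<le> CARD('n) - 1 \<and>
        (\<forall>k. block_diagonal a b (P ** A $ k ** matrix_inv Q)))"

definition D_set :: "(real^'n::{finite,linorder}^'m::{finite,linorder}^'r) set" where
  "D_set = {A. \<not> canonically_decomposable A \<and> rank (phi A) = CARD('r) \<and>
     (\<Sum>k\<in>UNIV. A $ k ** transpose (A $ k)) = real CARD('n) *\<^sub>R mat 1 \<and>
     (\<Sum>k\<in>UNIV. transpose (A $ k) ** A $ k) = real CARD('m) *\<^sub>R mat 1}"

definition C_set ::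
  "((real^'r)^('n::{finite,linorder} \<times> 'm::{finite,linorder})) set" where
  "C_set = phi ` D_set"

text \<open>\<open>stacked A\<close> is the column \<open>a = [vec(A\<^sub>1)\<^sup>T, \<dots>, vec(A\<^sub>r)\<^sup>T]\<^sup>T\<close>.\<close>

definition stacked :: "real^'n::finite^'m::finite^'r::finite \<Rightarrow> real^('r \<times> ('n \<times> 'm))" where
  "stacked A = (\<chi> t. vectorize (A $ fst t) $ snd t)"

lemma stacked_eq: "stacked A = vectorize (phi A)"
  by (simp add: stacked_def phi_def vectorize_def vec_eq_iff)

definition J1 :: "real^'n::finite^'m::finite^'r::finite \<Rightarrow> real^('r \<times> ('n \<times> 'm))^('m \<times> 'm)" where
  "J1 A =
     (1 / real (CARD('m) * CARD('n))) *\<^sub>R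
        ((mat 1 + commutation_matrix) ** hcat (\<lambda>k. kron (A $ k) (mat 1 :: real^'m^'m)))
     - (2 / (real CARD('m) ^ 2 * real CARD('n))) *\<^sub>R
        outer (vectorize (mat 1 :: real^'m^'m)) (stacked A)"

definition J2 :: "real^'n::finite^'m::finite^'r::finite \<Rightarrow> real^('r \<times> ('n \<times> 'm))^('n \<times> 'n)" where
  "J2 A =
     (1 / real (CARD('m) * CARD('n))) *\<^sub>R
        ((mat 1 + commutation_matrix) ** hcat (\<lambda>k. kron (mat 1 :: real^'n^'n) (transpose (A $ k))))
     - (2 / (real CARD('m) * real CARD('n) ^ 2)) *\<^sub>R
        outer (vectorize (mat 1 :: real^'n^'n)) (stacked A)"

definition J3 :: "real^'n::finite^'m::finite^'r::finite \<Rightarrow> real^('r \<times> ('n \<times> 'm))^unit" where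
  "J3 A = (\<chi> _. 2 *\<^sub>R stacked A)"

definition J ::
  "real^'n::finite^'m::finite^'r::finite \<Rightarrow> real^('r \<times> ('n \<times> 'm))^(('m \<times> 'm) + (('n \<times> 'n) + unit))" where
  "J A = vcat (J1 A) (vcat (J2 A) (J3 A))"

section \<open>Smooth functions and Euclidean derivatives\<close>

primrec Ck_on ::
  "nat \<Rightarrow> 'a::euclidean_space set \<Rightarrow> ('a \<Rightarrow> 'b::euclidean_space) \<Rightarrow> bool" where
  "Ck_on 0 U F \<longleftrightarrow> continuous_on U F"
| "Ck_on (Suc k) U F \<longleftrightarrow> (\<forall>x\<in>U. F differentiable (at x)) \<and>
     (\<forall>v. Ck_on k U (\<lambda>x. frechet_derivative F (at x) v))"

definition smooth_on ::
  "'a::euclidean_space set \<Rightarrow> ('a \<Rightarrow> 'b::euclidean_space) \<Rightarrow> bool" where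
  "smooth_on U F \<longleftrightarrow> (\<forall>k. Ck_on k U F)"

definition eucl_grad :: "('a::euclidean_space \<Rightarrow> real) \<Rightarrow> 'a \<Rightarrow> 'a" where
  "eucl_grad F x = (THE D. GDERIV F x :> D)"

definition eucl_hess :: "('a::euclidean_space \<Rightarrow> real) \<Rightarrow> 'a \<Rightarrow> 'a \<Rightarrow> 'a" where
  "eucl_hess F x v = frechet_derivative (eucl_grad F) (at x) v"

section \<open>Riemannian geometry of an embedded submanifold of a Euclidean space\<close>

text \<open>
  \<open>M\<close> is a subset of a Euclidean space, meant to be an embedded submanifold.
  Functions and vector fields on \<open>M\<close> are total functions whose values outside \<open>M\<close> are
  irrelevant; tangent vectors are represented by vectors of the ambient space.
\<close>

definition extends_near ::
  "'a::euclidean_space set \<Rightarrow> ('a \<Rightarrow> 'b::euclidean_space) \<Rightarrow> 'a \<Rightarrow> 'a set \<Rightarrow> ('a \<Rightarrow> 'b) \<Rightarrow> bool" where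
  "extends_near M f x U F \<longleftrightarrow>
     open U \<and> x \<in> U \<and> smooth_on U F \<and> (\<forall>y \<in> M \<inter> U. F y = f y)"

definition smooth_fun :: "'a::euclidean_space set \<Rightarrow> ('a \<Rightarrow> 'b::euclidean_space) \<Rightarrow> bool" where
  "smooth_fun M f \<longleftrightarrow> (\<forall>x\<in>M. \<exists>U F. extends_near M f x U F)"

text \<open>
  Curves are only required to be differentiable at the base point; on an embedded submanifold
  their velocities are the same as those of smooth curves.
\<close>

definition curve_through ::
  "'a::euclidean_space set \<Rightarrow> 'a \<Rightarrow> 'a \<Rightarrow> (real \<Rightarrow> 'a) \<Rightarrow> bool" where
  "curve_through M x v c \<longleftrightarrow>
     c 0 = x \<and> (\<forall>\<^sub>F t in nhds 0. c t \<in> M) \<and> (c has_vector_derivative v) (at 0)"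

definition tangent_space :: "'a::euclidean_space set \<Rightarrow> 'a \<Rightarrow> 'a set" where
  "tangent_space M x = {v. \<exists>c. curve_through M x v c}"

text \<open>The differential \<open>df\<^sub>x(v)\<close> of a real function \<open>f\<close> on \<open>M\<close>, for \<open>v \<in> T\<^sub>x M\<close>.\<close>

definition mdiff :: "'a::euclidean_space set \<Rightarrow> ('a \<Rightarrow> real) \<Rightarrow> 'a \<Rightarrow> 'a \<Rightarrow> real" where
  "mdiff M f x v =
     (THE d. \<forall>c. curve_through M x v c \<longrightarrow> ((\<lambda>t. f (c t)) has_real_derivative d) (at 0))"

definition vector_fields :: "'a::euclidean_space set \<Rightarrow> ('a \<Rightarrow> 'a) set" where
  "vector_fields M = {X. smooth_fun M X \<and> (\<forall>x\<in>M. X x \<in> tangent_space M x)}"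

text \<open>Below, \<open>g x u v\<close> is a Riemannian metric on \<open>M\<close>.\<close>

definition riem_grad ::
  "'a::euclidean_space set \<Rightarrow> ('a \<Rightarrow> 'a \<Rightarrow> 'a \<Rightarrow> real) \<Rightarrow> ('a \<Rightarrow> real) \<Rightarrow> 'a \<Rightarrow> 'a" where
  "riem_grad M g f x =
     (THE G. G \<in> tangent_space M x \<and> (\<forall>v \<in> tangent_space M x. g x G v = mdiff M f x v))"

definition affine_connection ::
  "'a::euclidean_space set \<Rightarrow> (('a \<Rightarrow> 'a) \<Rightarrow> ('a \<Rightarrow> 'a) \<Rightarrow> 'a \<Rightarrow> 'a) \<Rightarrow> bool" where
  "affine_connection M D \<longleftrightarrow>
     (\<forall>X\<in>vector_fields M. \<forall>Y\<in>vector_fields M. D X Y \<in> vector_fields M) \<and>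
     (\<forall>X\<in>vector_fields M. \<forall>X'\<in>vector_fields M. \<forall>Y\<in>vector_fields M. \<forall>h h'.
        smooth_fun M h \<longrightarrow> smooth_fun M h' \<longrightarrow>
        (\<forall>x\<in>M. D (\<lambda>y. h y *\<^sub>R X y + h' y *\<^sub>R X' y) Y x = h x *\<^sub>R D X Y x + h' x *\<^sub>R D X' Y x)) \<and>
     (\<forall>X\<in>vector_fields M. \<forall>Y\<in>vector_fields M. \<forall>Y'\<in>vector_fields M. \<forall>a b :: real.
        \<forall>x\<in>M. D X (\<lambda>y. a *\<^sub>R Y y + b *\<^sub>R Y' y) x = a *\<^sub>R D X Y x + b *\<^sub>R D X Y' x) \<and>
     (\<forall>X\<in>vector_fields M. \<forall>Y\<in>vector_fields M. \<forall>h. smooth_fun M h \<longrightarrow>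
        (\<forall>x\<in>M. D X (\<lambda>y. h y *\<^sub>R Y y) x = h x *\<^sub>R D X Y x + mdiff M h x (X x) *\<^sub>R Y x))"

text \<open>Torsion-freeness \<open>D\<^sub>X Y - D\<^sub>Y X = [X, Y]\<close>, both sides read as derivations on functions.\<close>

definition torsion_free ::
  "'a::euclidean_space set \<Rightarrow> (('a \<Rightarrow> 'a) \<Rightarrow> ('a \<Rightarrow> 'a) \<Rightarrow> 'a \<Rightarrow> 'a) \<Rightarrow> bool" where
  "torsion_free M D \<longleftrightarrow>
     (\<forall>X\<in>vector_fields M. \<forall>Y\<in>vector_fields M. \<forall>h. smooth_fun M h \<longrightarrow>
        (\<forall>x\<in>M. mdiff M h x (D X Y x) - mdiff M h x (D Y X x) =
           mdiff M (\<lambda>y. mdiff M h y (Y y)) x (X x) - mdiff M (\<lambda>y. mdiff M h y (X y)) x (Y x)))"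

definition metric_compatible ::
  "'a::euclidean_space set \<Rightarrow> ('a \<Rightarrow> 'a \<Rightarrow> 'a \<Rightarrow> real) \<Rightarrow>
     (('a \<Rightarrow> 'a) \<Rightarrow> ('a \<Rightarrow> 'a) \<Rightarrow> 'a \<Rightarrow> 'a) \<Rightarrow> bool" where
  "metric_compatible M g D \<longleftrightarrow>
     (\<forall>X\<in>vector_fields M. \<forall>Y\<in>vector_fields M. \<forall>Z\<in>vector_fields M. \<forall>x\<in>M.
        mdiff M (\<lambda>y. g y (Y y) (Z y)) x (X x) = g x (D X Y x) (Z x) + g x (Y x) (D X Z x))"

text \<open>
  The Levi-Civita connection is unique only up to values outside \<open>M\<close> and on arguments that are
  not vector fields, hence \<open>SOME\<close> rather than \<open>THE\<close>.
\<close>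

definition levi_civita ::
  "'a::euclidean_space set \<Rightarrow> ('a \<Rightarrow> 'a \<Rightarrow> 'a \<Rightarrow> real) \<Rightarrow> ('a \<Rightarrow> 'a) \<Rightarrow> ('a \<Rightarrow> 'a) \<Rightarrow> 'a \<Rightarrow> 'a" where
  "levi_civita M g = (SOME D. affine_connection M D \<and> torsion_free M D \<and> metric_compatible M g D)"

text \<open>The covariant derivative of \<open>Y\<close> at the point \<open>x\<close> in the tangent direction \<open>v\<close>.\<close>

definition cov_deriv ::
  "'a::euclidean_space set \<Rightarrow> ('a \<Rightarrow> 'a \<Rightarrow> 'a \<Rightarrow> real) \<Rightarrow> ('a \<Rightarrow> 'a) \<Rightarrow> 'a \<Rightarrow> 'a \<Rightarrow> 'a" where
  "cov_deriv M g Y x v =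
     (THE w. \<exists>X\<in>vector_fields M. X x = v \<and> w = levi_civita M g X Y x)"

definition riem_hess ::
  "'a::euclidean_space set \<Rightarrow> ('a \<Rightarrow> 'a \<Rightarrow> 'a \<Rightarrow> real) \<Rightarrow> ('a \<Rightarrow> real) \<Rightarrow> 'a \<Rightarrow> 'a \<Rightarrow> 'a" where
  "riem_hess M g f x v = cov_deriv M g (riem_grad M g f) x v"

definition gE :: "real^'c^'d \<Rightarrow> real^'c^'d \<Rightarrow> real^'c^'d \<Rightarrow> real" where
  "gE A U V = trace (transpose U ** V)"

end

theory Submission
  imports Defs
begin

text \<open>
  Near each of its points the manifold is a level set of the quadratic map
  \<open>A \<mapsto> J(A) vec(A)\<close>, whose derivative is \<open>2 J(A)\<close> because \<open>J(A) vec(B)\<close> is symmetric in \<open>A\<close>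
  and \<open>B\<close>.  Its values are a pair of trace-free symmetric matrices and a number, and the derivative is onto the space of such values
  exactly at the indecomposable tuples: a cokernel element \<open>(X, Y)\<close> satisfies
  \<open>X A\<^sub>k + A\<^sub>k Y = 0\<close>, so that the eigenspaces of \<open>X\<close> and \<open>-Y\<close> split the tuple, and conversely
  the endomorphism algebra of a balanced tuple is closed under transposition, so that a
  decomposition yields such a pair.  Hence regularity is an open condition, the tangent space is the
  kernel of \<open>J(A)\<close>, and \<open>I - J\<^sup>\<dagger> J\<close> is the orthogonal projection onto it, smooth in \<open>A\<close>.  By
  Koszul's argument the Levi-Civita connection is the projected derivative.  The Hessian follows by
  differentiating the normal part \<open>J(A)\<^sup>T \<zeta>(A)\<close> of the Euclidean gradient, with
  \<open>\<zeta> = (J\<^sup>\<dagger>)\<^sup>T J\<^sup>\<dagger> J vec(\<nabla>f)\<close>: the term \<open>J(A)\<^sup>T D\<zeta>\<close> is killed by the projection.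
\<close>

section \<open>Calculus of smooth functions\<close>

text \<open>The obstacle is the pseudoinverse, which is not continuous in general.
  \<open>J A\<close> never has full row rank, because its values contain only trace-free matrices;
  so \<open>J A ** transpose (J A)\<close> is singular and the usual formula for the pseudoinverse
  breaks down. At regular points, however, the range is a fixed space, the kernel of a constant
  matrix \<open>Q\<close>. Adding \<open>transpose Q ** Q\<close> fills exactly the missing
  directions: the sum \<open>G\<close> is invertible precisely at regular points, and
  \<open>transpose (J A) ** matrix_inv G\<close> is still the pseudoinverse. Cramer's rule makes it
  smooth, and one determinant shows that regularity is open. Gradient, connection and Hessian are
  given by description or choice operators, so each needs existence and uniqueness; tangent vectors
  are velocities of curves, so a kernel vector becomes tangent only through an inverse function
  argument.\<close>

lemma Ck_on_SucD1: "Ck_on (Suc k) U F \<Longrightarrow> x \<in> U \<Longrightarrow> (F has_derivative frechet_derivative F (at x)) (at x)"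
  by (simp add: frechet_derivative_works)

text \<open>\<open>frechet_derivative F (at x)\<close> depends on a whole neighbourhood of
  \<open>x\<close>; since \<open>U\<close> is open, agreement on \<open>U\<close> passes to the
  derivatives.\<close>

lemma Ck_on_cong:
  assumes "open U" "\<And>x. x \<in> U \<Longrightarrow> F x = G x" "Ck_on k U F"
  shows "Ck_on k U G"
  using assms(2,3)
proof (induction k arbitrary: F G)
  case 0
  then show ?case by (simp cong: continuous_on_cong)
next
  case (Suc k)
  have G: "(G has_derivative frechet_derivative F (at x)) (at x)" if "x \<in> U" for x
    using Ck_on_SucD1[OF Suc.prems(2) that] \<open>open U\<close> that Suc.prems(1)
    by (rule has_derivative_transform_within_open)
  then have "G differentiable (at x)" if "x \<in> U" for x
    using that differentiable_def by blast
  moreover have "Ck_on k U (\<lambda>x. frechet_derivative G (at x) v)" for v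
  proof (rule Suc.IH)
    show "frechet_derivative F (at x) v = frechet_derivative G (at x) v" if "x \<in> U" for x
      using frechet_derivative_at[OF G[OF that]] by simp
    show "Ck_on k U (\<lambda>x. frechet_derivative F (at x) v)"
      using Suc.prems(2) by simp
  qed
  ultimately show ?case by simp
qed

lemma Ck_on_SucI:
  assumes "open U" "\<And>x. x \<in> U \<Longrightarrow> (F has_derivative F' x) (at x)" "\<And>v. Ck_on k U (\<lambda>x. F' x v)"
  shows "Ck_on (Suc k) U F"
proof -
  have "Ck_on k U (\<lambda>x. frechet_derivative F (at x) v)" for v
    by (rule Ck_on_cong[OF assms(1) _ assms(3)[of v]]) (simp add: frechet_derivative_at[OF assms(2), symmetric])
  then show ?thesis
    using assms(2) by (auto simp: differentiable_def)
qed

lemma Ck_on_SucD: "Ck_on (Suc k) U F \<Longrightarrow> Ck_on k U F"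
proof (induction k arbitrary: F)
  case 0
  then show ?case
    by (auto intro!: differentiable_imp_continuous_on simp: differentiable_on_def differentiable_at_withinI)
next
  case (Suc k)
  have "Ck_on k U (\<lambda>x. frechet_derivative F (at x) v)" for v
    using Suc.prems Ck_on.simps(2)[of "Suc k" U F] by (intro Suc.IH) blast
  then show ?case using Suc.prems by simp
qed

lemma Ck_on_subset: "Ck_on k U F \<Longrightarrow> S \<subseteq> U \<Longrightarrow> Ck_on k S F"
  by (induction k arbitrary: F) (auto intro: continuous_on_subset)

lemma Ck_on_const: "Ck_on k U (\<lambda>_. c)"
  by (induction k arbitrary: c) auto

lemma Ck_on_add:
  assumes "open U" "Ck_on k U F" "Ck_on k U G"
  shows "Ck_on k U (\<lambda>x. F x + G x)"
  using assms(2,3)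
proof (induction k arbitrary: F G)
  case 0
  then show ?case by (auto intro: continuous_intros)
next
  case (Suc k)
  show ?case
  proof (rule Ck_on_SucI[OF \<open>open U\<close>])
    show "((\<lambda>x. F x + G x) has_derivative
        (\<lambda>v. frechet_derivative F (at x) v + frechet_derivative G (at x) v)) (at x)" if "x \<in> U" for x
      using Ck_on_SucD1[OF Suc.prems(1) that] Ck_on_SucD1[OF Suc.prems(2) that]
      by (rule has_derivative_add)
    show "Ck_on k U (\<lambda>x. frechet_derivative F (at x) v + frechet_derivative G (at x) v)" for v
      using Suc.prems by (intro Suc.IH) simp_all
  qed
qed

text \<open>A single product rule serves scaling, inner products and matrix products.
  Differentiation gives two terms of the same bilinear shape, so the induction ranges over both
  factors.\<close>

lemma Ck_on_bilinear:
  fixes prod :: "'b::euclidean_space \<Rightarrow> 'c::euclidean_space \<Rightarrow> 'd::euclidean_space"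
    and F :: "'a::euclidean_space \<Rightarrow> 'b" and G :: "'a \<Rightarrow> 'c"
  assumes "bounded_bilinear prod" "open U" "Ck_on k U F" "Ck_on k U G"
  shows "Ck_on k U (\<lambda>x. prod (F x) (G x))"
  using assms(3,4)
proof (induction k arbitrary: F G)
  case 0
  then show ?case using bounded_bilinear.continuous_on[OF assms(1)] by auto
next
  case (Suc k)
  show ?case
  proof (rule Ck_on_SucI[OF \<open>open U\<close>])
    show "((\<lambda>x. prod (F x) (G x)) has_derivative
        (\<lambda>v. prod (F x) (frechet_derivative G (at x) v) + prod (frechet_derivative F (at x) v) (G x)))
        (at x)" if "x \<in> U" for x
      using bounded_bilinear.FDERIV[OF assms(1) Ck_on_SucD1[OF Suc.prems(1) that]
          Ck_on_SucD1[OF Suc.prems(2) that]] .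
    show "Ck_on k U (\<lambda>x. prod (F x) (frechet_derivative G (at x) v)
        + prod (frechet_derivative F (at x) v) (G x))" for v
    proof (rule Ck_on_add[OF \<open>open U\<close>]; rule Suc.IH)
    qed (use Suc.prems in \<open>auto intro: Ck_on_SucD\<close>)
  qed
qed

lemma Ck_on_inverse:
  fixes F :: "'a::euclidean_space \<Rightarrow> real"
  assumes "open U" "\<And>x. x \<in> U \<Longrightarrow> F x \<noteq> 0" "Ck_on k U F"
  shows "Ck_on k U (\<lambda>x. inverse (F x))"
  using assms(3)
proof (induction k)
  case 0
  then show ?case using continuous_on_inverse[of U F] assms(2) by simp
next
  case (Suc k)
  show ?case
  proof (rule Ck_on_SucI[OF \<open>open U\<close>])
    \<comment> \<open>The derivative contains \<open>inverse (F x)\<close> itself, available at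
      order \<open>k\<close> by induction. The sign is a factor \<open>- 1\<close> so that the
      bilinear rule covers the whole term.\<close>
    show "((\<lambda>x. inverse (F x)) has_derivative
        (\<lambda>v. - 1 * (inverse (F x) * frechet_derivative F (at x) v * inverse (F x)))) (at x)" if "x \<in> U" for x
      using Deriv.has_derivative_inverse[OF assms(2)[OF that] Ck_on_SucD1[OF Suc.prems that]] by simp
    have inv: "Ck_on k U (\<lambda>x. inverse (F x))"
      using Suc.IH Ck_on_SucD[OF Suc.prems] by blast
    moreover have "Ck_on k U (\<lambda>x. frechet_derivative F (at x) v)" for v
      using Suc.prems by simp
    ultimately show "Ck_on k U (\<lambda>x. - 1 * (inverse (F x) * frechet_derivative F (at x) v * inverse (F x)))" for v
      by (intro Ck_on_bilinear[OF bounded_bilinear_mult \<open>open U\<close>] Ck_on_const)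
  qed
qed

lemma smooth_on_has_derivative:
  "smooth_on U F \<Longrightarrow> x \<in> U \<Longrightarrow> (F has_derivative frechet_derivative F (at x)) (at x)"
  unfolding smooth_on_def using Ck_on_SucD1 by blast

lemma smooth_on_imp_continuous_on: "smooth_on U F \<Longrightarrow> continuous_on U F"
  unfolding smooth_on_def by (metis Ck_on.simps(1))

lemma smooth_on_frechet_derivative:
  "smooth_on U F \<Longrightarrow> smooth_on U (\<lambda>x. frechet_derivative F (at x) v)"
  unfolding smooth_on_def by (metis Ck_on.simps(2))

lemma smooth_on_cong:
  "open U \<Longrightarrow> (\<And>x. x \<in> U \<Longrightarrow> F x = G x) \<Longrightarrow> smooth_on U F \<Longrightarrow> smooth_on U G"
  unfolding smooth_on_def by (auto intro: Ck_on_cong)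

lemma smooth_on_subset: "smooth_on U F \<Longrightarrow> S \<subseteq> U \<Longrightarrow> smooth_on S F"
  unfolding smooth_on_def by (auto intro: Ck_on_subset)

lemma smooth_on_const: "smooth_on U (\<lambda>_. c)"
  unfolding smooth_on_def by (auto intro: Ck_on_const)

lemma smooth_on_add:
  "open U \<Longrightarrow> smooth_on U F \<Longrightarrow> smooth_on U G \<Longrightarrow> smooth_on U (\<lambda>x. F x + G x)"
  unfolding smooth_on_def by (auto intro: Ck_on_add)

lemma smooth_on_bilinear:
  fixes prod :: "'b::euclidean_space \<Rightarrow> 'c::euclidean_space \<Rightarrow> 'd::euclidean_space"
    and F :: "'a::euclidean_space \<Rightarrow> 'b" and G :: "'a \<Rightarrow> 'c"
  shows "bounded_bilinear prod \<Longrightarrow> open U \<Longrightarrow> smooth_on U F \<Longrightarrow> smooth_on U G \<Longrightarrow>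
    smooth_on U (\<lambda>x. prod (F x) (G x))"
  unfolding smooth_on_def by (auto intro: Ck_on_bilinear)

lemma smooth_on_inverse:
  fixes F :: "'a::euclidean_space \<Rightarrow> real"
  shows "open U \<Longrightarrow> (\<And>x. x \<in> U \<Longrightarrow> F x \<noteq> 0) \<Longrightarrow> smooth_on U F \<Longrightarrow> smooth_on U (\<lambda>x. inverse (F x))"
  unfolding smooth_on_def by (auto intro: Ck_on_inverse)

lemma smooth_on_linear:
  assumes "open U" "bounded_linear T"
  shows "smooth_on U T"
  unfolding smooth_on_def
proof
  fix k
  have "Ck_on (Suc k) U T"
    by (rule Ck_on_SucI[OF \<open>open U\<close> bounded_linear_imp_has_derivative[OF assms(2)]]) (rule Ck_on_const)
  then show "Ck_on k U T" by (rule Ck_on_SucD)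
qed

lemma smooth_on_linear_compose:
  assumes "open U" "bounded_linear T" "smooth_on U F"
  shows "smooth_on U (\<lambda>x. T (F x))"
proof -
  \<comment> \<open>Composition with \<open>T\<close> is the bilinear map
    \<open>a *\<^sub>R T y\<close> at \<open>a = 1\<close>, so the product rule takes the place of a
    higher-order chain rule.\<close>
  have "bounded_bilinear (\<lambda>(a::real) y. a *\<^sub>R T y)"
    using bounded_bilinear.comp[OF bounded_bilinear_scaleR bounded_linear_ident assms(2)] .
  from smooth_on_bilinear[OF this assms(1) smooth_on_const[of _ 1] assms(3)]
  show ?thesis by simp
qed

lemma smooth_on_diff:
  "open U \<Longrightarrow> smooth_on U F \<Longrightarrow> smooth_on U G \<Longrightarrow> smooth_on U (\<lambda>x. F x - G x)"
  using smooth_on_add[of U F "\<lambda>x. - G x"]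
    smooth_on_linear_compose[OF _ bounded_linear_minus[OF bounded_linear_ident], of U G] by simp

lemma smooth_on_scaleR:
  "open U \<Longrightarrow> smooth_on U F \<Longrightarrow> smooth_on U G \<Longrightarrow> smooth_on U (\<lambda>x. F x *\<^sub>R G x)"
  by (rule smooth_on_bilinear[OF bounded_bilinear_scaleR])

lemma smooth_on_sum:
  "open U \<Longrightarrow> (\<And>i. i \<in> I \<Longrightarrow> smooth_on U (F i)) \<Longrightarrow> smooth_on U (\<lambda>x. \<Sum>i\<in>I. F i x)"
  by (induction I rule: infinite_finite_induct) (auto intro: smooth_on_const smooth_on_add)

lemma smooth_on_prod:
  fixes F :: "'i \<Rightarrow> 'a::euclidean_space \<Rightarrow> real"
  shows "open U \<Longrightarrow> (\<And>i. i \<in> I \<Longrightarrow> smooth_on U (F i)) \<Longrightarrow> smooth_on U (\<lambda>x. \<Prod>i\<in>I. F i x)"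
  by (induction I rule: infinite_finite_induct)
    (auto intro: smooth_on_const smooth_on_bilinear[OF bounded_bilinear_mult])

lemma smooth_on_vec:
  fixes F :: "'a::euclidean_space \<Rightarrow> 'b::euclidean_space^'i::finite"
  assumes "open U" "\<And>i. smooth_on U (\<lambda>x. F x $ i)"
  shows "smooth_on U F"
proof -
  have lin: "bounded_linear (axis i :: 'b \<Rightarrow> 'b^'i)" for i
    unfolding linear_conv_bounded_linear[symmetric]
    by (auto intro!: linearI simp: axis_def vec_eq_iff)
  have "smooth_on U (\<lambda>x. \<Sum>i\<in>UNIV. axis i (F x $ i))"
  proof (rule smooth_on_sum[OF assms(1)])
    show "smooth_on U (\<lambda>x. axis i (F x $ i))" for i
      by (rule smooth_on_linear_compose[OF assms(1) lin assms(2)])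
  qed
  also have "(\<lambda>x. \<Sum>i\<in>UNIV. axis i (F x $ i)) = F"
    by (simp add: fun_eq_iff vec_eq_iff axis_def)
  finally show ?thesis .
qed

lemma smooth_on_nth:
  fixes F :: "'a::euclidean_space \<Rightarrow> 'b::euclidean_space^'i::finite"
  shows "open U \<Longrightarrow> smooth_on U F \<Longrightarrow> smooth_on U (\<lambda>x. F x $ i)"
  by (rule smooth_on_linear_compose[OF _ bounded_linear_vec_nth])

section \<open>Derivatives in varying directions and symmetry of second derivatives\<close>

lemma frechet_derivative_eq_sum_Basis:
  assumes "(F has_derivative F') (at x)"
  shows "F' v = (\<Sum>b\<in>Basis. (v \<bullet> b) *\<^sub>R F' b)"
proof -
  have lin: "linear F'" using assms by (rule has_derivative_linear)
  then have "F' (\<Sum>b\<in>Basis. (v \<bullet> b) *\<^sub>R b) = (\<Sum>b\<in>Basis. (v \<bullet> b) *\<^sub>R F' b)"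
    by (simp add: linear_sum[OF lin] linear_scale[OF lin])
  then show ?thesis by (simp add: euclidean_representation)
qed

text \<open>\<open>Ck_on\<close> only controls derivatives in fixed directions. Expanding
  \<open>X x\<close> in the basis reduces a varying direction to a finite sum of products.\<close>

lemma smooth_on_frechet_derivative_apply:
  assumes "open U" "smooth_on U F" "smooth_on U X"
  shows "smooth_on U (\<lambda>x. frechet_derivative F (at x) (X x))"
proof (rule smooth_on_cong[OF assms(1)])
  show "(\<Sum>b\<in>Basis. (X x \<bullet> b) *\<^sub>R frechet_derivative F (at x) b) = frechet_derivative F (at x) (X x)"
    if "x \<in> U" for x
    by (rule frechet_derivative_eq_sum_Basis[OF smooth_on_has_derivative[OF assms(2) that], symmetric])
  show "smooth_on U (\<lambda>x. \<Sum>b\<in>Basis. (X x \<bullet> b) *\<^sub>R frechet_derivative F (at x) b)"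
  proof (rule smooth_on_sum[OF assms(1)])
    show "smooth_on U (\<lambda>x. (X x \<bullet> b) *\<^sub>R frechet_derivative F (at x) b)" for b
      by (rule smooth_on_scaleR[OF assms(1) smooth_on_linear_compose[OF assms(1) bounded_linear_inner_left assms(3)]
            smooth_on_frechet_derivative[OF assms(2)]])
  qed
qed

text \<open>Both mixed derivatives are limits of the same second difference quotient.\<close>

lemma second_difference:
  fixes F :: "'a::euclidean_space \<Rightarrow> real"
  assumes "open U" "smooth_on U F" "x \<in> U" "0 < e"
  defines "D \<equiv> \<lambda>u y. frechet_derivative F (at y) u"
  shows "\<exists>d>0. \<forall>t. 0 < t \<and> t < d \<longrightarrow>
    \<bar>(F (x + t *\<^sub>R u + t *\<^sub>R v) - F (x + t *\<^sub>R u) - F (x + t *\<^sub>R v) + F x) / t\<^sup>2 -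
      frechet_derivative (D u) (at x) v\<bar> < e"
proof -
  let ?H = "\<lambda>y. frechet_derivative (D u) (at y) v"
  have smD: "smooth_on U (D u)"
    unfolding D_def by (rule smooth_on_frechet_derivative[OF assms(2)])
  have "continuous_on U ?H"
    by (intro smooth_on_imp_continuous_on smooth_on_frechet_derivative smD)
  then have "isCont ?H x"
    using assms(1,3) continuous_on_eq_continuous_at by blast
  then obtain d1 where d1: "d1 > 0" "\<And>y. dist y x < d1 \<Longrightarrow> dist (?H y) (?H x) < e"
    unfolding continuous_at_eps_delta using assms(4) by blast
  obtain d2 where d2: "d2 > 0" "ball x d2 \<subseteq> U"
    using assms(1,3) open_contains_ball by blast
  \<comment> \<open>All points used below are \<open>x + a u + b v\<close> with \<open>a\<close> and
    \<open>b\<close> between 0 and \<open>t < d\<close>; this \<open>d\<close> keeps them within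
    \<open>min d1 d2\<close> of \<open>x\<close>. The summand 1 keeps the denominator
    positive.\<close>
  define d where "d = min d1 d2 / (norm u + norm v + 1)"
  have n1: "norm u + norm v + 1 > 0" by (smt (verit) norm_ge_zero)
  have d0: "d > 0" unfolding d_def using d1(1) d2(1) n1 by simp
  have near: "dist (x + a *\<^sub>R u + b *\<^sub>R v) x < min d1 d2" if "0 \<le> a" "a \<le> t" "0 \<le> b" "b \<le> t" "0 < t" "t < d" for a b t
  proof -
    have "dist (x + a *\<^sub>R u + b *\<^sub>R v) x = norm (a *\<^sub>R u + b *\<^sub>R v)"
      by (simp add: dist_norm)
    also have "\<dots> \<le> a * norm u + b * norm v"
      using norm_triangle_ineq[of "a *\<^sub>R u" "b *\<^sub>R v"] that by simp
    also have "\<dots> \<le> t * norm u + t * norm v"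
      using that by (intro add_mono mult_right_mono) auto
    also have "\<dots> \<le> t * (norm u + norm v + 1)"
      using that by (simp add: algebra_simps)
    also have "\<dots> < d * (norm u + norm v + 1)"
      using that n1 by (intro mult_strict_right_mono) auto
    also have "\<dots> = min d1 d2" unfolding d_def using n1 by simp
    finally show ?thesis .
  qed
  have inU: "x + a *\<^sub>R u + b *\<^sub>R v \<in> U" if "0 \<le> a" "a \<le> t" "0 \<le> b" "b \<le> t" "0 < t" "t < d" for a b t
  proof -
    have "x + a *\<^sub>R u + b *\<^sub>R v \<in> ball x d2"
      using near[OF that] by (simp add: dist_commute)
    then show ?thesis using d2(2) by blast
  qed
  have dF: "((\<lambda>s. F (x + s *\<^sub>R u + b *\<^sub>R v)) has_real_derivative D u (x + a *\<^sub>R u + b *\<^sub>R v)) (at a)"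
    if "x + a *\<^sub>R u + b *\<^sub>R v \<in> U" for a b
  proof -
    have "((\<lambda>s. x + s *\<^sub>R u + b *\<^sub>R v) has_vector_derivative u) (at a)"
      by (auto intro!: derivative_eq_intros)
    from vector_derivative_diff_chain_within[OF this has_derivative_at_withinI[OF smooth_on_has_derivative[OF assms(2) that]]]
    show ?thesis unfolding has_real_derivative_iff_has_vector_derivative D_def o_def .
  qed
  have dD: "((\<lambda>s. D u (x + a *\<^sub>R u + s *\<^sub>R v)) has_real_derivative ?H (x + a *\<^sub>R u + b *\<^sub>R v)) (at b)"
    if "x + a *\<^sub>R u + b *\<^sub>R v \<in> U" for a b
  proof -
    have "((\<lambda>s. x + a *\<^sub>R u + s *\<^sub>R v) has_vector_derivative v) (at b)"
      by (auto intro!: derivative_eq_intros)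
    from vector_derivative_diff_chain_within[OF this has_derivative_at_withinI[OF smooth_on_has_derivative[OF smD that]]]
    show ?thesis unfolding has_real_derivative_iff_has_vector_derivative o_def .
  qed
  have "\<bar>(F (x + t *\<^sub>R u + t *\<^sub>R v) - F (x + t *\<^sub>R u) - F (x + t *\<^sub>R v) + F x) / t\<^sup>2 - ?H x\<bar> < e"
    if t: "0 < t" "t < d" for t
  proof -
    \<comment> \<open>The second difference is an increment along \<open>u\<close> of an increment
      along \<open>v\<close>. The mean value theorem is applied first along \<open>u\<close>, then
      to \<open>D u\<close> along \<open>v\<close>.\<close>
    let ?f = "\<lambda>s. F (x + s *\<^sub>R u + t *\<^sub>R v) - F (x + s *\<^sub>R u + 0 *\<^sub>R v)"
    obtain s where s: "0 < s" "s < t"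
      "?f t - ?f 0 = (t - 0) * (D u (x + s *\<^sub>R u + t *\<^sub>R v) - D u (x + s *\<^sub>R u + 0 *\<^sub>R v))"
    proof (rule exE[OF MVT2[of 0 t ?f "\<lambda>s. D u (x + s *\<^sub>R u + t *\<^sub>R v) - D u (x + s *\<^sub>R u + 0 *\<^sub>R v)"]])
      show "(?f has_real_derivative D u (x + s *\<^sub>R u + t *\<^sub>R v) - D u (x + s *\<^sub>R u + 0 *\<^sub>R v)) (at s)"
        if "0 \<le> s" "s \<le> t" for s
        using that t by (intro DERIV_diff dF inU) auto
    qed (use t that in auto)
    obtain r where r: "0 < r" "r < t"
      "D u (x + s *\<^sub>R u + t *\<^sub>R v) - D u (x + s *\<^sub>R u + 0 *\<^sub>R v) = (t - 0) * ?H (x + s *\<^sub>R u + r *\<^sub>R v)"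
    proof (rule exE[OF MVT2[of 0 t "\<lambda>b. D u (x + s *\<^sub>R u + b *\<^sub>R v)" "\<lambda>b. ?H (x + s *\<^sub>R u + b *\<^sub>R v)"]])
      show "((\<lambda>b. D u (x + s *\<^sub>R u + b *\<^sub>R v)) has_real_derivative ?H (x + s *\<^sub>R u + b *\<^sub>R v)) (at b)"
        if "0 \<le> b" "b \<le> t" for b
        using that t s(1,2) by (intro dD inU) auto
    qed (use t that in auto)
    have "F (x + t *\<^sub>R u + t *\<^sub>R v) - F (x + t *\<^sub>R u) - F (x + t *\<^sub>R v) + F x
        = t\<^sup>2 * ?H (x + s *\<^sub>R u + r *\<^sub>R v)"
      using s(3) r(3) by (simp add: power2_eq_square)
    then have "(F (x + t *\<^sub>R u + t *\<^sub>R v) - F (x + t *\<^sub>R u) - F (x + t *\<^sub>R v) + F x) / t\<^sup>2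
        = ?H (x + s *\<^sub>R u + r *\<^sub>R v)"
      using t by simp
    moreover have "dist (x + s *\<^sub>R u + r *\<^sub>R v) x < d1"
      using near[of s t r] s r t by simp
    ultimately show ?thesis
      using d1(2) by (simp add: dist_real_def)
  qed
  then show ?thesis using d0 by blast
qed

lemma second_derivative_commute:
  fixes F :: "'a::euclidean_space \<Rightarrow> real"
  assumes "open U" "smooth_on U F" "x \<in> U"
  shows "frechet_derivative (\<lambda>y. frechet_derivative F (at y) u) (at x) v =
    frechet_derivative (\<lambda>y. frechet_derivative F (at y) v) (at x) u" (is "?a = ?b")
proof (rule ccontr)
  assume "?a \<noteq> ?b"
  then have e: "0 < \<bar>?a - ?b\<bar> / 2" by simp
  obtain d1 where d1: "d1 > 0" and *: "\<And>t. 0 < t \<and> t < d1 \<Longrightarrow>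
    \<bar>(F (x + t *\<^sub>R u + t *\<^sub>R v) - F (x + t *\<^sub>R u) - F (x + t *\<^sub>R v) + F x) / t\<^sup>2 - ?a\<bar> < \<bar>?a - ?b\<bar> / 2"
    using second_difference[OF assms e, of u v] by blast
  obtain d2 where d2: "d2 > 0" and **: "\<And>t. 0 < t \<and> t < d2 \<Longrightarrow>
    \<bar>(F (x + t *\<^sub>R v + t *\<^sub>R u) - F (x + t *\<^sub>R v) - F (x + t *\<^sub>R u) + F x) / t\<^sup>2 - ?b\<bar> < \<bar>?a - ?b\<bar> / 2"
    using second_difference[OF assms e, of v u] by blast
  define t where "t = min d1 d2 / 2"
  have t: "0 < t" "t < d1" "t < d2" using d1 d2 by (auto simp: t_def)
  define q where "q = (F (x + t *\<^sub>R u + t *\<^sub>R v) - F (x + t *\<^sub>R u) - F (x + t *\<^sub>R v) + F x) / t\<^sup>2"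
  have q: "q = (F (x + t *\<^sub>R v + t *\<^sub>R u) - F (x + t *\<^sub>R v) - F (x + t *\<^sub>R u) + F x) / t\<^sup>2"
    unfolding q_def by (simp add: algebra_simps)
  have "\<bar>q - ?a\<bar> < \<bar>?a - ?b\<bar> / 2"
    unfolding q_def using *[of t] t by blast
  moreover have "\<bar>q - ?b\<bar> < \<bar>?a - ?b\<bar> / 2"
    unfolding q using **[of t] t by blast
  ultimately show False by (smt (verit, best) field_sum_of_halves)
qed

section \<open>Determinants and inverses of smooth matrix functions\<close>

lemma smooth_on_det:
  fixes G :: "'a::euclidean_space \<Rightarrow> real^'k^'k"
  assumes "open U" "\<And>i j. smooth_on U (\<lambda>x. G x $ i $ j)"
  shows "smooth_on U (\<lambda>x. det (G x))"
  unfolding det_def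
proof (rule smooth_on_sum[OF assms(1)])
  show "smooth_on U (\<lambda>x. of_int (sign p) * (\<Prod>i\<in>UNIV. G x $ i $ p i))" for p
    by (rule smooth_on_bilinear[OF bounded_bilinear_mult assms(1) smooth_on_const smooth_on_prod[OF assms]])
qed

lemma matrix_inv_inverse:
  assumes "invertible M"
  shows "M ** matrix_inv M = mat 1" and "matrix_inv M ** M = mat 1"
  using someI_ex[OF assms[unfolded invertible_def]] by (simp_all add: matrix_inv_def)

text \<open>Cramer's rule for the right-hand side \<open>axis j 1\<close>. It writes the entries of
  the inverse as polynomials in the entries of \<open>M\<close> over \<open>det M\<close>, from
  which smoothness is read off.\<close>

lemma matrix_inv_entry:
  fixes M :: "real^'k^'k"
  assumes "det M \<noteq> 0"
  shows "matrix_inv M $ i $ j =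
    det (\<chi> a b. if b = i then axis j 1 $ a else M $ a $ b) * inverse (det M)"
proof -
  have "M ** matrix_inv M = mat 1"
    using assms by (simp add: invertible_det_nz matrix_inv_inverse)
  then have "M *v (matrix_inv M *v axis j 1) = axis j 1"
    by (simp add: matrix_vector_mul_assoc)
  then have "matrix_inv M *v axis j 1 =
      (\<chi> k. det (\<chi> a b. if b = k then axis j 1 $ a else M $ a $ b) / det M)"
    using cramer[OF assms] by blast
  then have "(matrix_inv M *v axis j 1) $ i =
      det (\<chi> a b. if b = i then axis j 1 $ a else M $ a $ b) / det M"
    by simp
  then show ?thesis
    by (simp add: matrix_vector_mult_basis column_def divide_inverse)
qed

lemma smooth_on_matrix_inv:
  fixes G :: "'a::euclidean_space \<Rightarrow> real^'k^'k"
  assumes "open U" "smooth_on U G" "\<And>x. x \<in> U \<Longrightarrow> det (G x) \<noteq> 0"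
  shows "smooth_on U (\<lambda>x. matrix_inv (G x))"
proof (intro smooth_on_vec assms(1))
  fix i j
  have G: "smooth_on U (\<lambda>x. G x $ i $ j)" for i j
    by (intro smooth_on_nth assms)
  have "smooth_on U (\<lambda>x. det (\<chi> a b. if b = i then axis j 1 $ a else G x $ a $ b))"
  proof (intro smooth_on_det assms(1))
    show "smooth_on U (\<lambda>x. (\<chi> a b. if b = i then axis j 1 $ a else G x $ a $ b) $ c $ d)" for c d
      using G by (cases "d = i") (auto intro: smooth_on_const)
  qed
  then have "smooth_on U (\<lambda>x. det (\<chi> a b. if b = i then axis j 1 $ a else G x $ a $ b) * inverse (det (G x)))"
    by (rule smooth_on_bilinear[OF bounded_bilinear_mult assms(1) _ smooth_on_inverse[OF assms(1,3) smooth_on_det[OF assms(1) G]]])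
  then show "smooth_on U (\<lambda>x. matrix_inv (G x) $ i $ j)"
    by (rule smooth_on_cong[OF assms(1), rotated]) (simp add: matrix_inv_entry assms(3))
qed

section \<open>Embedded submanifolds of a Euclidean space\<close>

text \<open>The vector-valued counterpart of \<open>mdiff\<close>. For a vector field it is the
  ambient derivative, whose tangential part will be the covariant derivative.\<close>

definition mderiv :: "'a::euclidean_space set \<Rightarrow> ('a \<Rightarrow> 'b::euclidean_space) \<Rightarrow> 'a \<Rightarrow> 'a \<Rightarrow> 'b" where
  "mderiv M Y x v =
     (THE d. \<forall>c. curve_through M x v c \<longrightarrow> ((\<lambda>t. Y (c t)) has_vector_derivative d) (at 0))"

lemma mdiff_eq_mderiv: "mdiff M f x v = mderiv M f x v"
  by (simp add: mdiff_def mderiv_def has_real_derivative_iff_has_vector_derivative)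

lemma extends_near_nearby: "extends_near M f x U F \<Longrightarrow> y \<in> U \<Longrightarrow> extends_near M f y U F"
  by (simp add: extends_near_def)

lemma extends_near_transfer:
  assumes "extends_near M f x U F" "open V" "x \<in> V" "\<And>y. y \<in> M \<Longrightarrow> y \<in> V \<Longrightarrow> f y = g y"
  shows "extends_near M g x (U \<inter> V) F"
  using assms smooth_on_subset[of U F "U \<inter> V"] by (auto simp: extends_near_def)

lemma extends_near_self: "open U \<Longrightarrow> smooth_on U F \<Longrightarrow> x \<in> U \<Longrightarrow> extends_near M F x U F"
  by (simp add: extends_near_def)

lemma extends_near_common:
  assumes "extends_near M f x U F" "extends_near M g x V G"
  shows "extends_near M f x (U \<inter> V) F" "extends_near M g x (U \<inter> V) G"
  using assms smooth_on_subset[of U F "U \<inter> V"] smooth_on_subset[of V G "U \<inter> V"]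
  by (auto simp: extends_near_def)

lemma extends_near_has_derivative:
  "extends_near M f x U F \<Longrightarrow> (F has_derivative frechet_derivative F (at x)) (at x)"
  unfolding extends_near_def by (blast intro: smooth_on_has_derivative)

lemma smooth_funE:
  assumes "smooth_fun M f" "x \<in> M"
  obtains U F where "extends_near M f x U F"
  using assms by (auto simp: smooth_fun_def)

lemma smooth_funE2:
  assumes "smooth_fun M f" "smooth_fun M g" "x \<in> M"
  obtains U F G where "extends_near M f x U F" "extends_near M g x U G"
proof -
  obtain U F where F: "extends_near M f x U F" using assms(1,3) by (rule smooth_funE)
  obtain V G where G: "extends_near M g x V G" using assms(2,3) by (rule smooth_funE)
  from extends_near_common[OF F G] show ?thesis by (rule that)
qed

lemma extends_near_imp_eq: "extends_near M f x U F \<Longrightarrow> y \<in> M \<Longrightarrow> y \<in> U \<Longrightarrow> F y = f y"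
  by (simp add: extends_near_def)

lemma curve_through_tendsto: "curve_through M x v c \<Longrightarrow> (c \<longlongrightarrow> x) (nhds 0)"
  unfolding curve_through_def
  using has_vector_derivative_continuous[of c v 0 UNIV]
  by (metis continuous_within isCont_def tendsto_at_iff_tendsto_nhds)

text \<open>Near time 0 the curve stays in \<open>U\<close> and in \<open>M\<close>, where
  \<open>F\<close> and \<open>Y\<close> agree, so the chain rule for \<open>F\<close> applies. The
  result depends on the curve only through its velocity, which makes \<open>mderiv\<close> well
  defined.\<close>

lemma extends_near_curve:
  assumes "extends_near M Y x U F" "curve_through M x v c"
  shows "((\<lambda>t. Y (c t)) has_vector_derivative frechet_derivative F (at x) v) (at 0)"
proof -
  have c: "c 0 = x" "(c has_vector_derivative v) (at 0)" "\<forall>\<^sub>F t in nhds 0. c t \<in> M"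
    using assms(2) by (auto simp: curve_through_def)
  have "((F \<circ> c) has_vector_derivative frechet_derivative F (at x) v) (at 0)"
    using vector_derivative_diff_chain_within[OF c(2), of F "frechet_derivative F (at x)"]
      extends_near_has_derivative[OF assms(1)] c(1) has_derivative_at_withinI by auto
  moreover have "\<forall>\<^sub>F t in nhds 0. c t \<in> U"
    using curve_through_tendsto[OF assms(2)] assms(1)
    by (auto simp: extends_near_def dest: topological_tendstoD)
  then have ev: "\<forall>\<^sub>F t in nhds 0. (F \<circ> c) t = Y (c t)"
    using c(3) by eventually_elim (use extends_near_imp_eq[OF assms(1)] in simp)
  then have "\<forall>\<^sub>F t in at 0. (F \<circ> c) t = Y (c t)" and "(F \<circ> c) 0 = Y (c 0)"
    by (auto simp: eventually_at_filter eventually_mono dest: eventually_nhds_x_imp_x)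
  ultimately show ?thesis
    unfolding has_vector_derivative_def
    by (rule has_derivative_transform_eventually) simp
qed

text \<open>One curve with velocity \<open>v\<close> suffices to compute \<open>mderiv\<close>. The
  disjunction serves fields smooth on all of \<open>M\<close> as well as maps with a known extension
  near \<open>x\<close> only.\<close>

lemma mderiv_eq:
  assumes "smooth_fun M Y \<or> extends_near M Y x U F" "x \<in> M" "curve_through M x v c"
    "((\<lambda>t. Y (c t)) has_vector_derivative d) (at 0)"
  shows "mderiv M Y x v = d"
proof -
  obtain U F where UF: "extends_near M Y x U F"
    using assms(1,2) by (auto simp: smooth_fun_def)
  have d: "d = frechet_derivative F (at x) v"
    using vector_derivative_unique_at[OF assms(4) extends_near_curve[OF UF assms(3)]] .
  show ?thesis
    unfolding mderiv_def d
  proof (rule the_equality)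
    show "\<forall>c. curve_through M x v c \<longrightarrow>
        ((\<lambda>t. Y (c t)) has_vector_derivative frechet_derivative F (at x) v) (at 0)"
      using extends_near_curve[OF UF] by blast
    show "d' = frechet_derivative F (at x) v"
      if "\<forall>c. curve_through M x v c \<longrightarrow> ((\<lambda>t. Y (c t)) has_vector_derivative d') (at 0)" for d'
      using vector_derivative_unique_at[OF that[rule_format, OF assms(3)] extends_near_curve[OF UF assms(3)]] .
  qed
qed

lemma mderiv_eq_frechet_derivative:
  assumes "extends_near M Y x U F" "x \<in> M" "v \<in> tangent_space M x"
  shows "mderiv M Y x v = frechet_derivative F (at x) v"
  using assms(3) mderiv_eq[OF disjI2[OF assms(1)] assms(2)] extends_near_curve[OF assms(1)]
  by (auto simp: tangent_space_def)

lemma curve_has_mderiv: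
  assumes "smooth_fun M Y" "x \<in> M" "curve_through M x v c"
  shows "((\<lambda>t. Y (c t)) has_vector_derivative mderiv M Y x v) (at 0)"
proof -
  obtain U F where "extends_near M Y x U F"
    using assms(1,2) by (auto simp: smooth_fun_def)
  note Y = extends_near_curve[OF this assms(3)]
  show ?thesis
    unfolding mderiv_eq[OF disjI1[OF assms(1)] assms(2,3) Y] by (rule Y)
qed

text \<open>Adding curves leaves \<open>M\<close>, so linearity in the direction is not visible from
  the definition; it is inherited from the Frechet derivative of an extension.\<close>

lemma mderiv_linear:
  assumes "smooth_fun M Y" "x \<in> M" "u \<in> tangent_space M x" "v \<in> tangent_space M x"
    "subspace (tangent_space M x)"
  shows "mderiv M Y x (a *\<^sub>R u + b *\<^sub>R v) = a *\<^sub>R mderiv M Y x u + b *\<^sub>R mderiv M Y x v"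
proof -
  obtain U F where UF: "extends_near M Y x U F"
    using assms(1,2) by (auto simp: smooth_fun_def)
  have lin: "linear (frechet_derivative F (at x))"
    by (rule has_derivative_linear[OF extends_near_has_derivative[OF UF]])
  have "a *\<^sub>R u + b *\<^sub>R v \<in> tangent_space M x"
    using assms by (intro subspace_add subspace_scale)
  then show ?thesis
    using mderiv_eq_frechet_derivative[OF UF assms(2)] assms(3,4)
    by (simp add: linear_add[OF lin] linear_scale[OF lin])
qed

section \<open>Euclidean gradients and iterated derivatives along fields\<close>

lemma eucl_grad_inner:
  assumes "(F has_derivative F') (at x)"
  shows "eucl_grad F x = (\<Sum>b\<in>Basis. F' b *\<^sub>R b)" and "v \<bullet> eucl_grad F x = F' v"
proof -
  let ?D = "\<Sum>b\<in>Basis. F' b *\<^sub>R b"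
  have *: "v \<bullet> ?D = F' v" for v
    using frechet_derivative_eq_sum_Basis[OF assms, of v] by (simp add: inner_sum_right mult.commute)
  then have "GDERIV F x :> ?D"
    using assms by (simp add: gderiv_def)
  moreover have "D = ?D" if "GDERIV F x :> D" for D
  proof -
    have "v \<bullet> D = v \<bullet> ?D" for v
      using has_derivative_unique[OF that[unfolded gderiv_def] assms] * by metis
    then show ?thesis by (metis vector_eq_ldot)
  qed
  ultimately show "eucl_grad F x = ?D"
    unfolding eucl_grad_def by (rule the_equality)
  then show "v \<bullet> eucl_grad F x = F' v" using * by simp
qed

lemma smooth_on_eucl_grad:
  assumes "open U" "smooth_on U F"
  shows "smooth_on U (eucl_grad F)"
proof (rule smooth_on_cong[OF assms(1)])
  show "(\<Sum>b\<in>Basis. frechet_derivative F (at x) b *\<^sub>R b) = eucl_grad F x" if "x \<in> U" for x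
    using eucl_grad_inner(1)[OF smooth_on_has_derivative[OF assms(2) that]] by simp
  show "smooth_on U (\<lambda>x. \<Sum>b\<in>Basis. frechet_derivative F (at x) b *\<^sub>R b)"
  proof (rule smooth_on_sum[OF assms(1)])
    show "smooth_on U (\<lambda>x. frechet_derivative F (at x) b *\<^sub>R b)" for b
      by (rule smooth_on_scaleR[OF assms(1) smooth_on_frechet_derivative[OF assms(2)] smooth_on_const])
  qed
qed

text \<open>The product rule for \<open>DH(y)(G y)\<close>: one term freezes the direction at
  \<open>G x\<close>, the other differentiates it. A basis expansion turns the expression into a
  finite sum of ordinary products.\<close>

lemma frechet_derivative_along_field:
  assumes "open U" "smooth_on U H" "smooth_on U G" "x \<in> U"
  shows "frechet_derivative (\<lambda>y. frechet_derivative H (at y) (G y)) (at x) v =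
    frechet_derivative (\<lambda>y. frechet_derivative H (at y) (G x)) (at x) v +
    frechet_derivative H (at x) (frechet_derivative G (at x) v)"
proof -
  let ?D = "\<lambda>b y. frechet_derivative H (at y) b"
  have expand: "?D w y = (\<Sum>b\<in>Basis. (w \<bullet> b) *\<^sub>R ?D b y)" if "y \<in> U" for y w
    by (rule frechet_derivative_eq_sum_Basis[OF smooth_on_has_derivative[OF assms(2) that]])
  have dD: "(?D b has_derivative frechet_derivative (?D b) (at x)) (at x)" for b
    by (rule smooth_on_has_derivative[OF smooth_on_frechet_derivative[OF assms(2)] assms(4)])
  have dG: "(G has_derivative frechet_derivative G (at x)) (at x)"
    by (rule smooth_on_has_derivative[OF assms(3,4)])
  have "((\<lambda>y. \<Sum>b\<in>Basis. (G y \<bullet> b) *\<^sub>R ?D b y) has_derivative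
      (\<lambda>v. \<Sum>b\<in>Basis. (G x \<bullet> b) *\<^sub>R frechet_derivative (?D b) (at x) v +
        (frechet_derivative G (at x) v \<bullet> b) *\<^sub>R ?D b x)) (at x)"
    by (intro has_derivative_sum has_derivative_scaleR has_derivative_inner_left dD dG)
  then have "((\<lambda>y. frechet_derivative H (at y) (G y)) has_derivative
      (\<lambda>v. \<Sum>b\<in>Basis. (G x \<bullet> b) *\<^sub>R frechet_derivative (?D b) (at x) v +
        (frechet_derivative G (at x) v \<bullet> b) *\<^sub>R ?D b x)) (at x)"
    by (rule has_derivative_transform_within_open[OF _ assms(1,4)]) (rule expand[symmetric])
  then have "frechet_derivative (\<lambda>y. frechet_derivative H (at y) (G y)) (at x) v =
      (\<Sum>b\<in>Basis. (G x \<bullet> b) *\<^sub>R frechet_derivative (?D b) (at x) v) +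
      (\<Sum>b\<in>Basis. (frechet_derivative G (at x) v \<bullet> b) *\<^sub>R ?D b x)"
    by (simp add: frechet_derivative_at[symmetric] sum.distrib)
  also have "(\<Sum>b\<in>Basis. (frechet_derivative G (at x) v \<bullet> b) *\<^sub>R ?D b x) =
      frechet_derivative H (at x) (frechet_derivative G (at x) v)"
    by (rule expand[OF assms(4), symmetric])
  also have "(\<Sum>b\<in>Basis. (G x \<bullet> b) *\<^sub>R frechet_derivative (?D b) (at x) v) =
      frechet_derivative (\<lambda>y. frechet_derivative H (at y) (G x)) (at x) v"
  proof -
    have "((\<lambda>y. \<Sum>b\<in>Basis. (G x \<bullet> b) *\<^sub>R ?D b y) has_derivative
        (\<lambda>v. \<Sum>b\<in>Basis. (G x \<bullet> b) *\<^sub>R frechet_derivative (?D b) (at x) v)) (at x)"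
      by (intro has_derivative_sum has_derivative_scaleR_right dD)
    then have "(?D (G x) has_derivative
        (\<lambda>v. \<Sum>b\<in>Basis. (G x \<bullet> b) *\<^sub>R frechet_derivative (?D b) (at x) v)) (at x)"
      by (rule has_derivative_transform_within_open[OF _ assms(1,4)]) (rule expand[symmetric])
    then show ?thesis by (simp add: frechet_derivative_at[symmetric])
  qed
  finally show ?thesis .
qed

text \<open>In place of charts, the properties that the induced Riemannian geometry rests on:
  orthogonal projections \<open>P x\<close> onto the tangent spaces that preserve smoothness of
  fields, and tangency of the bracket, the source of torsion-freeness.\<close>

locale embedded_submanifold =
  fixes M :: "'a::euclidean_space set" and P :: "'a \<Rightarrow> 'a \<Rightarrow> 'a"
  assumes subspace_tangent: "x \<in> M \<Longrightarrow> subspace (tangent_space M x)"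
    and proj_tangent: "x \<in> M \<Longrightarrow> P x w \<in> tangent_space M x"
    and proj_inner: "x \<in> M \<Longrightarrow> v \<in> tangent_space M x \<Longrightarrow> P x w \<bullet> v = w \<bullet> v"
    and proj_smooth: "x \<in> M \<Longrightarrow> extends_near M Z x U G \<Longrightarrow>
      \<exists>U' G'. extends_near M (\<lambda>y. P y (Z y)) x U' G'"
    and bracket_tangent: "X \<in> vector_fields M \<Longrightarrow> Y \<in> vector_fields M \<Longrightarrow> x \<in> M \<Longrightarrow>
      mderiv M Y x (X x) - mderiv M X x (Y x) \<in> tangent_space M x"
begin

lemma proj_unique:
  assumes "x \<in> M" "u \<in> tangent_space M x" "\<And>v. v \<in> tangent_space M x \<Longrightarrow> u \<bullet> v = w \<bullet> v"
  shows "P x w = u"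
proof -
  have T: "P x w - u \<in> tangent_space M x"
    by (intro subspace_diff[OF subspace_tangent] proj_tangent assms(1,2))
  have "(P x w - u) \<bullet> (P x w - u) = 0"
    using proj_inner[OF assms(1) T, of w] assms(3)[OF T] by (simp add: inner_diff_left)
  then show ?thesis by simp
qed

lemma proj_tangent_eq: "x \<in> M \<Longrightarrow> v \<in> tangent_space M x \<Longrightarrow> P x v = v"
  by (rule proj_unique) auto

lemma proj_linear: "x \<in> M \<Longrightarrow> P x (a *\<^sub>R u + b *\<^sub>R w) = a *\<^sub>R P x u + b *\<^sub>R P x w"
  by (rule proj_unique)
    (auto intro!: subspace_add[OF subspace_tangent] subspace_scale[OF subspace_tangent] proj_tangent
      simp: inner_add_left proj_inner)

lemma proj_diff: "x \<in> M \<Longrightarrow> P x (u - w) = P x u - P x w"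
  using proj_linear[of x 1 u "-1" w] by simp

lemma vector_fieldsD:
  assumes "X \<in> vector_fields M"
  shows "smooth_fun M X" "\<And>x. x \<in> M \<Longrightarrow> X x \<in> tangent_space M x"
  using assms by (auto simp: vector_fields_def)

text \<open>Projecting a constant extends a tangent vector at one point to a vector field on all of
  \<open>M\<close>, so pointwise claims can be tested with fields.\<close>

lemma proj_const_field: "(\<lambda>y. P y v) \<in> vector_fields M"
  unfolding vector_fields_def smooth_fun_def
  using proj_smooth[OF _ extends_near_self[OF open_UNIV smooth_on_const]] proj_tangent by fastforce

abbreviation gI :: "'a \<Rightarrow> 'a \<Rightarrow> 'a \<Rightarrow> real" where
  "gI \<equiv> (\<lambda>_. inner)"

lemma riem_grad_eq:
  assumes "x \<in> M" "extends_near M f x U F"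
  shows "riem_grad M gI f x = P x (eucl_grad F x)"
proof -
  have "mdiff M f x v = eucl_grad F x \<bullet> v" if "v \<in> tangent_space M x" for v
    using mderiv_eq_frechet_derivative[OF assms(2,1) that]
      eucl_grad_inner(2)[OF extends_near_has_derivative[OF assms(2)], of v]
    by (simp add: mdiff_eq_mderiv inner_commute)
  then show ?thesis
    unfolding riem_grad_def
    by (intro the_equality) (auto simp: proj_tangent proj_inner assms(1) intro!: proj_unique[OF assms(1), symmetric])
qed

text \<open>The Hessian differentiates the gradient, so the projection formula must hold at all
  points of \<open>M\<close> near \<open>x\<close>; \<open>F\<close> extends \<open>f\<close> at
  each of those in \<open>U\<close>.\<close>

lemma riem_grad_extends_near:
  assumes "x \<in> M" "extends_near M f x U F" "extends_near M (\<lambda>y. P y (eucl_grad F y)) x V G"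
  shows "extends_near M (riem_grad M gI f) x (V \<inter> U) G"
  using assms(3)
proof (rule extends_near_transfer)
  show "open U" "x \<in> U" using assms(2) by (auto simp: extends_near_def)
  show "P y (eucl_grad F y) = riem_grad M gI f y" if "y \<in> M" "y \<in> U" for y
    using riem_grad_eq[OF that(1) extends_near_nearby[OF assms(2) that(2)]] by simp
qed

lemma riem_grad_field:
  assumes "smooth_fun M f"
  shows "riem_grad M gI f \<in> vector_fields M"
proof -
  have "(\<exists>V G. extends_near M (riem_grad M gI f) x V G) \<and> riem_grad M gI f x \<in> tangent_space M x"
    if x: "x \<in> M" for x
  proof -
    obtain U F where UF: "extends_near M f x U F"
      using assms x by (auto simp: smooth_fun_def)
    have "extends_near M (eucl_grad F) x U (eucl_grad F)"
      using UF smooth_on_eucl_grad by (intro extends_near_self) (auto simp: extends_near_def)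
    then obtain V G where "extends_near M (\<lambda>y. P y (eucl_grad F y)) x V G"
      using proj_smooth[OF x] by blast
    from riem_grad_extends_near[OF x UF this] show ?thesis
      using riem_grad_eq[OF x UF] proj_tangent[OF x] by auto
  qed
  then show ?thesis by (simp add: vector_fields_def smooth_fun_def)
qed

text \<open>The connection of the Gauss formula, the candidate for the Levi-Civita
  connection.\<close>

definition proj_deriv :: "('a \<Rightarrow> 'a) \<Rightarrow> ('a \<Rightarrow> 'a) \<Rightarrow> 'a \<Rightarrow> 'a" where
  "proj_deriv X Y x = P x (mderiv M Y x (X x))"

lemma mderiv_field_extends_near:
  assumes "\<And>y. y \<in> M \<Longrightarrow> X y \<in> tangent_space M y"
    "extends_near M X x U F" "extends_near M Y x U G"
  shows "extends_near M (\<lambda>y. mderiv M Y y (X y)) x U (\<lambda>y. frechet_derivative G (at y) (F y))"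
  using assms mderiv_eq_frechet_derivative[OF extends_near_nearby[OF assms(3)]]
  by (auto simp: extends_near_def intro: smooth_on_frechet_derivative_apply)

lemma proj_deriv_field:
  assumes "X \<in> vector_fields M" "Y \<in> vector_fields M"
  shows "proj_deriv X Y \<in> vector_fields M"
proof -
  have "\<exists>V G. extends_near M (proj_deriv X Y) x V G" if x: "x \<in> M" for x
  proof -
    obtain V F G where "extends_near M X x V F" "extends_near M Y x V G"
      using assms[THEN vector_fieldsD(1)] x by (rule smooth_funE2)
    from mderiv_field_extends_near[OF vector_fieldsD(2)[OF assms(1)] this]
    show ?thesis
      unfolding proj_deriv_def using proj_smooth[OF x] by blast
  qed
  then show ?thesis
    by (simp add: vector_fields_def smooth_fun_def proj_deriv_def proj_tangent)
qed

section \<open>Sum and product rules on the submanifold\<close>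

lemma tangent_curve: "v \<in> tangent_space M x \<Longrightarrow> (\<And>c. curve_through M x v c \<Longrightarrow> thesis) \<Longrightarrow> thesis"
  by (auto simp: tangent_space_def)

lemma smooth_fun_bilinear:
  fixes f :: "'a \<Rightarrow> 'b::euclidean_space" and g :: "'a \<Rightarrow> 'c::euclidean_space"
    and prod :: "'b \<Rightarrow> 'c \<Rightarrow> 'd::euclidean_space"
  assumes "bounded_bilinear prod" "smooth_fun M f" "smooth_fun M g"
  shows "smooth_fun M (\<lambda>x. prod (f x) (g x))"
  unfolding smooth_fun_def
proof
  fix x assume x: "x \<in> M"
  obtain V F G where "extends_near M f x V F" "extends_near M g x V G"
    using assms(2,3) x by (rule smooth_funE2)
  then have "extends_near M (\<lambda>x. prod (f x) (g x)) x V (\<lambda>x. prod (F x) (G x))"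
    using smooth_on_bilinear[OF assms(1)] by (auto simp: extends_near_def)
  then show "\<exists>U H. extends_near M (\<lambda>x. prod (f x) (g x)) x U H" by blast
qed

lemma smooth_fun_add:
  fixes f g :: "'a \<Rightarrow> 'b::euclidean_space"
  assumes "smooth_fun M f" "smooth_fun M g"
  shows "smooth_fun M (\<lambda>x. f x + g x)"
  unfolding smooth_fun_def
proof
  fix x assume x: "x \<in> M"
  obtain V F G where "extends_near M f x V F" "extends_near M g x V G"
    using assms x by (rule smooth_funE2)
  then have "extends_near M (\<lambda>x. f x + g x) x V (\<lambda>x. F x + G x)"
    using smooth_on_add by (auto simp: extends_near_def)
  then show "\<exists>U H. extends_near M (\<lambda>x. f x + g x) x U H" by blast
qed

lemma mderiv_bilinear:
  fixes f :: "'a \<Rightarrow> 'b::euclidean_space" and g :: "'a \<Rightarrow> 'c::euclidean_space"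
    and prod :: "'b \<Rightarrow> 'c \<Rightarrow> 'd::euclidean_space"
  assumes "bounded_bilinear prod" "smooth_fun M f" "smooth_fun M g" "x \<in> M" "v \<in> tangent_space M x"
  shows "mderiv M (\<lambda>x. prod (f x) (g x)) x v = prod (f x) (mderiv M g x v) + prod (mderiv M f x v) (g x)"
proof -
  obtain c where c: "curve_through M x v c"
    using assms(5) by (rule tangent_curve)
  have c0: "c 0 = x" using c by (simp add: curve_through_def)
  show ?thesis
    using mderiv_eq[OF disjI1[OF smooth_fun_bilinear[OF assms(1-3)]] assms(4) c]
      bounded_bilinear.has_vector_derivative[OF assms(1) curve_has_mderiv[OF assms(2,4) c]
        curve_has_mderiv[OF assms(3,4) c]] c0 by simp
qed

lemma mderiv_add:
  fixes f g :: "'a \<Rightarrow> 'b::euclidean_space"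
  assumes "smooth_fun M f" "smooth_fun M g" "x \<in> M" "v \<in> tangent_space M x"
  shows "mderiv M (\<lambda>x. f x + g x) x v = mderiv M f x v + mderiv M g x v"
proof -
  obtain c where c: "curve_through M x v c"
    using assms(4) by (rule tangent_curve)
  show ?thesis
    using mderiv_eq[OF disjI1[OF smooth_fun_add[OF assms(1,2)]] assms(3) c
      has_vector_derivative_add[OF curve_has_mderiv[OF assms(1,3) c] curve_has_mderiv[OF assms(2,3) c]]] .
qed

lemma smooth_fun_linear: "bounded_linear T \<Longrightarrow> smooth_fun M T"
  unfolding smooth_fun_def using extends_near_self[OF open_UNIV smooth_on_linear[OF open_UNIV]] by blast

lemma smooth_fun_const: "smooth_fun M (\<lambda>_. c)"
  unfolding smooth_fun_def using extends_near_self[OF open_UNIV smooth_on_const] by blast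

lemma mderiv_linear_map:
  assumes "bounded_linear T" "x \<in> M" "v \<in> tangent_space M x"
  shows "mderiv M T x v = T v"
  using mderiv_eq_frechet_derivative[OF extends_near_self[OF open_UNIV smooth_on_linear[OF open_UNIV assms(1)]] assms(2,3)]
    frechet_derivative_at[OF bounded_linear_imp_has_derivative[OF assms(1)]] by simp

lemma mderiv_const: "x \<in> M \<Longrightarrow> v \<in> tangent_space M x \<Longrightarrow> mderiv M (\<lambda>_. c) x v = 0"
  using mderiv_eq_frechet_derivative[OF extends_near_self[OF open_UNIV smooth_on_const]] by simp

section \<open>The projected derivative is the Levi-Civita connection\<close>

lemma affine_connection_proj_deriv: "affine_connection M proj_deriv"
proof -
  have 1: "proj_deriv (\<lambda>y. h y *\<^sub>R X y + h' y *\<^sub>R X' y) Y x =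
      h x *\<^sub>R proj_deriv X Y x + h' x *\<^sub>R proj_deriv X' Y x"
    if "X \<in> vector_fields M" "X' \<in> vector_fields M" "Y \<in> vector_fields M" "x \<in> M" for X X' Y h h' x
    using that mderiv_linear[OF vector_fieldsD(1)[OF that(3)] that(4) vector_fieldsD(2)[OF that(1)]
        vector_fieldsD(2)[OF that(2)] subspace_tangent]
    by (simp add: proj_deriv_def proj_linear)
  have 2: "proj_deriv X (\<lambda>y. a *\<^sub>R Y y + b *\<^sub>R Y' y) x =
      a *\<^sub>R proj_deriv X Y x + b *\<^sub>R proj_deriv X Y' x"
    if "X \<in> vector_fields M" "Y \<in> vector_fields M" "Y' \<in> vector_fields M" "x \<in> M" for X Y Y' a b x
  proof -
    have T: "X x \<in> tangent_space M x" using that by (intro vector_fieldsD)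
    have sc: "smooth_fun M (\<lambda>y. r *\<^sub>R Z y)" "mderiv M (\<lambda>y. r *\<^sub>R Z y) x (X x) = r *\<^sub>R mderiv M Z x (X x)"
      if "smooth_fun M Z" for r and Z :: "'a \<Rightarrow> 'a"
      using smooth_fun_bilinear[OF bounded_bilinear_scaleR smooth_fun_const that]
        mderiv_bilinear[OF bounded_bilinear_scaleR smooth_fun_const that \<open>x \<in> M\<close> T]
        mderiv_const[OF \<open>x \<in> M\<close> T, of r] by simp_all
    show ?thesis
      using that T by (simp add: proj_deriv_def mderiv_add sc vector_fieldsD(1) proj_linear)
  qed
  have 3: "proj_deriv X (\<lambda>y. h y *\<^sub>R Y y) x = h x *\<^sub>R proj_deriv X Y x + mdiff M h x (X x) *\<^sub>R Y x"
    if "X \<in> vector_fields M" "Y \<in> vector_fields M" "smooth_fun M h" "x \<in> M" for X Y h x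
    using mderiv_bilinear[OF bounded_bilinear_scaleR that(3) vector_fieldsD(1)[OF that(2)] that(4)
        vector_fieldsD(2)[OF that(1,4)]] that(4)
      proj_tangent_eq[OF that(4) vector_fieldsD(2)[OF that(2,4)]]
    by (simp add: proj_deriv_def proj_linear mdiff_eq_mderiv)
  show ?thesis
    unfolding affine_connection_def
    by (intro conjI ballI allI impI proj_deriv_field 1 2 3)
qed

text \<open>The Leibniz rule yields ambient derivatives, and pairing with a tangent vector does not
  see their normal parts.\<close>

lemma metric_compatible_proj_deriv: "metric_compatible M gI proj_deriv"
  unfolding metric_compatible_def
proof (intro ballI)
  fix X Y Z x assume XYZ: "X \<in> vector_fields M" "Y \<in> vector_fields M" "Z \<in> vector_fields M" and x: "x \<in> M"
  have "mdiff M (\<lambda>y. Y y \<bullet> Z y) x (X x) = Y x \<bullet> mderiv M Z x (X x) + mderiv M Y x (X x) \<bullet> Z x"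
    unfolding mdiff_eq_mderiv using XYZ x
    by (intro mderiv_bilinear[OF bounded_bilinear_inner] vector_fieldsD)
  then show "mdiff M (\<lambda>y. Y y \<bullet> Z y) x (X x) = proj_deriv X Y x \<bullet> Z x + Y x \<bullet> proj_deriv X Z x"
    using proj_inner[OF x vector_fieldsD(2)[OF XYZ(3) x]] proj_inner[OF x vector_fieldsD(2)[OF XYZ(2) x]]
    by (simp add: proj_deriv_def inner_commute)
qed

text \<open>In \<open>X (Y h) - Y (X h)\<close> the second derivatives of the extension
  \<open>H\<close> cancel by symmetry, leaving its derivative along the bracket. The bracket is
  tangent, hence fixed by the projection in \<open>proj_deriv\<close>.\<close>

lemma torsion_free_proj_deriv: "torsion_free M proj_deriv"
  unfolding torsion_free_def
proof (intro ballI allI impI)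
  fix X Y x and h :: "'a \<Rightarrow> real"
  assume XY: "X \<in> vector_fields M" "Y \<in> vector_fields M" and h: "smooth_fun M h" and x: "x \<in> M"
  obtain U1 F G where F1: "extends_near M X x U1 F" and G1: "extends_near M Y x U1 G"
    using XY[THEN vector_fieldsD(1)] x by (rule smooth_funE2)
  obtain U2 H where H1: "extends_near M h x U2 H"
    using h x by (rule smooth_funE)
  define U where "U = U1 \<inter> U2"
  have F: "extends_near M X x U F" and G: "extends_near M Y x U G" and H: "extends_near M h x U H"
    unfolding U_def using extends_near_common[OF F1 H1] extends_near_common[OF G1 H1] by simp_all
  have U: "open U" "x \<in> U" "smooth_on U F" "smooth_on U G" "smooth_on U H"
    using F G H by (auto simp: extends_near_def)
  have Tx: "X x \<in> tangent_space M x" "Y x \<in> tangent_space M x"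
    using XY x by (auto intro: vector_fieldsD)
  have eq: "F x = X x" "G x = Y x"
    using extends_near_imp_eq F G x U(2) by blast+
  let ?b = "mderiv M Y x (X x) - mderiv M X x (Y x)"
  have b: "?b = frechet_derivative G (at x) (X x) - frechet_derivative F (at x) (Y x)"
    using mderiv_eq_frechet_derivative[OF G x Tx(1)] mderiv_eq_frechet_derivative[OF F x Tx(2)] by simp
  have lin: "linear (frechet_derivative H (at x))"
    by (rule has_derivative_linear[OF extends_near_has_derivative[OF H]])
  have "mdiff M h x (proj_deriv X Y x) - mdiff M h x (proj_deriv Y X x) =
      frechet_derivative H (at x) (P x (mderiv M Y x (X x))) - frechet_derivative H (at x) (P x (mderiv M X x (Y x)))"
    using mderiv_eq_frechet_derivative[OF H x proj_tangent[OF x]]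
    by (simp add: mdiff_eq_mderiv proj_deriv_def)
  also have "\<dots> = frechet_derivative H (at x) (P x ?b)"
    by (simp add: linear_diff[OF lin] proj_diff[OF x])
  also have "\<dots> = frechet_derivative H (at x) ?b"
    using proj_tangent_eq[OF x bracket_tangent[OF XY x]] by simp
  finally have lhs: "mdiff M h x (proj_deriv X Y x) - mdiff M h x (proj_deriv Y X x) = frechet_derivative H (at x) ?b" .
  have 1: "mdiff M (\<lambda>y. mdiff M h y (Y y)) x (X x) =
      frechet_derivative (\<lambda>y. frechet_derivative H (at y) (Y x)) (at x) (X x) +
      frechet_derivative H (at x) (frechet_derivative G (at x) (X x))"
    using mderiv_eq_frechet_derivative[OF mderiv_field_extends_near[OF vector_fieldsD(2)[OF XY(2)] G H] x Tx(1)]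
      frechet_derivative_along_field[OF U(1,5,4,2), of "X x"] eq by (simp add: mdiff_eq_mderiv)
  have 2: "mdiff M (\<lambda>y. mdiff M h y (X y)) x (Y x) =
      frechet_derivative (\<lambda>y. frechet_derivative H (at y) (X x)) (at x) (Y x) +
      frechet_derivative H (at x) (frechet_derivative F (at x) (Y x))"
    using mderiv_eq_frechet_derivative[OF mderiv_field_extends_near[OF vector_fieldsD(2)[OF XY(1)] F H] x Tx(2)]
      frechet_derivative_along_field[OF U(1,5,3,2), of "Y x"] eq by (simp add: mdiff_eq_mderiv)
  show "mdiff M h x (proj_deriv X Y x) - mdiff M h x (proj_deriv Y X x) =
      mdiff M (\<lambda>y. mdiff M h y (Y y)) x (X x) - mdiff M (\<lambda>y. mdiff M h y (X y)) x (Y x)"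
    unfolding lhs 1 2 b
    using second_derivative_commute[OF U(1,5,2), of "Y x" "X x"] by (simp add: linear_diff[OF lin])
qed

text \<open>The difference of two such connections is a trilinear form that is symmetric in the first
  and skew in the last two arguments, hence zero.\<close>

lemma levi_civita_unique:
  assumes D: "affine_connection M D" "torsion_free M D" "metric_compatible M gI D"
    and XY: "X \<in> vector_fields M" "Y \<in> vector_fields M" and x: "x \<in> M"
  shows "D X Y x = proj_deriv X Y x"
proof -
  let ?V = "vector_fields M"
  let ?S = "\<lambda>X Y. D X Y x - proj_deriv X Y x"
  have T: "D X Y x \<in> tangent_space M x" if "X \<in> ?V" "Y \<in> ?V" for X Y
    using D(1) that x vector_fieldsD(2) unfolding affine_connection_def by blast
  have T0: "proj_deriv X Y x \<in> tangent_space M x" for X Y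
    by (simp add: proj_deriv_def proj_tangent x)
  have sym: "?S X Y = ?S Y X" if "X \<in> ?V" "Y \<in> ?V" for X Y
  proof -
    have "u \<bullet> ?S X Y = u \<bullet> ?S Y X" for u
    proof -
      \<comment> \<open>Torsion-freeness compares vectors only through derivatives of functions;
        linear functionals are test functions that separate vectors.\<close>
      have md: "mdiff M (inner u) x w = u \<bullet> w" if "w \<in> tangent_space M x" for w
        unfolding mdiff_eq_mderiv by (rule mderiv_linear_map[OF bounded_linear_inner_right x that])
      have "mdiff M (inner u) x (D X Y x) - mdiff M (inner u) x (D Y X x) =
          mdiff M (inner u) x (proj_deriv X Y x) - mdiff M (inner u) x (proj_deriv Y X x)"
        using D(2) torsion_free_proj_deriv that x smooth_fun_linear[OF bounded_linear_inner_right[of u]]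
        unfolding torsion_free_def by simp
      then show ?thesis
        using T[OF that] T[OF that(2,1)] T0 by (simp add: md inner_diff_right)
    qed
    then show ?thesis by (metis vector_eq_ldot)
  qed
  have skew: "?S X Y \<bullet> Z x = - (?S X Z \<bullet> Y x)" if "X \<in> ?V" "Y \<in> ?V" "Z \<in> ?V" for X Y Z
  proof -
    have "D X Y x \<bullet> Z x + Y x \<bullet> D X Z x = proj_deriv X Y x \<bullet> Z x + Y x \<bullet> proj_deriv X Z x"
      using D(3)[unfolded metric_compatible_def, rule_format, OF that x]
        metric_compatible_proj_deriv[unfolded metric_compatible_def, rule_format, OF that x] by simp
    then show ?thesis by (simp add: inner_diff_left inner_diff_right inner_commute)
  qed
  have S0: "?S X Y \<bullet> Z x = 0" if Z: "Z \<in> ?V" for Z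
  proof -
    have "?S X Y \<bullet> Z x = - (?S X Z \<bullet> Y x)" by (rule skew[OF XY Z])
    also have "\<dots> = - (?S Z X \<bullet> Y x)" by (simp only: sym[OF XY(1) Z])
    also have "\<dots> = ?S Z Y \<bullet> X x" using skew[OF Z XY] by linarith
    also have "\<dots> = ?S Y Z \<bullet> X x" by (simp only: sym[OF Z XY(2)])
    also have "\<dots> = - (?S Y X \<bullet> Z x)" by (rule skew[OF XY(2) Z XY(1)])
    also have "\<dots> = - (?S X Y \<bullet> Z x)" by (simp only: sym[OF XY])
    finally show ?thesis by linarith
  qed
  have "?S X Y \<in> tangent_space M x"
    using T[OF XY] T0 by (rule subspace_diff[OF subspace_tangent[OF x]])
  \<comment> \<open>Taking for \<open>Z\<close> the projected constant field through the difference
    vector makes that vector orthogonal to itself.\<close>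
  then have "?S X Y \<bullet> ?S X Y = 0"
    using S0[OF proj_const_field[of "?S X Y"]] proj_tangent_eq[OF x] by simp
  then show ?thesis by simp
qed

text \<open>The projected derivative witnesses that \<open>SOME\<close> picks a connection with the
  three properties; uniqueness then identifies the picked one on vector fields.\<close>

lemma levi_civita_eq:
  assumes "X \<in> vector_fields M" "Y \<in> vector_fields M" "x \<in> M"
  shows "levi_civita M gI X Y x = P x (mderiv M Y x (X x))"
proof -
  have "affine_connection M (levi_civita M gI) \<and> torsion_free M (levi_civita M gI) \<and>
      metric_compatible M gI (levi_civita M gI)"
    unfolding levi_civita_def
    by (rule someI[of _ proj_deriv])
      (simp add: affine_connection_proj_deriv torsion_free_proj_deriv metric_compatible_proj_deriv)
  then show ?thesis
    using levi_civita_unique assms by (simp add: proj_deriv_def)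
qed

text \<open>The description in \<open>cov_deriv\<close> ranges over all fields through
  \<open>v\<close>. Projecting the constant \<open>v\<close> provides one, and the value depends on
  the field only through its value at \<open>x\<close>.\<close>

lemma riem_hess_eq:
  assumes "smooth_fun M f" "x \<in> M" "v \<in> tangent_space M x"
  shows "riem_hess M gI f x v = P x (mderiv M (riem_grad M gI f) x v)"
  unfolding riem_hess_def cov_deriv_def
proof (rule the_equality)
  have "P x v = v" by (rule proj_tangent_eq[OF assms(2,3)])
  then show "\<exists>X\<in>vector_fields M. X x = v \<and>
      P x (mderiv M (riem_grad M gI f) x v) = levi_civita M gI X (riem_grad M gI f) x"
    using levi_civita_eq[OF proj_const_field[of v] riem_grad_field[OF assms(1)] assms(2)]
    by (intro bexI[of _ "\<lambda>y. P y v"] proj_const_field) simp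
  show "w = P x (mderiv M (riem_grad M gI f) x v)"
    if "\<exists>X\<in>vector_fields M. X x = v \<and> w = levi_civita M gI X (riem_grad M gI f) x" for w
    using that levi_civita_eq[OF _ riem_grad_field[OF assms(1)] assms(2)] by blast
qed

end

section \<open>Pseudoinverses of matrices\<close>

declare transpose_matrix_vector [simp del]

lemma bounded_bilinear_matrix_mult: "bounded_bilinear ((**) :: real^'b^'a \<Rightarrow> real^'c^'b \<Rightarrow> real^'c^'a)"
  unfolding bilinear_conv_bounded_bilinear[symmetric] bilinear_def
  by (auto intro!: linearI simp: matrix_matrix_mult_def vec_eq_iff sum.distrib sum_distrib_left algebra_simps)

lemma bounded_bilinear_matrix_vector_mult: "bounded_bilinear ((*v) :: real^'b^'a \<Rightarrow> real^'b \<Rightarrow> real^'a)"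
  unfolding bilinear_conv_bounded_bilinear[symmetric] bilinear_def
  by (auto intro!: linearI simp: matrix_vector_mult_def vec_eq_iff sum.distrib sum_distrib_left algebra_simps)

lemma bounded_linear_transpose: "bounded_linear (transpose :: real^'b^'a \<Rightarrow> real^'a^'b)"
  unfolding linear_conv_bounded_linear[symmetric]
  by (auto intro!: linearI simp: transpose_def vec_eq_iff)

interpretation matrix_mult: bounded_bilinear "(**) :: real^'b^'a \<Rightarrow> real^'c^'b \<Rightarrow> real^'c^'a"
  by (rule bounded_bilinear_matrix_mult)

interpretation matrix_vector: bounded_bilinear "(*v) :: real^'b^'a \<Rightarrow> real^'b \<Rightarrow> real^'a"
  by (rule bounded_bilinear_matrix_vector_mult)

lemma linear_transpose: "linear (transpose :: real^'b^'a \<Rightarrow> real^'a^'b)"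
  by (rule bounded_linear.linear[OF bounded_linear_transpose])

lemma transpose_minus: "transpose (- A) = - transpose A" for A :: "real^'b^'a"
  by (rule linear_neg[OF linear_transpose])

lemma transpose_add: "transpose (A + B) = transpose A + transpose B" for A :: "real^'b^'a"
  by (rule linear_add[OF linear_transpose])

lemma transpose_diff: "transpose (A - B) = transpose A - transpose B" for A :: "real^'b^'a"
  by (rule linear_diff[OF linear_transpose])

lemma transpose_zero: "transpose (0 :: real^'b^'a) = 0"
  by (rule linear_0[OF linear_transpose])

lemma inner_matrix_vector: "(A *v x) \<bullet> y = x \<bullet> (transpose A *v y)" for A :: "real^'b^'a"
  by (metis dot_lmul_matrix inner_commute vector_transpose_matrix transpose_transpose)

text \<open>Penrose's argument: both candidates equal \<open>X ** M ** Y\<close>, since the symmetry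
  conditions allow products such as \<open>(M ** Y) ** (M ** X)\<close> to be reversed by
  transposition.\<close>

lemma pinv_eqI:
  fixes M :: "real^'c^'d"
  assumes X: "M ** X ** M = M" "X ** M ** X = X" "transpose (M ** X) = M ** X" "transpose (X ** M) = X ** M"
  shows "pinv M = X"
  unfolding pinv_def
proof (rule the_equality)
  fix Y assume Y: "M ** Y ** M = M \<and> Y ** M ** Y = Y \<and> transpose (M ** Y) = M ** Y \<and> transpose (Y ** M) = Y ** M"
  have "X = X ** ((M ** Y) ** (M ** X))"
    using X(2) Y by (metis matrix_mul_assoc)
  also have "(M ** Y) ** (M ** X) = transpose ((M ** X) ** (M ** Y))"
    using X(3) Y by (simp add: matrix_transpose_mul)
  also have "(M ** X) ** (M ** Y) = M ** Y"
    using X(1) by (simp add: matrix_mul_assoc)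
  finally have 1: "X = X ** M ** Y" using Y by (simp add: matrix_mul_assoc)
  have "Y = ((Y ** M) ** (X ** M)) ** Y"
    using X(1) Y by (metis matrix_mul_assoc)
  also have "(Y ** M) ** (X ** M) = transpose ((X ** M) ** (Y ** M))"
    using X(4) Y by (simp add: matrix_transpose_mul)
  also have "(X ** M) ** (Y ** M) = X ** M"
    using Y by (metis matrix_mul_assoc)
  finally have 2: "Y = X ** M ** Y" using X(4) by simp
  show "Y = X" using 1 2 by simp
qed (use X in blast)

text \<open>If the columns of \<open>M\<close> lie in the kernel of \<open>Q\<close> then adding \<open>Q\<^sup>T Q\<close> to \<open>M M\<^sup>T\<close> only
  affects the orthogonal complement of the range of \<open>M\<close>.\<close>

locale corrected_normal_matrix =
  fixes M :: "real^'q^'k" and Q :: "real^'k^'k"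
  assumes QM: "Q ** M = 0"
    and det: "det (M ** transpose M + transpose Q ** Q) \<noteq> 0"
begin

definition "G = M ** transpose M + transpose Q ** Q"

definition "X = transpose M ** matrix_inv G"

lemma G_inverse: "G ** matrix_inv G = mat 1" "matrix_inv G ** G = mat 1"
  using matrix_inv_inverse[of G] det by (simp_all add: invertible_det_nz G_def)

lemma G_symmetric: "transpose G = G"
  by (simp add: G_def transpose_add matrix_transpose_mul)

lemma matrix_inv_G_symmetric: "transpose (matrix_inv G) = matrix_inv G"
proof -
  have "transpose (matrix_inv G) ** G = mat 1"
    using G_inverse(1) by (metis G_symmetric matrix_transpose_mul transpose_mat)
  then have "transpose (matrix_inv G) ** G ** matrix_inv G = matrix_inv G" by simp
  then show ?thesis by (simp add: matrix_mul_assoc[symmetric] G_inverse)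
qed

lemma MQ: "transpose M ** transpose Q = 0"
  using QM by (metis matrix_transpose_mul transpose_zero)

text \<open>\<open>M ** transpose M\<close> and \<open>transpose Q ** Q\<close> annihilate each
  other, so the correction commutes with \<open>G\<close> and with its inverse. This gives the
  symmetry of \<open>M ** X\<close> and brings \<open>transpose Q\<close> next to
  \<open>transpose M\<close> in \<open>penrose2\<close>.\<close>

lemma correction_commutes: "transpose Q ** Q ** matrix_inv G = matrix_inv G ** (transpose Q ** Q)"
proof -
  let ?N = "transpose Q ** Q"
  have "?N ** (M ** transpose M) = transpose Q ** (Q ** M) ** transpose M"
    "M ** transpose M ** ?N = M ** (transpose M ** transpose Q) ** Q"
    by (simp_all only: matrix_mul_assoc)
  then have "?N ** G = ?N ** ?N" "G ** ?N = ?N ** ?N"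
    by (simp_all add: G_def matrix_mult.add_right matrix_mult.add_left QM MQ)
  then have "matrix_inv G ** (?N ** G) ** matrix_inv G = matrix_inv G ** (G ** ?N) ** matrix_inv G"
    by simp
  then have "matrix_inv G ** ?N ** (G ** matrix_inv G) = (matrix_inv G ** G) ** ?N ** matrix_inv G"
    by (simp only: matrix_mul_assoc)
  then show ?thesis by (simp add: G_inverse)
qed

text \<open>Expand \<open>G ** matrix_inv G = mat 1\<close>. The right-hand side is the orthogonal
  projection onto the kernel of \<open>Q\<close>, which is the range of \<open>M\<close>.\<close>

lemma M_mult_X: "M ** X = mat 1 - matrix_inv G ** (transpose Q ** Q)"
proof -
  have "M ** X + transpose Q ** Q ** matrix_inv G = G ** matrix_inv G"
    unfolding X_def by (simp add: G_def matrix_mult.add_left matrix_mul_assoc)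
  then show ?thesis
    by (simp add: G_inverse correction_commutes algebra_simps)
qed

lemma X_mult_M: "X ** M = transpose M ** matrix_inv G ** M"
  by (simp add: X_def)

lemma penrose1: "M ** X ** M = M"
proof -
  have "matrix_inv G ** (transpose Q ** Q) ** M = matrix_inv G ** transpose Q ** (Q ** M)"
    by (simp only: matrix_mul_assoc)
  then show ?thesis
    unfolding M_mult_X matrix_mult.diff_left by (simp add: QM)
qed

lemma penrose2: "X ** M ** X = X"
proof -
  have "X ** (matrix_inv G ** (transpose Q ** Q)) =
      transpose M ** matrix_inv G ** (transpose Q ** Q ** matrix_inv G)"
    by (simp only: X_def correction_commutes)
  also have "\<dots> = transpose M ** (matrix_inv G ** (transpose Q ** Q)) ** matrix_inv G"
    by (simp only: matrix_mul_assoc)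
  also have "\<dots> = (transpose M ** transpose Q) ** Q ** matrix_inv G ** matrix_inv G"
    unfolding correction_commutes[symmetric] by (simp only: matrix_mul_assoc)
  finally have "X ** (matrix_inv G ** (transpose Q ** Q)) = 0" by (simp add: MQ)
  then show ?thesis
    unfolding matrix_mul_assoc[symmetric] M_mult_X by (simp add: matrix_mult.diff_right)
qed

lemma penrose3: "transpose (M ** X) = M ** X"
  unfolding M_mult_X
  by (simp add: transpose_diff matrix_transpose_mul matrix_inv_G_symmetric correction_commutes)

lemma penrose4: "transpose (X ** M) = X ** M"
  unfolding X_mult_M by (simp add: matrix_transpose_mul matrix_inv_G_symmetric matrix_mul_assoc)

lemma pinv_eq: "pinv M = X"
  by (rule pinv_eqI[OF penrose1 penrose2 penrose3 penrose4])

lemma transpose_X: "transpose X = matrix_inv G ** M"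
  by (simp add: X_def matrix_transpose_mul matrix_inv_G_symmetric)

text \<open>The converse of \<open>QM\<close>: invertibility of \<open>G\<close> makes
  \<open>M\<close> onto the kernel of \<open>Q\<close>, the space to which its values are
  confined.\<close>

lemma range_M:
  assumes "Q *v w = 0"
  shows "M *v (X *v w) = w"
proof -
  have "matrix_inv G ** (transpose Q ** Q) *v w = matrix_inv G ** transpose Q *v (Q *v w)"
    by (simp only: matrix_vector_mul_assoc matrix_mul_assoc)
  then have "matrix_inv G ** (transpose Q ** Q) *v w = 0"
    by (simp only: assms matrix_vector_mult_0_right)
  then show ?thesis
    unfolding matrix_vector_mul_assoc M_mult_X matrix_vector.diff_left by simp
qed

end

text \<open>The quadratic form of this matrix at \<open>w\<close> is the sum of the squared norms of
  \<open>transpose M *v w\<close> and \<open>Q *v w\<close>. One determinant thus encodes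
  regularity; with \<open>Q = 0\<close> it becomes a full rank test.\<close>

lemma det_corrected_normal_matrix:
  fixes M :: "real^'q^'k" and Q :: "real^'k^'k"
  shows "det (M ** transpose M + transpose Q ** Q) \<noteq> 0 \<longleftrightarrow>
    (\<forall>w. transpose M *v w = 0 \<longrightarrow> Q *v w = 0 \<longrightarrow> w = 0)"
proof -
  let ?G = "M ** transpose M + transpose Q ** Q"
  have G: "?G *v w = M *v (transpose M *v w) + transpose Q *v (Q *v w)" for w
    by (simp add: matrix_vector_mul_assoc matrix_vector.add_left)
  have "?G *v w = 0 \<longleftrightarrow> transpose M *v w = 0 \<and> Q *v w = 0" for w
  proof
    assume "?G *v w = 0"
    then have "(?G *v w) \<bullet> w = 0" by simp
    then have "(transpose M *v w) \<bullet> (transpose M *v w) + (Q *v w) \<bullet> (Q *v w) = 0"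
      unfolding G by (simp add: inner_add_left inner_matrix_vector)
    then show "transpose M *v w = 0 \<and> Q *v w = 0"
      by (metis add_nonneg_eq_0_iff inner_ge_zero inner_eq_zero_iff)
  qed (simp add: G)
  moreover have "det ?G \<noteq> 0 \<longleftrightarrow> (\<forall>w. ?G *v w = 0 \<longrightarrow> w = 0)"
    unfolding invertible_det_nz[symmetric] invertible_left_inverse matrix_left_invertible_ker ..
  ultimately show ?thesis by blast
qed

section \<open>Level sets of quadratic maps\<close>

text \<open>The level set is that of \<open>x \<mapsto> Jm x *v \<iota> x\<close>, whose derivative at \<open>x\<close> is twice
  \<open>Jm x *v \<iota> v\<close>.  It takes values in the kernel of \<open>Q\<close>, and the regular points are
  those where the derivative is onto that kernel.\<close>

locale quadratic_level_set =
  fixes M :: "'a::euclidean_space set" and Jm :: "'a \<Rightarrow> real^'q^'k"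
    and \<iota> :: "'a \<Rightarrow> real^'q" and \<kappa> :: "real^'q \<Rightarrow> 'a" and Q :: "real^'k^'k"
  assumes linear_Jm: "linear Jm" and linear_iota: "linear \<iota>" and linear_kappa: "linear \<kappa>"
    and iota_kappa: "\<iota> (\<kappa> z) = z" and iota_inner: "\<iota> x \<bullet> \<iota> y = x \<bullet> y"
    and Jm_sym: "Jm x *v \<iota> y = Jm y *v \<iota> x"
    and Q_Jm: "Q ** Jm x = 0"
    and regular: "x \<in> M \<Longrightarrow> transpose (Jm x) *v w = 0 \<Longrightarrow> Q *v w = 0 \<Longrightarrow> w = 0"
    and level: "x \<in> M \<Longrightarrow> y \<in> M \<Longrightarrow> Jm x *v \<iota> x = Jm y *v \<iota> y"
    and regular_level_near: "x \<in> M \<Longrightarrow> \<forall>\<^sub>F y in nhds x.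
      (\<forall>w. transpose (Jm y) *v w = 0 \<longrightarrow> Q *v w = 0 \<longrightarrow> w = 0) \<longrightarrow>
      Jm y *v \<iota> y = Jm x *v \<iota> x \<longrightarrow> y \<in> M"
begin

text \<open>\<open>Gm\<close> and \<open>Rm\<close> are total functions of \<open>y\<close>, as
  statements about smoothness require. On \<open>V\<close> they agree with \<open>G\<close> and
  \<open>X\<close> of \<open>corrected_normal_matrix\<close>, and there \<open>Rm\<close> is the
  pseudoinverse.\<close>

definition Gm :: "'a \<Rightarrow> real^'k^'k" where
  "Gm y = Jm y ** transpose (Jm y) + transpose Q ** Q"

definition Rm :: "'a \<Rightarrow> real^'k^'q" where
  "Rm y = transpose (Jm y) ** matrix_inv (Gm y)"

definition P :: "'a \<Rightarrow> 'a \<Rightarrow> 'a" where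
  "P y v = v - \<kappa> (Rm y *v (Jm y *v \<iota> v))"

text \<open>The polarisation of the constraint: \<open>B x x\<close> is constant on
  \<open>M\<close>, and \<open>B x v = 0\<close> will describe the tangent vectors.\<close>

definition B :: "'a \<Rightarrow> 'a \<Rightarrow> real^'k" where
  "B x y = Jm x *v \<iota> y"

definition V :: "'a set" where
  "V = {y. det (Gm y) \<noteq> 0}"

section \<open>The projection and its smooth dependence on the base point\<close>

lemma bounded_linear_maps: "bounded_linear Jm" "bounded_linear \<iota>" "bounded_linear \<kappa>"
  using linear_Jm linear_iota linear_kappa by (simp_all add: linear_conv_bounded_linear)

lemma kappa_inner: "\<kappa> z \<bullet> x = z \<bullet> \<iota> x"
  by (metis iota_inner iota_kappa)

lemma bounded_bilinear_B: "bounded_bilinear B"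
  unfolding B_def by (rule bounded_bilinear.comp[OF bounded_bilinear_matrix_vector_mult bounded_linear_maps(1,2)])

lemma B_sym: "B x y = B y x"
  unfolding B_def by (rule Jm_sym)

lemma Q_B: "Q *v B x y = 0"
  unfolding B_def by (simp add: matrix_vector_mul_assoc Q_Jm)

lemma corrected: "y \<in> V \<Longrightarrow> corrected_normal_matrix (Jm y) Q"
  by unfold_locales (simp_all add: Q_Jm V_def Gm_def)

lemma Gm_eq: "y \<in> V \<Longrightarrow> Gm y = corrected_normal_matrix.G (Jm y) Q"
  by (simp add: Gm_def corrected_normal_matrix.G_def[OF corrected])

lemma Rm_eq: "y \<in> V \<Longrightarrow> Rm y = corrected_normal_matrix.X (Jm y) Q"
  by (simp add: Rm_def Gm_eq corrected_normal_matrix.X_def[OF corrected])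

lemma pinv_Jm: "y \<in> V \<Longrightarrow> pinv (Jm y) = Rm y"
  by (simp add: Rm_eq corrected_normal_matrix.pinv_eq[OF corrected])

lemma M_subset_V: "M \<subseteq> V"
  using regular det_corrected_normal_matrix by (fastforce simp: V_def Gm_def)

lemma smooth_Jm: "smooth_on UNIV Jm"
  by (rule smooth_on_linear[OF open_UNIV bounded_linear_maps(1)])

lemma smooth_Gm: "smooth_on UNIV Gm"
  unfolding Gm_def
  by (rule smooth_on_add[OF open_UNIV
      smooth_on_bilinear[OF bounded_bilinear_matrix_mult open_UNIV smooth_Jm
        smooth_on_linear_compose[OF open_UNIV bounded_linear_transpose smooth_Jm]] smooth_on_const])

lemma open_V: "open V"
proof -
  have "continuous_on UNIV (\<lambda>y. det (Gm y))"
    by (intro smooth_on_imp_continuous_on smooth_on_det open_UNIV smooth_on_nth smooth_Gm)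
  then show ?thesis
    unfolding V_def using open_Collect_neq[of "\<lambda>y. det (Gm y)" "\<lambda>_. 0"] continuous_on_const by blast
qed

text \<open>\<open>V\<close> is open and consists of regular points, so near \<open>x\<close> the
  level equation alone forces membership in \<open>M\<close>.\<close>

lemma M_near:
  assumes "x \<in> M"
  shows "\<forall>\<^sub>F y in nhds x. B y y = B x x \<longrightarrow> y \<in> M"
proof -
  have "\<forall>\<^sub>F y in nhds x. y \<in> V"
    using open_V M_subset_V assms by (auto intro: eventually_nhds_in_open)
  with regular_level_near[OF assms] show ?thesis
    by eventually_elim (use det_corrected_normal_matrix in \<open>auto simp: V_def Gm_def B_def\<close>)
qed

text \<open>The Lagrange multiplier of the field: the part of \<open>Z y\<close> removed by
  \<open>P y\<close> is \<open>B' y (multiplier Z y)\<close>.\<close>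

definition multiplier :: "('a \<Rightarrow> 'a) \<Rightarrow> 'a \<Rightarrow> real^'k" where
  "multiplier Z y = matrix_inv (Gm y) *v (Jm y *v \<iota> (Z y))"

lemma smooth_multiplier:
  assumes "open U" "smooth_on U Z" "U \<subseteq> V"
  shows "smooth_on U (multiplier Z)"
proof -
  have J: "smooth_on U Jm" and G: "smooth_on U Gm"
    using smooth_Jm smooth_Gm smooth_on_subset by blast+
  have inv: "smooth_on U (\<lambda>y. matrix_inv (Gm y))"
    using assms(3) by (intro smooth_on_matrix_inv assms(1) G) (auto simp: V_def)
  show ?thesis
    unfolding multiplier_def
    by (rule smooth_on_bilinear[OF bounded_bilinear_matrix_vector_mult assms(1) inv
          smooth_on_bilinear[OF bounded_bilinear_matrix_vector_mult assms(1) J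
            smooth_on_linear_compose[OF assms(1) bounded_linear_maps(2) assms(2)]]])
qed

text \<open>The adjoint of \<open>B y\<close>; for \<open>y\<close> in \<open>M\<close> its range is
  the normal space. Bilinearity in \<open>(y, z)\<close> lets the product rule separate the moving
  base point from the moving multiplier.\<close>

definition B' :: "'a \<Rightarrow> real^'k \<Rightarrow> 'a" where
  "B' y z = \<kappa> (transpose (Jm y) *v z)"

lemma bounded_bilinear_B': "bounded_bilinear B'"
  unfolding bilinear_conv_bounded_bilinear[symmetric] bilinear_def
  by (auto intro!: linearI simp: B'_def linear_add[OF linear_Jm] linear_scale[OF linear_Jm]
      linear_add[OF linear_kappa] linear_scale[OF linear_kappa] transpose_add transpose_scalar
      matrix_vector.add_right matrix_vector.scaleR_right matrix_vector.add_left matrix_vector.scaleR_left)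

lemma P_multiplier: "P y (Z y) = Z y - B' y (multiplier Z y)"
  by (simp add: P_def B'_def multiplier_def Rm_def matrix_vector_mul_assoc matrix_mul_assoc)

lemma smooth_P:
  assumes "open U" "smooth_on U Z" "U \<subseteq> V"
  shows "smooth_on U (\<lambda>y. P y (Z y))"
  unfolding P_multiplier
  by (rule smooth_on_diff[OF assms(1,2) smooth_on_bilinear[OF bounded_bilinear_B' assms(1)
        smooth_on_linear[OF assms(1) bounded_linear_ident] smooth_multiplier[OF assms]]])

lemma Jm_Rm_Jm: "y \<in> V \<Longrightarrow> Jm y ** Rm y ** Jm y = Jm y"
  by (simp add: Rm_eq corrected_normal_matrix.penrose1[OF corrected])

lemma Rm_Jm_sym: "y \<in> V \<Longrightarrow> transpose (Rm y ** Jm y) = Rm y ** Jm y"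
  by (simp add: Rm_eq corrected_normal_matrix.penrose4[OF corrected])

lemma Jm_Rm: "y \<in> V \<Longrightarrow> Q *v w = 0 \<Longrightarrow> Jm y *v (Rm y *v w) = w"
  by (simp add: Rm_eq corrected_normal_matrix.range_M[OF corrected])

lemma B_P: "y \<in> V \<Longrightarrow> B y (P y v) = 0"
  by (simp add: B_def P_def linear_diff[OF linear_iota] iota_kappa matrix_vector.diff_right
      matrix_vector_mul_assoc matrix_mul_assoc Jm_Rm_Jm)

text \<open>As \<open>Rm y ** Jm y\<close> is symmetric, transposing
  \<open>Jm y ** Rm y ** Jm y = Jm y\<close> shows that the projection annihilates the rows of
  \<open>Jm y\<close>.\<close>

lemma P_B': "y \<in> V \<Longrightarrow> P y (B' y z) = 0"
proof -
  assume y: "y \<in> V"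
  have "Rm y ** Jm y ** transpose (Jm y) = transpose (Jm y ** (Rm y ** Jm y))"
    using Rm_Jm_sym[OF y] by (simp add: matrix_transpose_mul)
  then show ?thesis
    using Jm_Rm_Jm[OF y]
    by (simp add: P_def B'_def iota_kappa matrix_vector_mul_assoc matrix_mul_assoc)
qed

lemma iota_P: "\<iota> (P y v) = (mat 1 - Rm y ** Jm y) *v \<iota> v"
  by (simp add: P_def linear_diff[OF linear_iota] iota_kappa matrix_vector.diff_left matrix_vector_mul_assoc)

lemma linear_P: "linear (P y)"
  by (rule linearI)
    (simp_all add: P_def linear_add[OF linear_iota] linear_add[OF linear_kappa] linear_scale[OF linear_iota]
      linear_scale[OF linear_kappa] matrix_vector.add_right matrix_vector.scaleR_right scaleR_diff_right)

text \<open>Along a curve in \<open>M\<close> the value \<open>B (c t) (c t)\<close> is constant,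
  and by symmetry its derivative at 0 is twice \<open>B x v\<close>.\<close>

lemma tangent_imp_kernel:
  assumes "x \<in> M" "v \<in> tangent_space M x"
  shows "B x v = 0"
proof -
  obtain c where c: "curve_through M x v c" using assms(2) by (auto simp: tangent_space_def)
  then have c': "c 0 = x" "(c has_vector_derivative v) (at 0)" "\<forall>\<^sub>F t in nhds 0. c t \<in> M"
    by (auto simp: curve_through_def)
  have 1: "((\<lambda>t. B (c t) (c t)) has_vector_derivative B x v + B v x) (at 0)"
    using bounded_bilinear.has_vector_derivative[OF bounded_bilinear_B c'(2) c'(2)] c'(1) by simp
  have ev: "\<forall>\<^sub>F t in nhds 0. B x x = B (c t) (c t)"
    using c'(3) by eventually_elim (use level[OF assms(1)] in \<open>simp add: B_def\<close>)
  have "((\<lambda>t. B (c t) (c t)) has_vector_derivative 0) (at 0)"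
    unfolding has_vector_derivative_def
    by (rule has_derivative_transform_eventually[of "\<lambda>_. B x x"])
      (use ev c'(1) in \<open>auto simp: eventually_at_filter eventually_mono\<close>)
  from vector_derivative_unique_at[OF 1 this] have "2 *\<^sub>R B x v = 0"
    by (simp add: B_sym[of v x] scaleR_2)
  then show ?thesis by simp
qed

text \<open>The local inverse of \<open>y \<mapsto> P (y - x) + R (h y - h x)\<close>, where \<open>h y = B y y / 2\<close> and
  \<open>R\<close> is a right inverse of the derivative of \<open>h\<close>, maps the line \<open>t v\<close> into the level set.\<close>

lemma kernel_imp_tangent:
  assumes x: "x \<in> M" and v: "B x v = 0"
  shows "v \<in> tangent_space M x"
proof -
  have xV: "x \<in> V" using x M_subset_V by blast
  define R where "R w = \<kappa> (Rm x *v w)" for w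
  have lin_R: "linear R"
    unfolding R_def
    by (rule linear_compose[OF matrix_vector_mul_linear linear_kappa, unfolded o_def])
  define f where "f y = P x (y - x) + (1/2) *\<^sub>R R (B y y - B x x)" for y
  define f' where "f' y u = P x u + R (B y u)" for y u
  have lin_f': "linear (f' y)" for y
    by (rule linearI)
      (simp_all add: f'_def linear_add[OF linear_P] linear_scale[OF linear_P] linear_add[OF lin_R]
        linear_scale[OF lin_R] bounded_bilinear.add_right[OF bounded_bilinear_B]
        bounded_bilinear.scaleR_right[OF bounded_bilinear_B] scaleR_add_right)
  have bl: "bounded_linear (f' y)" for y
    using lin_f' by (simp add: linear_conv_bounded_linear)
  have der: "(f has_derivative blinfun_apply (Blinfun (f' y))) (at y)" for y
  proof -
    have "((\<lambda>y. B y y - B x x) has_derivative (\<lambda>u. (B y u + B u y) - 0)) (at y)"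
      by (intro has_derivative_diff has_derivative_const
          bounded_bilinear.FDERIV[OF bounded_bilinear_B has_derivative_ident has_derivative_ident])
    then have 1: "((\<lambda>y. B y y - B x x) has_derivative (\<lambda>u. 2 *\<^sub>R B y u)) (at y)"
      by (simp add: B_sym[of _ y] scaleR_2)
    have "((\<lambda>y. P x (y - x) + (1/2) *\<^sub>R R (B y y - B x x)) has_derivative
        (\<lambda>u. P x (u - 0) + (1/2) *\<^sub>R R (2 *\<^sub>R B y u))) (at y)"
      using linear_P lin_R
      by (intro has_derivative_add has_derivative_scaleR_right bounded_linear.has_derivative[OF _ 1]
          bounded_linear.has_derivative[of "P x"] has_derivative_diff has_derivative_ident has_derivative_const)
        (auto simp: linear_conv_bounded_linear)
    then show ?thesis
      unfolding bounded_linear_Blinfun_apply[OF bl]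
      by (simp add: f_def[abs_def] f'_def[abs_def] linear_scale[OF lin_R])
  qed
  have cont: "continuous_on UNIV (\<lambda>y. Blinfun (f' y))"
  proof (rule continuous_on_blinfun_componentwise)
    fix i :: 'a assume "i \<in> Basis"
    have "linear (\<lambda>y. R (B y i))"
      by (rule linearI)
        (simp_all add: linear_add[OF lin_R] linear_scale[OF lin_R] bounded_bilinear.add_left[OF bounded_bilinear_B]
          bounded_bilinear.scaleR_left[OF bounded_bilinear_B])
    then have "continuous_on UNIV (\<lambda>y. P x i + R (B y i))"
      by (intro continuous_on_add continuous_on_const linear_continuous_on)
        (simp add: linear_conv_bounded_linear)
    then show "continuous_on UNIV (\<lambda>y. blinfun_apply (Blinfun (f' y)) i)"
      by (simp add: bounded_linear_Blinfun_apply[OF bl] f'_def)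
  qed
  \<comment> \<open>The two summands of \<open>f' x\<close> are complementary: \<open>P x u\<close>
    is \<open>u\<close> minus exactly \<open>R (B x u)\<close>.\<close>
  have f'x: "f' x = id"
    by (rule ext) (simp add: f'_def P_def R_def B_def)
  then have "id_blinfun o\<^sub>L Blinfun (f' x) = id_blinfun"
    by (intro blinfun_eqI) (simp add: bounded_linear_Blinfun_apply[OF bl[of x], unfolded f'x])
  from inverse_function_theorem[OF open_UNIV der cont UNIV_I this]
  obtain U' V' g g' where g: "open U'" "x \<in> U'" "open V'" "f x \<in> V'" "homeomorphism U' V' f g"
    "\<And>y. y \<in> V' \<Longrightarrow> (g has_derivative (g' y)) (at y)"
    "\<And>y. y \<in> V' \<Longrightarrow> g' y = inv (blinfun_apply (Blinfun (f' (g y))))"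
    by metis
  have fx: "f x = 0"
    by (simp add: f_def linear_0[OF linear_P] linear_0[OF lin_R])
  have g0: "g 0 = x"
    using g(2,5) fx by (metis homeomorphism_apply1)
  have dg: "(g has_derivative id) (at 0)"
    using g(6,7)[of 0] g(4) fx f'x g0 by (simp add: bounded_linear_Blinfun_apply[OF bl[of x], unfolded f'x])
  define c where "c t = g (t *\<^sub>R v)" for t :: real
  have c0: "c 0 = x" by (simp add: c_def g0)
  have "((\<lambda>t. t *\<^sub>R v) has_vector_derivative v) (at 0)"
    by (auto intro!: derivative_eq_intros)
  from vector_derivative_diff_chain_within[OF this, of g id] dg
  have dc: "(c has_vector_derivative v) (at 0)"
    unfolding c_def o_def by (auto intro: has_derivative_at_withinI)
  have "((\<lambda>t. t *\<^sub>R v) \<longlongrightarrow> 0 *\<^sub>R v) (nhds 0)"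
    by (intro tendsto_intros filterlim_ident)
  then have ev1: "\<forall>\<^sub>F t in nhds 0. t *\<^sub>R v \<in> V'"
    using topological_tendstoD[of _ "0 *\<^sub>R v" _ V'] g(3,4) fx by simp
  have "isCont c 0" using dc by (metis has_vector_derivative_continuous)
  then have "(c \<longlongrightarrow> x) (nhds 0)"
    using c0 by (metis isCont_def tendsto_at_iff_tendsto_nhds)
  then have ev2: "\<forall>\<^sub>F t in nhds 0. B (c t) (c t) = B x x \<longrightarrow> c t \<in> M"
    using M_near[OF x] unfolding filterlim_iff by blast
  have lev: "B (c t) (c t) = B x x" if "t *\<^sub>R v \<in> V'" for t
  proof -
    \<comment> \<open>\<open>w\<close> is half the constraint defect at \<open>c t\<close>. It lies
      in the kernel of \<open>Q\<close>, where \<open>R\<close> is a right inverse of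
      \<open>B x\<close>; applying \<open>B x\<close> to \<open>f (c t) = t v\<close> leaves only
      \<open>w\<close>, while \<open>B x v = 0\<close>.\<close>
    define w where "w = (1/2) *\<^sub>R (B (c t) (c t) - B x x)"
    have Qw: "Q *v w = 0"
      by (simp add: w_def matrix_vector.scaleR_right matrix_vector.diff_right Q_B)
    have "t *\<^sub>R v = f (c t)"
      using g(5) that by (simp add: c_def homeomorphism_apply2)
    also have "\<dots> = P x (c t - x) + R w"
      by (simp add: f_def w_def linear_scale[OF lin_R])
    finally have "B x (t *\<^sub>R v) = B x (P x (c t - x) + R w)" by simp
    then have "B x (R w) = 0"
      using v by (simp add: bounded_bilinear.scaleR_right[OF bounded_bilinear_B]
          bounded_bilinear.add_right[OF bounded_bilinear_B] B_P[OF xV])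
    then have "w = 0"
      using Jm_Rm[OF xV Qw] by (simp add: B_def R_def iota_kappa)
    then show ?thesis by (simp add: w_def)
  qed
  have "\<forall>\<^sub>F t in nhds 0. c t \<in> M"
    using ev1 ev2 by eventually_elim (use lev in simp)
  then show ?thesis
    using c0 dc by (auto simp: tangent_space_def curve_through_def)
qed

lemma tangent_space_eq: "x \<in> M \<Longrightarrow> tangent_space M x = {v. B x v = 0}"
  using tangent_imp_kernel kernel_imp_tangent by blast

text \<open>Differentiate the tangency equation \<open>B (c t) (Y (c t)) = 0\<close>. The outcome is
  symmetric in \<open>X\<close> and \<open>Y\<close>, so the two halves of the bracket cancel under
  \<open>B x\<close>.\<close>

lemma bracket_kernel:
  assumes "X \<in> vector_fields M" "Y \<in> vector_fields M" "x \<in> M"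
  shows "B x (mderiv M Y x (X x)) = - B (X x) (Y x)"
proof -
  have Y: "smooth_fun M Y" "\<And>y. y \<in> M \<Longrightarrow> Y y \<in> tangent_space M y" and "X x \<in> tangent_space M x"
    using assms by (auto simp: vector_fields_def)
  then obtain c where c: "curve_through M x (X x) c" by (auto simp: tangent_space_def)
  then have c': "c 0 = x" "(c has_vector_derivative X x) (at 0)" "\<forall>\<^sub>F t in nhds 0. c t \<in> M"
    by (auto simp: curve_through_def)
  have 1: "((\<lambda>t. B (c t) (Y (c t))) has_vector_derivative B x (mderiv M Y x (X x)) + B (X x) (Y x)) (at 0)"
    using bounded_bilinear.has_vector_derivative[OF bounded_bilinear_B c'(2) curve_has_mderiv[OF Y(1) assms(3) c]] c'(1)
    by simp
  have ev: "\<forall>\<^sub>F t in nhds 0. 0 = B (c t) (Y (c t))"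
    using c'(3) by eventually_elim (use tangent_imp_kernel Y(2) in simp)
  have "((\<lambda>t. B (c t) (Y (c t))) has_vector_derivative 0) (at 0)"
    unfolding has_vector_derivative_def
    by (rule has_derivative_transform_eventually[of "\<lambda>_. 0"])
      (use ev eventually_nhds_x_imp_x[OF ev] in \<open>auto simp: eventually_at_filter eventually_mono\<close>)
  from vector_derivative_unique_at[OF 1 this] show ?thesis
    by (simp add: eq_neg_iff_add_eq_0)
qed

lemma extends_near_P:
  assumes "x \<in> M" "extends_near M Z x U G"
  shows "extends_near M (\<lambda>y. P y (Z y)) x (U \<inter> V) (\<lambda>y. P y (G y))"
  using assms M_subset_V open_V smooth_P[of "U \<inter> V" G] smooth_on_subset[of U G "U \<inter> V"]
  by (auto simp: extends_near_def)

sublocale embedded_submanifold M P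
proof
  fix x w v assume x: "x \<in> M"
  then have xV: "x \<in> V" using M_subset_V by blast
  show "subspace (tangent_space M x)"
    unfolding tangent_space_eq[OF x] subspace_def
    using bounded_bilinear.add_right[OF bounded_bilinear_B] bounded_bilinear.scaleR_right[OF bounded_bilinear_B]
      bounded_bilinear.zero_right[OF bounded_bilinear_B] by simp
  show "P x w \<in> tangent_space M x"
    by (simp add: tangent_space_eq[OF x] B_P[OF xV])
  show "P x w \<bullet> v = w \<bullet> v" if "v \<in> tangent_space M x"
  proof -
    have "(Rm x ** Jm x *v \<iota> w) \<bullet> \<iota> v = \<iota> w \<bullet> (Rm x ** Jm x *v \<iota> v)"
      by (simp add: inner_matrix_vector Rm_Jm_sym[OF xV])
    also have "Rm x ** Jm x *v \<iota> v = 0"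
      using that by (simp add: tangent_space_eq[OF x] B_def matrix_vector_mul_assoc[symmetric])
    finally show ?thesis
      by (simp add: P_def inner_diff_left kappa_inner matrix_vector_mul_assoc)
  qed
next
  fix x U and Z G :: "'a \<Rightarrow> 'a" assume "x \<in> M" "extends_near M Z x U G"
  from extends_near_P[OF this] show "\<exists>U' G'. extends_near M (\<lambda>y. P y (Z y)) x U' G'" by blast
next
  fix X Y x assume "X \<in> vector_fields M" "Y \<in> vector_fields M" "x \<in> M"
  then show "mderiv M Y x (X x) - mderiv M X x (Y x) \<in> tangent_space M x"
    by (simp add: tangent_space_eq bounded_bilinear.diff_right[OF bounded_bilinear_B] bracket_kernel B_sym)
qed

theorem riem_grad_pinv:
  assumes "x \<in> M" "extends_near M f x U F"
  shows "\<iota> (riem_grad M gI f x) = (mat 1 - pinv (Jm x) ** Jm x) *v \<iota> (eucl_grad F x)"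
  using riem_grad_eq[OF assms] pinv_Jm M_subset_V assms(1) by (auto simp: iota_P)

text \<open>The normal part of the Euclidean gradient is \<open>B' y (multiplier (eucl_grad F) y)\<close>; the
  derivative of the multiplier drops out, since \<open>P\<close> kills the range of \<open>B' x\<close>.\<close>

theorem riem_hess_pinv:
  assumes f: "smooth_fun M f" and x: "x \<in> M" and v: "v \<in> tangent_space M x"
    and F: "extends_near M f x U F"
  shows "\<iota> (riem_hess M gI f x v) =
    (mat 1 - pinv (Jm x) ** Jm x) *v \<iota> (eucl_hess F x v)
    - ((mat 1 - pinv (Jm x) ** Jm x) ** transpose (Jm v) ** transpose (pinv (Jm x))
        ** pinv (Jm x) ** Jm x) *v \<iota> (eucl_grad F x)"
proof -
  have xV: "x \<in> V" using x M_subset_V by blast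
  let ?Z = "eucl_grad F" and ?N = "\<lambda>y. B' y (multiplier (eucl_grad F) y)"
  have U: "open U" "x \<in> U" "smooth_on U F" using F by (auto simp: extends_near_def)
  have Z: "smooth_on U ?Z" by (rule smooth_on_eucl_grad[OF U(1,3)])
  have UV: "open (U \<inter> V)" "smooth_on (U \<inter> V) ?Z" "x \<in> U \<inter> V"
    using U open_V Z xV smooth_on_subset[of U ?Z "U \<inter> V"] by auto
  have dZ: "(?Z has_derivative frechet_derivative ?Z (at x)) (at x)"
    by (rule smooth_on_has_derivative[OF Z U(2)])
  have dm: "(multiplier ?Z has_derivative frechet_derivative (multiplier ?Z) (at x)) (at x)"
    by (rule smooth_on_has_derivative[OF smooth_multiplier[OF UV(1,2)] UV(3)]) simp
  have "extends_near M ?Z x U ?Z"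
    using U Z by (intro extends_near_self)
  from riem_grad_extends_near[OF x F extends_near_P[OF x this]]
  have ext: "extends_near M (riem_grad M gI f) x (U \<inter> V \<inter> U) (\<lambda>y. ?Z y - ?N y)"
    by (simp only: P_multiplier)
  have "((\<lambda>y. ?Z y - ?N y) has_derivative (\<lambda>u. frechet_derivative ?Z (at x) u -
      (B' x (frechet_derivative (multiplier ?Z) (at x) u) + B' u (multiplier ?Z x)))) (at x)"
    by (intro has_derivative_diff dZ bounded_bilinear.FDERIV[OF bounded_bilinear_B' has_derivative_ident dm])
  then have "mderiv M (riem_grad M gI f) x v = eucl_hess F x v -
      (B' x (frechet_derivative (multiplier ?Z) (at x) v) + B' v (multiplier ?Z x))"
    using mderiv_eq_frechet_derivative[OF ext x v] by (simp add: frechet_derivative_at[symmetric] eucl_hess_def)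
  then have "riem_hess M gI f x v = P x (eucl_hess F x v) - P x (B' v (multiplier ?Z x))"
    unfolding riem_hess_eq[OF f x v]
    by (simp add: linear_diff[OF linear_P] linear_add[OF linear_P] P_B'[OF xV])
  moreover have "\<iota> (P x (B' v (multiplier ?Z x))) =
      ((mat 1 - Rm x ** Jm x) ** transpose (Jm v) ** transpose (Rm x) ** Rm x ** Jm x) *v \<iota> (?Z x)"
  proof -
    \<comment> \<open>Since \<open>transpose (Rm x)\<close> is
      \<open>matrix_inv (Gm x) ** Jm x\<close>, the product of pseudoinverses in the Hessian formula
      computes precisely the multiplier.\<close>
    have "transpose (Rm x) ** Rm x ** Jm x = matrix_inv (Gm x) ** (Jm x ** Rm x ** Jm x)"
      unfolding Rm_eq[OF xV] Gm_eq[OF xV] corrected_normal_matrix.transpose_X[OF corrected[OF xV]]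
      by (simp only: matrix_mul_assoc)
    then have "multiplier ?Z x = (transpose (Rm x) ** Rm x ** Jm x) *v \<iota> (?Z x)"
      by (simp add: multiplier_def matrix_vector_mul_assoc Jm_Rm_Jm[OF xV])
    then show ?thesis
      by (simp add: iota_P B'_def iota_kappa matrix_vector_mul_assoc matrix_mul_assoc)
  qed
  ultimately show ?thesis
    by (simp add: linear_diff[OF linear_iota] iota_P pinv_Jm[OF xV])
qed

end

section \<open>The core constraints\<close>

lemma sum_UNIV_prod: "(\<Sum>t\<in>(UNIV :: ('a::finite \<times> 'b::finite) set). f t) = (\<Sum>a\<in>UNIV. \<Sum>b\<in>UNIV. f (a, b))"
  by (simp add: sum.cartesian_product flip: UNIV_Times_UNIV)

lemma sum_UNIV_sum: "(\<Sum>t\<in>(UNIV :: ('a::finite + 'b::finite) set). f t) = (\<Sum>a\<in>UNIV. f (Inl a)) + (\<Sum>b\<in>UNIV. f (Inr b))"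
  by (simp add: sum.Plus flip: UNIV_Plus_UNIV)

lemma inner_eq_trace: "A \<bullet> B = trace (transpose A ** B)" for A B :: "real^'b^'a"
proof -
  have "A \<bullet> B = (\<Sum>i\<in>UNIV. \<Sum>j\<in>UNIV. A $ i $ j * B $ i $ j)"
    by (simp add: inner_vec_def)
  also have "\<dots> = (\<Sum>j\<in>UNIV. \<Sum>i\<in>UNIV. A $ i $ j * B $ i $ j)"
    by (rule sum.swap)
  finally show ?thesis
    by (simp add: trace_def matrix_matrix_mult_def transpose_def)
qed

lemma inner_matrix_mult_right: "X \<bullet> (Y ** Z) = (X ** transpose Z) \<bullet> Y" for Y :: "real^'b^'a" and Z :: "real^'c^'b"
proof -
  have "X \<bullet> (Y ** Z) = trace ((transpose X ** Y) ** Z)"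
    by (simp add: inner_eq_trace matrix_mul_assoc)
  also have "\<dots> = trace (Z ** (transpose X ** Y))"
    by (rule trace_mul_sym)
  finally show ?thesis
    by (simp add: inner_eq_trace matrix_transpose_mul matrix_mul_assoc)
qed

lemma inner_matrix_mult_left: "X \<bullet> (Y ** Z) = (transpose Y ** X) \<bullet> Z" for Y :: "real^'b^'a" and Z :: "real^'c^'b"
  by (simp add: inner_eq_trace matrix_transpose_mul matrix_mul_assoc)

lemma inner_transpose: "transpose A \<bullet> transpose B = A \<bullet> B" for A B :: "real^'b^'a"
  unfolding inner_eq_trace[of A] inner_eq_trace[of "transpose A"]
  by (metis inner_eq_trace inner_commute trace_mul_sym transpose_transpose)

lemma inner_mat_1: "A \<bullet> mat 1 = trace A" for A :: "real^'a^'a"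
  by (simp add: inner_eq_trace trace_def transpose_def)

lemma trace_transpose: "trace (transpose A) = trace A" for A :: "real^'a^'a"
  by (simp add: trace_def transpose_def)

lemma trace_scaleR: "trace (c *\<^sub>R A) = c * trace A" for A :: "real^'a^'a"
  by (simp add: trace_def sum_distrib_left)

lemma trace_sum: "trace (\<Sum>k\<in>I. A k) = (\<Sum>k\<in>I. trace (A k))" for A :: "'i \<Rightarrow> real^'a^'a"
  unfolding trace_def sum_component by (rule sum.swap)

lemma inner_vectorize: "vectorize A \<bullet> vectorize B = A \<bullet> B"
proof -
  have "vectorize A \<bullet> vectorize B = (\<Sum>j\<in>UNIV. \<Sum>i\<in>UNIV. A $ i $ j * B $ i $ j)"
    by (simp add: inner_vec_def vectorize_def sum_UNIV_prod)
  also have "\<dots> = (\<Sum>i\<in>UNIV. \<Sum>j\<in>UNIV. A $ i $ j * B $ i $ j)"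
    by (rule sum.swap)
  finally show ?thesis by (simp add: inner_vec_def)
qed

lemma linear_vectorize: "linear vectorize"
  by (rule linearI) (simp_all add: vectorize_def vec_eq_iff)

definition unvectorize :: "real^('c \<times> 'd) \<Rightarrow> real^'c::finite^'d::finite" where
  "unvectorize z = (\<chi> i j. z $ (j, i))"

lemma vectorize_unvectorize: "vectorize (unvectorize z) = z"
  by (simp add: vectorize_def unvectorize_def vec_eq_iff)

lemma unvectorize_vectorize: "unvectorize (vectorize A) = A"
  by (simp add: vectorize_def unvectorize_def vec_eq_iff)

lemma linear_unvectorize: "linear unvectorize"
  by (rule linearI) (simp_all add: unvectorize_def vec_eq_iff)

definition unphi :: "real^'r^('n::finite \<times> 'm::finite) \<Rightarrow> real^'n^'m^'r::finite" where
  "unphi B = (\<chi> k i j. B $ (j, i) $ k)"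

lemma phi_unphi: "phi (unphi B) = B"
  by (simp add: phi_def unphi_def vectorize_def vec_eq_iff)

lemma unphi_phi: "unphi (phi A) = A"
  by (simp add: phi_def unphi_def vectorize_def vec_eq_iff)

lemma inv_phi: "inv phi = unphi"
  by (rule inv_unique_comp) (simp_all add: fun_eq_iff phi_unphi unphi_phi)

lemma linear_unphi: "linear unphi"
  by (rule linearI) (simp_all add: unphi_def vec_eq_iff)

lemma stacked_unphi: "stacked (unphi B) = vectorize B"
  by (simp add: stacked_eq phi_unphi)

lemma inner_stacked: "stacked A \<bullet> stacked B = A \<bullet> B"
proof -
  have "stacked A \<bullet> stacked B = (\<Sum>k\<in>UNIV. \<Sum>j\<in>UNIV. \<Sum>i\<in>UNIV. A $ k $ i $ j * B $ k $ i $ j)"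
    by (simp add: inner_vec_def stacked_def vectorize_def sum_UNIV_prod)
  also have "\<dots> = (\<Sum>k\<in>UNIV. \<Sum>i\<in>UNIV. \<Sum>j\<in>UNIV. A $ k $ i $ j * B $ k $ i $ j)"
    by (rule sum.cong[OF refl sum.swap])
  finally show ?thesis by (simp add: inner_vec_def)
qed

text \<open>Polarised left-hand sides of the two balance equations. The order of the factors fits
  the Kronecker identity: \<open>kron A (mat 1)\<close> sends \<open>vectorize B\<close> to
  \<open>vectorize (B ** transpose A)\<close>.\<close>

definition row_gram :: "real^'n::finite^'m::finite^'r::finite \<Rightarrow> real^'n^'m^'r \<Rightarrow> real^'m^'m" where
  "row_gram A B = (\<Sum>k\<in>UNIV. B $ k ** transpose (A $ k))"

definition col_gram :: "real^'n::finite^'m::finite^'r::finite \<Rightarrow> real^'n^'m^'r \<Rightarrow> real^'n^'n" where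
  "col_gram A B = (\<Sum>k\<in>UNIV. transpose (A $ k) ** B $ k)"

lemma transpose_row_gram: "transpose (row_gram A B) = row_gram B A"
  by (simp add: row_gram_def linear_sum[OF linear_transpose] matrix_transpose_mul)

lemma transpose_col_gram: "transpose (col_gram A B) = col_gram B A"
  by (simp add: col_gram_def linear_sum[OF linear_transpose] matrix_transpose_mul)

lemma trace_row_gram: "trace (row_gram A A) = A \<bullet> A"
proof -
  have "trace (row_gram A A) = (\<Sum>k\<in>UNIV. A $ k \<bullet> A $ k)"
    unfolding row_gram_def trace_sum inner_eq_trace by (rule sum.cong[OF refl trace_mul_sym])
  then show ?thesis by (simp add: inner_vec_def)
qed

lemma inner_row_gram: "X \<bullet> row_gram A B = (\<Sum>k\<in>UNIV. (X ** A $ k) \<bullet> B $ k)"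
  by (simp add: row_gram_def inner_sum_right inner_matrix_mult_right)

lemma inner_col_gram: "Y \<bullet> col_gram A B = (\<Sum>k\<in>UNIV. (A $ k ** Y) \<bullet> B $ k)"
  by (simp add: col_gram_def inner_sum_right inner_matrix_mult_left)

lemma trace_mult_row_gram: "trace (X ** row_gram A B) = (\<Sum>k\<in>UNIV. trace (X ** B $ k ** transpose (A $ k)))"
  by (simp add: row_gram_def matrix_mult.sum_right trace_sum matrix_mul_assoc)

lemma hcat_kron_row: "hcat (\<lambda>k. kron (A $ k) (mat 1)) *v stacked B = vectorize (row_gram A B)"
proof -
  have "(hcat (\<lambda>k. kron (A $ k) (mat 1)) *v stacked B) $ s = vectorize (row_gram A B) $ s" for s
  proof -
    have *: "A $ k $ fst s $ j * (if snd s = i then 1 else 0) * B $ k $ i $ j =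
        (if i = snd s then A $ k $ fst s $ j * B $ k $ i $ j else 0)" for k i j
      by simp
    have "(hcat (\<lambda>k. kron (A $ k) (mat 1)) *v stacked B) $ s =
        (\<Sum>k\<in>UNIV. \<Sum>j\<in>UNIV. \<Sum>i\<in>UNIV. A $ k $ fst s $ j * (if snd s = i then 1 else 0) * B $ k $ i $ j)"
      by (simp add: matrix_vector_mult_def hcat_def kron_def stacked_def vectorize_def sum_UNIV_prod mat_def)
    also have "\<dots> = (\<Sum>k\<in>UNIV. \<Sum>j\<in>UNIV. A $ k $ fst s $ j * B $ k $ snd s $ j)"
      unfolding * by simp
    finally show ?thesis
      by (simp add: vectorize_def row_gram_def matrix_matrix_mult_def transpose_def mult.commute)
  qed
  then show ?thesis by (simp add: vec_eq_iff)
qed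

lemma hcat_kron_col: "hcat (\<lambda>k. kron (mat 1) (transpose (A $ k))) *v stacked B = vectorize (col_gram A B)"
proof -
  have "(hcat (\<lambda>k. kron (mat 1) (transpose (A $ k))) *v stacked B) $ s = vectorize (col_gram A B) $ s" for s
  proof -
    have *: "(if fst s = j then 1 else 0) * A $ k $ i $ snd s * B $ k $ i $ j =
        (if j = fst s then A $ k $ i $ snd s * B $ k $ i $ j else 0)" for k i j
      by simp
    have "(hcat (\<lambda>k. kron (mat 1) (transpose (A $ k))) *v stacked B) $ s =
        (\<Sum>k\<in>UNIV. \<Sum>j\<in>UNIV. \<Sum>i\<in>UNIV. (if fst s = j then 1 else 0) * A $ k $ i $ snd s * B $ k $ i $ j)"
      by (simp add: matrix_vector_mult_def hcat_def kron_def stacked_def vectorize_def sum_UNIV_prod mat_def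
          transpose_def)
    also have "\<dots> = (\<Sum>k\<in>UNIV. \<Sum>i\<in>UNIV. \<Sum>j\<in>UNIV. (if fst s = j then 1 else 0) * A $ k $ i $ snd s * B $ k $ i $ j)"
      by (rule sum.cong[OF refl sum.swap])
    also have "\<dots> = (\<Sum>k\<in>UNIV. \<Sum>i\<in>UNIV. A $ k $ i $ snd s * B $ k $ i $ fst s)"
      unfolding * by simp
    finally show ?thesis
      by (simp add: vectorize_def col_gram_def matrix_matrix_mult_def transpose_def)
  qed
  then show ?thesis by (simp add: vec_eq_iff)
qed

lemma outer_mult: "outer x y *v z = (y \<bullet> z) *\<^sub>R x"
  by (simp add: outer_def matrix_vector_mult_def inner_vec_def vec_eq_iff sum_distrib_left mult_ac)

lemma commutation_sum: "(mat 1 + commutation_matrix) *v vectorize X = vectorize (X + transpose X)"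
  using commutation_matrix_vectorize[of "transpose X"]
  by (simp add: matrix_vector.add_left linear_add[OF linear_vectorize])

text \<open>The trace-free part of the symmetrised Gram matrix, divided by p. Since
  \<open>row_gram A B\<close> has trace \<open>A \<bullet> B\<close>, the second coefficient is the
  one that cancels the trace.\<close>

definition row_defect :: "real^'n::finite^'m::finite^'r::finite \<Rightarrow> real^'n^'m^'r \<Rightarrow> real^'m^'m" where
  "row_defect A B = (1 / real (CARD('m) * CARD('n))) *\<^sub>R (row_gram A B + row_gram B A)
     - (2 / (real CARD('m) ^ 2 * real CARD('n)) * (A \<bullet> B)) *\<^sub>R mat 1"

definition col_defect :: "real^'n::finite^'m::finite^'r::finite \<Rightarrow> real^'n^'m^'r \<Rightarrow> real^'n^'n" where
  "col_defect A B = (1 / real (CARD('m) * CARD('n))) *\<^sub>R (col_gram A B + col_gram B A)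
     - (2 / (real CARD('m) * real CARD('n) ^ 2) * (A \<bullet> B)) *\<^sub>R mat 1"

lemma J1_mult: "J1 A *v stacked B = vectorize (row_defect A B)"
  by (simp add: J1_def row_defect_def matrix_vector.diff_left matrix_vector.scaleR_left outer_mult inner_stacked
      flip: matrix_vector_mul_assoc transpose_row_gram[of A B] commutation_sum hcat_kron_row
      add: linear_diff[OF linear_vectorize] linear_scale[OF linear_vectorize])

lemma J2_mult: "J2 A *v stacked B = vectorize (col_defect A B)"
  by (simp add: J2_def col_defect_def matrix_vector.diff_left matrix_vector.scaleR_left outer_mult inner_stacked
      flip: matrix_vector_mul_assoc transpose_col_gram[of A B] commutation_sum hcat_kron_col
      add: linear_diff[OF linear_vectorize] linear_scale[OF linear_vectorize])

section \<open>The values of \<open>J\<close> as pairs of matrices with a number\<close>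

definition triple :: "real^'m::finite^'m \<Rightarrow> real^'n::finite^'n \<Rightarrow> real \<Rightarrow> real^(('m \<times> 'm) + (('n \<times> 'n) + unit))" where
  "triple X Y c = (\<chi> s. case s of Inl q \<Rightarrow> vectorize X $ q | Inr (Inl q) \<Rightarrow> vectorize Y $ q | Inr (Inr _) \<Rightarrow> c)"

lemma triple_cases:
  obtains X Y c where "w = triple X Y c"
proof
  show "w = triple (unvectorize (\<chi> q. w $ Inl q)) (unvectorize (\<chi> q. w $ Inr (Inl q))) (w $ Inr (Inr ()))"
    by (simp add: triple_def vectorize_unvectorize vec_eq_iff split: sum.split)
qed

lemma triple_eq_iff: "triple X Y c = triple X' Y' c' \<longleftrightarrow> X = X' \<and> Y = Y' \<and> c = c'"
proof
  assume *: "triple X Y c = triple X' Y' c'"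
  have "triple X Y c $ Inl q = triple X' Y' c' $ Inl q" "triple X Y c $ Inr (Inl q') = triple X' Y' c' $ Inr (Inl q')"
    "triple X Y c $ Inr (Inr ()) = triple X' Y' c' $ Inr (Inr ())" for q q'
    unfolding * by simp_all
  then have "vectorize X = vectorize X'" "vectorize Y = vectorize Y'" "c = c'"
    by (simp_all add: triple_def vec_eq_iff)
  then show "X = X' \<and> Y = Y' \<and> c = c'" by (metis unvectorize_vectorize)
qed simp

lemma triple_0: "triple 0 0 0 = 0"
  by (simp add: triple_def vectorize_def vec_eq_iff split: sum.split)

lemma triple_add: "triple (X + X') (Y + Y') (c + c') = triple X Y c + triple X' Y' c'"
  by (simp add: triple_def vec_eq_iff vectorize_def split: sum.split)

lemma triple_scaleR: "triple (r *\<^sub>R X) (r *\<^sub>R Y) (r * c) = r *\<^sub>R triple X Y c"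
  by (simp add: triple_def vec_eq_iff vectorize_def split: sum.split)

lemma inner_triple: "triple X Y c \<bullet> triple X' Y' c' = X \<bullet> X' + Y \<bullet> Y' + c * c'"
  unfolding inner_vec_def[of "triple X Y c"] sum_UNIV_sum inner_vectorize[of X, symmetric]
    inner_vectorize[of Y, symmetric]
  by (simp add: triple_def inner_vec_def[of "vectorize X"] inner_vec_def[of "vectorize Y"] UNIV_unit)

text \<open>All later arguments reach \<open>J\<close> through this formula: Kronecker products and
  commutation matrices disappear, and symmetry in \<open>A\<close> and \<open>B\<close> becomes
  visible.\<close>

lemma J_mult: "J A *v stacked B = triple (row_defect A B) (col_defect A B) (2 * (A \<bullet> B))"
proof -
  have "J A *v stacked B = (\<chi> s. case s of Inl q \<Rightarrow> (J1 A *v stacked B) $ q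
      | Inr (Inl q) \<Rightarrow> (J2 A *v stacked B) $ q | Inr (Inr u) \<Rightarrow> (J3 A *v stacked B) $ u)"
    by (simp add: J_def vcat_def matrix_vector_mult_def vec_eq_iff split: sum.split)
  also have "\<dots> = triple (row_defect A B) (col_defect A B) (2 * (A \<bullet> B))"
  proof -
    have J3: "($) (J3 A *v stacked B) = (\<lambda>u. 2 * (A \<bullet> B))"
      by (rule ext) (simp add: J3_def matrix_vector_mul_component inner_stacked)
    show ?thesis unfolding triple_def J1_mult J2_mult J3 ..
  qed
  finally show ?thesis .
qed

lemma row_defect_sym: "row_defect A B = row_defect B A"
  by (simp add: row_defect_def add.commute inner_commute)

lemma col_defect_sym: "col_defect A B = col_defect B A"
  by (simp add: col_defect_def add.commute inner_commute)

text \<open>One linear map whose kernel is exactly the trace-free symmetric matrices: its skew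
  summand and its scalar summand cannot cancel each other.\<close>

definition skew_trace :: "real^'a::finite^'a \<Rightarrow> real^'a^'a" where
  "skew_trace X = X - transpose X + trace X *\<^sub>R mat 1"

lemma skew_trace_eq_0: "skew_trace X = 0 \<longleftrightarrow> transpose X = X \<and> trace X = 0"
proof
  assume *: "skew_trace X = 0"
  have "trace (skew_trace X) = trace X * real CARD('a)"
    by (simp add: skew_trace_def trace_add trace_sub trace_transpose trace_scaleR trace_I)
  then have "trace X = 0" unfolding * by (simp add: trace_def)
  then show "transpose X = X \<and> trace X = 0" using * by (simp add: skew_trace_def)
qed (simp add: skew_trace_def)

lemma linear_skew_trace: "linear skew_trace"
  by (rule linearI)
    (simp_all add: skew_trace_def trace_add trace_scaleR transpose_add transpose_scalar
      scaleR_add_left scaleR_diff_right scaleR_add_right)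

text \<open>The matrix \<open>Q\<close> of the level set locale. It is zero on the last component
  because the number in a triple is unconstrained.\<close>

definition correction :: "real^(('m::finite \<times> 'm) + (('n::finite \<times> 'n) + unit))^(('m \<times> 'm) + (('n \<times> 'n) + unit))" where
  "correction = matrix (\<lambda>w. triple (skew_trace (unvectorize (\<chi> q. w $ Inl q)))
     (skew_trace (unvectorize (\<chi> q. w $ Inr (Inl q)))) 0)"

lemma correction_mult:
  fixes X :: "real^'a::finite^'a" and Y :: "real^'b::finite^'b"
  shows "correction *v triple X Y c = triple (skew_trace X) (skew_trace Y) 0"
proof -
  let ?f = "\<lambda>w :: real^(('a \<times> 'a) + (('b \<times> 'b) + unit)). triple (skew_trace (unvectorize (\<chi> q. w $ Inl q))) (skew_trace (unvectorize (\<chi> q. w $ Inr (Inl q)))) 0"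
  let ?X = "\<lambda>w. \<chi> q. w $ Inl q" and ?Y = "\<lambda>w. \<chi> q. w $ Inr (Inl q)"
  have "?X (v + w) = ?X v + ?X w" "?Y (v + w) = ?Y v + ?Y w" "?X (r *\<^sub>R w) = r *\<^sub>R ?X w" "?Y (r *\<^sub>R w) = r *\<^sub>R ?Y w"
    for v w :: "real^(('a \<times> 'a) + (('b \<times> 'b) + unit))" and r
    by (simp_all add: vec_eq_iff)
  then have "linear ?f"
    by (intro linearI)
      (simp_all only: linear_add[OF linear_unvectorize] linear_add[OF linear_skew_trace] linear_scale[OF linear_unvectorize]
        linear_scale[OF linear_skew_trace] add_0_left mult_zero_right flip: triple_add triple_scaleR)
  then have "correction *v triple X Y c = ?f (triple X Y c)"
    unfolding correction_def by (simp add: matrix_works[unfolded linear_matrix_vector_mul_eq])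
  then show ?thesis by (simp add: triple_def unvectorize_vectorize)
qed

lemma trace_row_defect: "trace (row_defect A B) = 0"
proof -
  have tr: "trace (row_gram A B) = A \<bullet> B" for A B :: "real^'n::finite^'m::finite^'r::finite"
    using inner_row_gram[of "mat 1" A B] by (simp add: inner_mat_1 inner_commute[of "mat 1"] inner_vec_def[of A])
  show ?thesis
    by (simp add: row_defect_def trace_add trace_sub trace_scaleR trace_I tr inner_commute power2_eq_square)
qed

lemma trace_col_defect: "trace (col_defect A B) = 0"
proof -
  have tr: "trace (col_gram A B) = A \<bullet> B" for A B :: "real^'n::finite^'m::finite^'r::finite"
    using inner_col_gram[of "mat 1" A B] by (simp add: inner_mat_1 inner_commute[of "mat 1"] inner_vec_def[of A])
  show ?thesis
    by (simp add: col_defect_def trace_add trace_sub trace_scaleR trace_I tr inner_commute power2_eq_square)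
qed

lemma transpose_row_defect: "transpose (row_defect A B) = row_defect A B"
  by (simp add: row_defect_def transpose_diff transpose_add transpose_scalar transpose_row_gram add.commute)

lemma transpose_col_defect: "transpose (col_defect A B) = col_defect A B"
  by (simp add: col_defect_def transpose_diff transpose_add transpose_scalar transpose_col_gram add.commute)

lemma correction_J: "correction ** J A = 0"
proof -
  have "correction *v (J A *v z) = 0" for z
  proof -
    have "z = stacked (unphi (unvectorize z))" by (simp add: stacked_unphi vectorize_unvectorize)
    then have "correction *v (J A *v z) = correction *v (J A *v stacked (unphi (unvectorize z)))" by simp
    also have "\<dots> = 0"
      unfolding J_mult correction_mult
      by (simp add: skew_trace_eq_0[THEN iffD2] trace_row_defect trace_col_defect transpose_row_defect
          transpose_col_defect triple_0)
    finally show ?thesis .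
  qed
  then have "(correction ** J A) *v z = 0 *v z" for z
    by (simp add: matrix_vector_mul_assoc)
  then show ?thesis unfolding matrix_eq by blast
qed

text \<open>Linearity is tested on each \<open>J A *v stacked B\<close>, where the bilinear formula
  applies; the vectors \<open>stacked B\<close> exhaust the whole space.\<close>

lemma linear_J: "linear (J :: real^'n::finite^'m::finite^'r::finite \<Rightarrow> _)"
proof -
  have *: "linear (\<lambda>A. J A *v stacked B)" for B :: "real^'n^'m^'r"
  proof -
    have row: "row_gram B (x + y) = row_gram B x + row_gram B y" "row_gram B (c *\<^sub>R x) = c *\<^sub>R row_gram B x" for x y :: "real^'n^'m^'r" and c
      by (simp_all add: row_gram_def matrix_mult.add_left matrix_mult.scaleR_left sum.distrib scaleR_sum_right)
    have row': "row_gram (x + y) B = row_gram x B + row_gram y B" "row_gram (c *\<^sub>R x) B = c *\<^sub>R row_gram x B" for x y :: "real^'n^'m^'r" and c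
      using row by (metis transpose_row_gram transpose_add, metis transpose_row_gram row(2) transpose_scalar)
    have col: "col_gram B (x + y) = col_gram B x + col_gram B y" "col_gram B (c *\<^sub>R x) = c *\<^sub>R col_gram B x" for x y :: "real^'n^'m^'r" and c
      by (simp_all add: col_gram_def matrix_mult.add_right matrix_mult.scaleR_right sum.distrib scaleR_sum_right)
    have col': "col_gram (x + y) B = col_gram x B + col_gram y B" "col_gram (c *\<^sub>R x) B = c *\<^sub>R col_gram x B" for x y :: "real^'n^'m^'r" and c
      using col by (metis transpose_col_gram transpose_add, metis transpose_col_gram col(2) transpose_scalar)
    have "row_defect (x + y) B = row_defect x B + row_defect y B" "row_defect (c *\<^sub>R x) B = c *\<^sub>R row_defect x B"
      "col_defect (x + y) B = col_defect x B + col_defect y B" "col_defect (c *\<^sub>R x) B = c *\<^sub>R col_defect x B" for x y and c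
      by (simp_all add: row_defect_def col_defect_def row row' col col' inner_add_left scaleR_add_right
          scaleR_add_left scaleR_diff_right distrib_left mult_ac add_divide_distrib)
    then show ?thesis
      by (intro linearI)
        (simp_all add: J_mult inner_add_left distrib_left mult.left_commute flip: triple_add triple_scaleR)
  qed
  have st: "stacked (unphi (unvectorize z)) = z" for z :: "real^('r \<times> ('n \<times> 'm))"
    by (simp add: stacked_unphi vectorize_unvectorize)
  show ?thesis
  proof (rule linearI)
    show "J (x + y) = J x + J y" for x y :: "real^'n^'m^'r"
      unfolding matrix_eq matrix_vector.add_left using linear_add[OF *] by (metis st)
    show "J (c *\<^sub>R x) = c *\<^sub>R J x" for c and x :: "real^'n^'m^'r"
      unfolding matrix_eq matrix_vector.scaleR_left using linear_scale[OF *] by (metis st)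
  qed
qed

lemma inner_all_eq_0: "(\<forall>y. x \<bullet> y = 0) \<longleftrightarrow> x = 0"
  using inner_eq_zero_iff inner_zero_left by blast

text \<open>Pairing the triple with \<open>J A *v stacked B\<close> gives, up to the factor 2/p, the
  pairing of the displayed tuple with \<open>B\<close>: symmetry merges the two Gram terms, and zero
  trace removes the multiples of \<open>mat 1\<close>.\<close>

lemma J_transpose_kernel:
  fixes A :: "real^'n::finite^'m::finite^'r::finite"
  assumes X: "transpose X = X" "trace X = 0" and Y: "transpose Y = Y" "trace Y = 0"
  shows "transpose (J A) *v triple X Y c = 0 \<longleftrightarrow>
    (\<forall>k. X ** A $ k + A $ k ** Y + (real (CARD('m) * CARD('n)) * c) *\<^sub>R A $ k = 0)"
proof -
  let ?p = "real (CARD('m) * CARD('n))"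
  let ?E = "\<chi> k. X ** A $ k + A $ k ** Y + (?p * c) *\<^sub>R A $ k"
  have p: "?p \<noteq> 0" by simp
  have *: "(transpose (J A) *v triple X Y c) \<bullet> stacked B = (2 / ?p) * (?E \<bullet> B)" for B
  proof -
    have Xg: "X \<bullet> row_gram B A = X \<bullet> row_gram A B"
      by (metis X(1) inner_transpose transpose_row_gram)
    have Yg: "Y \<bullet> col_gram B A = Y \<bullet> col_gram A B"
      by (metis Y(1) inner_transpose transpose_col_gram)
    have "(transpose (J A) *v triple X Y c) \<bullet> stacked B = triple X Y c \<bullet> (J A *v stacked B)"
      by (simp add: inner_matrix_vector)
    also have "\<dots> = X \<bullet> row_defect A B + Y \<bullet> col_defect A B + c * (2 * (A \<bullet> B))"
      by (simp add: J_mult inner_triple)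
    also have "X \<bullet> row_defect A B = (2 / ?p) * (X \<bullet> row_gram A B)"
      by (simp add: row_defect_def inner_diff_right inner_add_right Xg inner_mat_1 X(2))
    also have "Y \<bullet> col_defect A B = (2 / ?p) * (Y \<bullet> col_gram A B)"
      by (simp add: col_defect_def inner_diff_right inner_add_right Yg inner_mat_1 Y(2))
    also have "(2 / ?p) * (X \<bullet> row_gram A B) + (2 / ?p) * (Y \<bullet> col_gram A B) + c * (2 * (A \<bullet> B)) =
        (2 / ?p) * (X \<bullet> row_gram A B + Y \<bullet> col_gram A B + ?p * c * (A \<bullet> B))"
      using p by (simp add: field_simps)
    also have "X \<bullet> row_gram A B + Y \<bullet> col_gram A B + ?p * c * (A \<bullet> B) = ?E \<bullet> B"
      unfolding inner_row_gram inner_col_gram inner_vec_def[of A] inner_vec_def[of ?E]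
      by (simp add: inner_add_left sum.distrib sum_distrib_left)
    finally show ?thesis .
  qed
  have "transpose (J A) *v triple X Y c = 0 \<longleftrightarrow> (\<forall>z. (transpose (J A) *v triple X Y c) \<bullet> z = 0)"
    by (rule inner_all_eq_0[symmetric])
  also have "\<dots> \<longleftrightarrow> (\<forall>B. (transpose (J A) *v triple X Y c) \<bullet> stacked B = 0)"
    by (metis stacked_unphi vectorize_unvectorize)
  also have "\<dots> \<longleftrightarrow> (\<forall>B. ?E \<bullet> B = 0)"
    unfolding * using p by simp
  also have "\<dots> \<longleftrightarrow> ?E = 0"
    by (rule inner_all_eq_0)
  finally show ?thesis by (simp add: vec_eq_iff)
qed

section \<open>Decomposability of balanced tuples\<close>

definition balanced :: "real^'n::finite^'m::finite^'r::finite \<Rightarrow> bool" where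
  "balanced A \<longleftrightarrow> row_gram A A = real CARD('n) *\<^sub>R mat 1 \<and> col_gram A A = real CARD('m) *\<^sub>R mat 1"

text \<open>Take a maximiser \<open>u\<close> of the Rayleigh quotient on the unit sphere. The form
  \<open>q\<close> is nonnegative and vanishes at \<open>u\<close>, so its gradient vanishes there,
  which is the eigenvector equation.\<close>

lemma symmetric_eigenvector:
  fixes X :: "real^'a^'a"
  assumes "transpose X = X"
  obtains l u where "u \<noteq> 0" "X *v u = l *\<^sub>R u"
proof -
  have cont: "continuous_on (sphere 0 1) (\<lambda>v. v \<bullet> (X *v v))"
    by (intro continuous_on_inner continuous_on_id linear_continuous_on matrix_vector_mul_bounded_linear)
  have "sphere (0 :: real^'a) 1 \<noteq> {}" by simp
  then obtain u where u: "norm u = 1" and max: "\<And>v. norm v = 1 \<Longrightarrow> v \<bullet> (X *v v) \<le> u \<bullet> (X *v u)"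
    using continuous_attains_sup[OF compact_sphere _ cont] by auto
  define l where "l = u \<bullet> (X *v u)"
  define q where "q v = l * (v \<bullet> v) - v \<bullet> (X *v v)" for v
  have q_nonneg: "0 \<le> q v" for v
  proof (cases "v = 0")
    case False
    then have "(v /\<^sub>R norm v) \<bullet> (X *v (v /\<^sub>R norm v)) \<le> l"
      unfolding l_def by (intro max) simp
    then have "v \<bullet> (X *v v) / (norm v)\<^sup>2 \<le> l"
      by (simp add: matrix_vector.scaleR_right power2_eq_square divide_inverse mult_ac)
    then show ?thesis
      using False by (simp add: q_def divide_le_eq power2_norm_eq_inner)
  qed (simp add: q_def)
  \<comment> \<open>Half the gradient of \<open>q\<close> at \<open>u\<close>. If it were nonzero, a
    small step against it would make \<open>q\<close> negative.\<close>
  define d where "d = l *\<^sub>R u - X *v u"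
  have qu: "q u = 0" using u by (simp add: q_def l_def norm_eq_1)
  have sym: "d \<bullet> (X *v u) = u \<bullet> (X *v d)"
    by (metis assms inner_commute inner_matrix_vector)
  have expand: "q (u - s *\<^sub>R d) = s * (s * q d - 2 * (d \<bullet> d))" for s
  proof -
    have "q (u - s *\<^sub>R d) = q u - 2 * s * (l * (u \<bullet> d) - d \<bullet> (X *v u)) + s\<^sup>2 * q d"
      using sym unfolding q_def
      by (simp add: matrix_vector.diff_right matrix_vector.scaleR_right inner_diff_left inner_diff_right
          inner_commute[of d u] power2_eq_square algebra_simps)
    also have "l * (u \<bullet> d) - d \<bullet> (X *v u) = d \<bullet> d"
      by (simp add: d_def[THEN arg_cong, of "inner d"] inner_diff_right inner_commute)
    finally show ?thesis using qu by (simp add: power2_eq_square algebra_simps)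
  qed
  have "d = 0"
  proof (rule ccontr)
    assume "d \<noteq> 0"
    then have dd: "0 < d \<bullet> d" by simp
    \<comment> \<open>Small enough that \<open>s * q d\<close> is at most
      \<open>d \<bullet> d\<close>; the summand 1 covers the case \<open>q d = 0\<close>.\<close>
    define s where "s = (d \<bullet> d) / (q d + 1)"
    have s: "0 < s" unfolding s_def using dd q_nonneg[of d] by (intro divide_pos_pos) auto
    have "s * q d \<le> d \<bullet> d"
      using q_nonneg[of d] dd by (simp add: s_def field_simps)
    then have "s * q d - 2 * (d \<bullet> d) < 0" using dd by linarith
    then have "s * (s * q d - 2 * (d \<bullet> d)) < 0"
      by (rule mult_pos_neg[OF s])
    then show False using q_nonneg[of "u - s *\<^sub>R d"] expand[of s] by simp
  qed
  then have "X *v u = l *\<^sub>R u" by (simp add: d_def)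
  moreover have "u \<noteq> 0" using u by auto
  ultimately show thesis by (rule that[rotated])
qed

text \<open>The position map is strictly monotone, hence a bijection onto
  \<open>{..<CARD('a)}\<close>. This links the block sizes in \<open>block_diagonal\<close> with
  dimensions and traces.\<close>

lemma card_initial_segment:
  assumes "a \<le> CARD('a::{finite,linorder})"
  shows "card {i::'a. card {..<i} < a} = a"
proof -
  let ?f = "\<lambda>i::'a. card {..<i}"
  have mono: "?f i < ?f j" if "i < j" for i j
    using that by (intro psubset_card_mono) auto
  have inj: "inj ?f"
  proof (rule injI, rule ccontr)
    fix i j :: 'a assume ij: "?f i = ?f j" "i \<noteq> j"
    from ij(2) consider "i < j" | "j < i" by (rule linorder_neqE)
    then show False using mono[of i j] mono[of j i] ij(1) by cases simp_all
  qed
  have "?f i < CARD('a)" for i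
    by (intro psubset_card_mono) auto
  then have "range ?f \<subseteq> {..<CARD('a)}" by auto
  moreover have "card (range ?f) = card {..<CARD('a)}"
    using card_image[OF inj] by simp
  ultimately have range: "range ?f = {..<CARD('a)}"
    by (intro card_subset_eq) auto
  have "?f ` {i. ?f i < a} = {..<a}"
  proof (intro equalityI subsetI)
    fix x assume "x \<in> {..<a}"
    then have "x \<in> range ?f" unfolding range using assms by simp
    then show "x \<in> ?f ` {i. ?f i < a}" using \<open>x \<in> {..<a}\<close> by auto
  qed auto
  then show ?thesis
    using card_image[OF inj_on_subset[OF inj subset_UNIV], of "{i. ?f i < a}"] by simp
qed

text \<open>The rows at the first \<open>dim T\<close> positions form an orthonormal basis of
  \<open>T\<close>, the others one of its orthogonal complement.\<close>

lemma adapted_orthogonal_matrix: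
  fixes T :: "(real^'a::{finite,linorder}) set"
  assumes "subspace T"
  obtains P :: "real^'a::{finite,linorder}^'a::{finite,linorder}" where "orthogonal_matrix P"
    "\<And>i. card {..<i} < dim T \<Longrightarrow> P $ i \<in> T"
    "\<And>i x. \<not> card {..<i} < dim T \<Longrightarrow> x \<in> T \<Longrightarrow> P $ i \<bullet> x = 0"
proof -
  let ?I = "{i::'a. card {..<i} < dim T}"
  let ?T' = "{y. \<forall>x\<in>T. orthogonal x y}"
  have dimT: "dim T \<le> CARD('a)"
    using dim_subset_UNIV_cart by blast
  have "dim ?T' + dim T = CARD('a)"
    using dim_subspace_orthogonal_to_vectors[OF assms subspace_UNIV] by simp
  obtain B1 where B1: "B1 \<subseteq> T" "pairwise orthogonal B1" "\<And>x. x \<in> B1 \<Longrightarrow> norm x = 1" "independent B1" "card B1 = dim T" "span B1 = T"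
    by (rule orthonormal_basis_subspace[OF assms]) (rule that; blast)
  obtain B2 where B2: "B2 \<subseteq> ?T'" "pairwise orthogonal B2" "\<And>x. x \<in> B2 \<Longrightarrow> norm x = 1" "independent B2" "card B2 = dim ?T'" "span B2 = ?T'"
    by (rule orthonormal_basis_subspace[OF subspace_orthogonal_to_vectors]) (rule that; blast)
  have fin: "finite B1" "finite B2" using B1(4) B2(4) by (auto simp: independent_imp_finite)
  have "card ?I = card B1" using card_initial_segment[OF dimT] B1(5) by simp
  then obtain e1 where e1: "bij_betw e1 ?I B1" using fin by (metis finite finite_same_card_bij)
  have "card (- ?I) = card B2"
    using card_initial_segment[OF dimT] B2(5) \<open>dim ?T' + dim T = CARD('a)\<close> by (simp add: Compl_eq_Diff_UNIV card_Diff_subset)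
  then obtain e2 where e2: "bij_betw e2 (- ?I) B2" using fin by (metis finite finite_same_card_bij)
  define e where "e i = (if i \<in> ?I then e1 i else e2 i)" for i
  have eI: "e i \<in> B1" if "i \<in> ?I" for i
    using that e1 by (auto simp: e_def bij_betw_def)
  have eN: "e i \<in> B2" if "i \<notin> ?I" for i
    using that e2 by (auto simp: e_def bij_betw_def)
  have orth12: "orthogonal x y" if "x \<in> B1" "y \<in> B2" for x y
    using that B1(1) B2(1) by blast
  have orth: "orthogonal (e i) (e j)" if "i \<noteq> j" for i j
  proof (cases "i \<in> ?I"; cases "j \<in> ?I")
    assume ij: "i \<in> ?I" "j \<in> ?I"
    then have "e i \<noteq> e j" using that e1 by (auto simp: e_def bij_betw_def inj_on_def)
    then show ?thesis using B1(2) eI[OF ij(1)] eI[OF ij(2)] by (simp add: pairwise_def)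
  next
    assume ij: "i \<notin> ?I" "j \<notin> ?I"
    then have "e i \<noteq> e j" using that e2 by (auto simp: e_def bij_betw_def inj_on_def)
    then show ?thesis using B2(2) eN[OF ij(1)] eN[OF ij(2)] by (simp add: pairwise_def)
  next
    assume "i \<in> ?I" "j \<notin> ?I"
    then show ?thesis by (intro orth12 eI eN)
  next
    assume "i \<notin> ?I" "j \<in> ?I"
    then have "orthogonal (e j) (e i)" by (intro orth12 eI eN)
    then show ?thesis by (simp add: orthogonal_commute)
  qed
  have norm: "norm (e i) = 1" for i
    using eI eN B1(3) B2(3) by (cases "i \<in> ?I") blast+
  show thesis
  proof (rule that[of "\<chi> i. e i"])
    have "row i (\<chi> i. e i) = e i" for i by (simp add: row_def vec_eq_iff)
    then show "orthogonal_matrix (\<chi> i. e i)"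
      using norm orth by (simp add: orthogonal_matrix_orthonormal_rows)
    show "(\<chi> i. e i) $ i \<in> T" if "card {..<i} < dim T" for i
      using that eI B1(1) by auto
    show "(\<chi> i. e i) $ i \<bullet> x = 0" if "\<not> card {..<i} < dim T" "x \<in> T" for i x
      using that eN[of i] B2(1) by (auto simp: orthogonal_def inner_commute)
  qed
qed

lemma orthogonal_matrix_inv:
  fixes Q :: "real^'a^'a"
  assumes "orthogonal_matrix Q"
  shows "invertible Q" "matrix_inv Q = transpose Q"
proof -
  have Q: "Q ** transpose Q = mat 1" "transpose Q ** Q = mat 1"
    using assms by (auto simp: orthogonal_matrix_def)
  then show inv: "invertible Q" by (auto simp: invertible_def)
  have "matrix_inv Q ** Q ** transpose Q = transpose Q"
    by (simp add: matrix_inv_inverse[OF inv])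
  then show "matrix_inv Q = transpose Q"
    by (simp add: matrix_mul_assoc[symmetric] Q)
qed

lemma dim_proper:
  fixes T :: "(real^'a) set"
  assumes "subspace T" "T \<noteq> {0}" "T \<noteq> UNIV"
  shows "1 \<le> dim T" "dim T \<le> CARD('a) - 1"
proof -
  have "dim T \<noteq> 0"
    using assms(1,2) subspace_0 by (auto simp: dim_eq_0)
  then show "1 \<le> dim T" by linarith
  have "dim T \<noteq> CARD('a)"
    using assms(1,3) dim_eq_full[of T] by (simp add: span_eq_iff[THEN iffD2])
  then show "dim T \<le> CARD('a) - 1"
    using dim_subset_UNIV_cart[of T] by linarith
qed

text \<open>The condition on transposes says that the orthogonal complement of \<open>S\<close> is
  sent into that of \<open>T\<close>. In adapted orthonormal bases an entry is
  \<open>P $ i \<bullet> (A $ k *v Q $ j)\<close>, so both off-diagonal blocks vanish.\<close>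

lemma invariant_subspaces_decomposable:
  fixes A :: "real^'n::{finite,linorder}^'m::{finite,linorder}^'r"
  assumes T: "subspace T" "T \<noteq> {0}" "T \<noteq> UNIV" and S: "subspace S" "S \<noteq> {0}" "S \<noteq> UNIV"
    and A: "\<And>k y. y \<in> S \<Longrightarrow> A $ k *v y \<in> T" "\<And>k x. x \<in> T \<Longrightarrow> transpose (A $ k) *v x \<in> S"
  shows "canonically_decomposable A"
proof -
  obtain P where P: "orthogonal_matrix P" "\<And>i. card {..<i} < dim T \<Longrightarrow> P $ i \<in> T"
    "\<And>i x. \<not> card {..<i} < dim T \<Longrightarrow> x \<in> T \<Longrightarrow> P $ i \<bullet> x = 0"
    using adapted_orthogonal_matrix[OF T(1)] by metis
  obtain Q where Q: "orthogonal_matrix Q" "\<And>i. card {..<i} < dim S \<Longrightarrow> Q $ i \<in> S"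
    "\<And>i x. \<not> card {..<i} < dim S \<Longrightarrow> x \<in> S \<Longrightarrow> Q $ i \<bullet> x = 0"
    using adapted_orthogonal_matrix[OF S(1)] by metis
  have entry: "(P ** A $ k ** matrix_inv Q) $ i $ j = P $ i \<bullet> (A $ k *v Q $ j)" for k i j
  proof -
    have "(P ** A $ k ** transpose Q) $ i $ j = (\<Sum>l\<in>UNIV. \<Sum>h\<in>UNIV. P $ i $ h * A $ k $ h $ l * Q $ j $ l)"
      by (simp add: matrix_matrix_mult_def transpose_def sum_distrib_right)
    also have "\<dots> = (\<Sum>h\<in>UNIV. \<Sum>l\<in>UNIV. P $ i $ h * A $ k $ h $ l * Q $ j $ l)"
      by (rule sum.swap)
    finally show ?thesis
      by (simp add: orthogonal_matrix_inv(2)[OF Q(1)] inner_vec_def matrix_vector_mult_def sum_distrib_left mult.assoc)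
  qed
  have "block_diagonal (dim T) (dim S) (P ** A $ k ** matrix_inv Q)" for k
    unfolding block_diagonal_def
  proof (intro allI impI)
    fix i :: 'm and j :: 'n assume "(card {..<i} < dim T) \<noteq> (card {..<j} < dim S)"
    then consider "card {..<i} < dim T" "\<not> card {..<j} < dim S" | "\<not> card {..<i} < dim T" "card {..<j} < dim S"
      by blast
    then show "(P ** A $ k ** matrix_inv Q) $ i $ j = 0"
    proof cases
      case 1
      then have "Q $ j \<bullet> (transpose (A $ k) *v P $ i) = 0"
        by (intro Q(3) A(2) P(2))
      then show ?thesis
        by (simp add: entry inner_matrix_vector inner_commute[of "P $ i"])
    next
      case 2
      then show ?thesis unfolding entry by (intro P(3) A(1) Q(2))
    qed
  qed
  then show ?thesis
    unfolding canonically_decomposable_def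
    using orthogonal_matrix_inv(1)[OF P(1)] orthogonal_matrix_inv(1)[OF Q(1)] dim_proper[OF T] dim_proper[OF S]
    by blast
qed

text \<open>Each hypothesis makes a Gram matrix, a nonzero multiple of the identity, annihilate the
  given vector or matrix.\<close>

lemma balanced_annihilated:
  fixes A :: "real^'n::finite^'m::finite^'r::finite"
  assumes "balanced A"
  shows "(\<And>k. transpose (A $ k) *v x = 0) \<Longrightarrow> x = 0" and "(\<And>k. A $ k *v y = 0) \<Longrightarrow> y = 0"
    and "(\<And>k. X ** A $ k = 0) \<Longrightarrow> X = 0" and "(\<And>k. A $ k ** Y = 0) \<Longrightarrow> Y = 0"
proof -
  show "x = 0" if "\<And>k. transpose (A $ k) *v x = 0"
  proof -
    have "row_gram A A *v x = (\<Sum>k\<in>UNIV. A $ k *v (transpose (A $ k) *v x))"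
      by (simp add: row_gram_def matrix_vector.sum_left matrix_vector_mul_assoc)
    then show ?thesis
      using assms that by (simp add: balanced_def matrix_vector.scaleR_left)
  qed
  show "y = 0" if "\<And>k. A $ k *v y = 0"
  proof -
    have "col_gram A A *v y = (\<Sum>k\<in>UNIV. transpose (A $ k) *v (A $ k *v y))"
      by (simp add: col_gram_def matrix_vector.sum_left matrix_vector_mul_assoc)
    then show ?thesis
      using assms that by (simp add: balanced_def matrix_vector.scaleR_left)
  qed
  show "X = 0" if "\<And>k. X ** A $ k = 0"
  proof -
    have "X ** row_gram A A = (\<Sum>k\<in>UNIV. (X ** A $ k) ** transpose (A $ k))"
      by (simp add: row_gram_def matrix_mult.sum_right matrix_mul_assoc)
    then show ?thesis
      using assms that by (simp add: balanced_def matrix_mult.scaleR_right)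
  qed
  show "Y = 0" if "\<And>k. A $ k ** Y = 0"
  proof -
    have "col_gram A A ** Y = (\<Sum>k\<in>UNIV. transpose (A $ k) ** (A $ k ** Y))"
      by (simp add: col_gram_def matrix_mult.sum_left matrix_mul_assoc)
    then show ?thesis
      using assms that by (simp add: balanced_def matrix_mult.scaleR_left)
  qed
qed

lemma trace_mult_grams:
  fixes A :: "real^'n::finite^'m::finite^'r::finite"
  assumes "balanced A"
  shows "(\<Sum>k\<in>UNIV. trace (X ** A $ k ** transpose (A $ k))) = real CARD('n) * trace X"
    and "(\<Sum>k\<in>UNIV. trace (A $ k ** Y ** transpose (A $ k))) = real CARD('m) * trace Y"
proof -
  show "(\<Sum>k\<in>UNIV. trace (X ** A $ k ** transpose (A $ k))) = real CARD('n) * trace X"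
    using assms by (simp add: trace_mult_row_gram[symmetric] balanced_def matrix_mult.scaleR_right trace_scaleR)
  have "(\<Sum>k\<in>UNIV. trace (A $ k ** Y ** transpose (A $ k))) = (\<Sum>k\<in>UNIV. trace (transpose (A $ k) ** A $ k ** Y))"
    by (rule sum.cong[OF refl]) (metis trace_mul_sym matrix_mul_assoc)
  also have "\<dots> = trace (col_gram A A ** Y)"
    by (simp add: col_gram_def matrix_mult.sum_left trace_sum)
  finally show "(\<Sum>k\<in>UNIV. trace (A $ k ** Y ** transpose (A $ k))) = real CARD('m) * trace Y"
    using assms by (simp add: balanced_def matrix_mult.scaleR_left trace_scaleR)
qed

text \<open>The delicate point is that the paired eigenspaces \<open>?T\<close> and
  \<open>?S\<close> are proper and nonzero: trace zero prevents \<open>X\<close> and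
  \<open>Y\<close> from being nonzero scalars, and by balance some \<open>transpose (A $ k)\<close>
  carries the eigenvector \<open>u\<close> to a nonzero vector of \<open>?S\<close>.\<close>

lemma indecomposable_imp_regular:
  fixes A :: "real^'n::{finite,linorder}^'m::{finite,linorder}^'r"
  assumes A: "balanced A" "\<not> canonically_decomposable A"
    and X: "transpose X = X" "trace X = 0" and Y: "transpose Y = Y" "trace Y = 0"
    and eq: "\<And>k. X ** A $ k + A $ k ** Y + c *\<^sub>R A $ k = 0"
  shows "X = 0 \<and> Y = 0 \<and> c = 0"
proof -
  \<comment> \<open>Pairing the equation with \<open>A\<close> itself kills the terms of the
    trace-free \<open>X\<close> and \<open>Y\<close> and leaves \<open>c\<close> times the product
    of the dimensions.\<close>
  have "0 = (\<Sum>k\<in>UNIV. trace ((X ** A $ k + A $ k ** Y + c *\<^sub>R A $ k) ** transpose (A $ k)))"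
    by (simp add: eq trace_def)
  also have "\<dots> = (\<Sum>k\<in>UNIV. trace (X ** A $ k ** transpose (A $ k))) +
      (\<Sum>k\<in>UNIV. trace (A $ k ** Y ** transpose (A $ k))) +
      c * (\<Sum>k\<in>UNIV. trace (mat 1 ** A $ k ** transpose (A $ k)))"
    by (simp add: matrix_mult.add_left matrix_mult.scaleR_left trace_add trace_scaleR sum.distrib sum_distrib_left)
  also have "\<dots> = c * (real CARD('n) * real CARD('m))"
    unfolding trace_mult_grams[OF A(1)] using X Y by (simp add: trace_I)
  finally have c: "c = 0" by simp
  have XA: "X ** A $ k = - (A $ k ** Y)" for k
    using eq[of k] c by (simp add: eq_neg_iff_add_eq_0)
  have AX: "transpose (A $ k) ** X = - (Y ** transpose (A $ k))" for k
  proof -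
    have "transpose (X ** A $ k) = transpose (- (A $ k ** Y))" by (simp only: XA)
    then show ?thesis
      using X(1) Y(1) by (simp add: matrix_transpose_mul transpose_minus)
  qed
  have "X = 0"
  proof (rule ccontr)
    assume X0: "X \<noteq> 0"
    obtain l u where u: "u \<noteq> 0" "X *v u = l *\<^sub>R u"
      using symmetric_eigenvector[OF X(1)] by metis
    let ?T = "{x. X *v x = l *\<^sub>R x}" and ?S = "{y. Y *v y = (- l) *\<^sub>R y}"
    have T: "subspace ?T"
      by (auto simp: subspace_def matrix_vector.add_right matrix_vector.scaleR_right scaleR_add_right)
    have S: "subspace ?S"
      by (auto simp: subspace_def matrix_vector.add_right matrix_vector.scaleR_right scaleR_add_right)
    have scalar: "Z = l *\<^sub>R mat 1" if "\<And>x. Z *v x = l *\<^sub>R x" for Z :: "real^'b::finite^'b" and l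
      unfolding matrix_eq using that by (simp add: matrix_vector.scaleR_left)
    have "?T \<noteq> UNIV"
    proof
      assume "?T = UNIV"
      then have *: "X = l *\<^sub>R mat 1" by (intro scalar) blast
      then have "trace X = l * real CARD('m)" by (simp add: trace_scaleR trace_I)
      then show False using X(2) X0 * by simp
    qed
    moreover have "?S \<noteq> UNIV"
    proof
      assume "?S = UNIV"
      then have *: "Y = (- l) *\<^sub>R mat 1" by (intro scalar) blast
      then have "trace Y = - l * real CARD('n)" by (simp only: trace_scaleR trace_I)
      then have "Y = 0" using Y(2) * by simp
      then have "X = 0" using XA by (intro balanced_annihilated(3)[OF A(1)]) simp
      then show False using X0 by simp
    qed
    moreover have AS: "A $ k *v y \<in> ?T" if "y \<in> ?S" for k y
    proof -
      have "X *v (A $ k *v y) = - (A $ k *v (Y *v y))"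
        by (simp add: matrix_vector_mul_assoc XA matrix_vector.minus_left)
      then show ?thesis using that by (simp add: matrix_vector.minus_right matrix_vector.scaleR_right)
    qed
    moreover have AT: "transpose (A $ k) *v x \<in> ?S" if "x \<in> ?T" for k x
    proof -
      have "Y *v (transpose (A $ k) *v x) = - (transpose (A $ k) *v (X *v x))"
        by (simp add: matrix_vector_mul_assoc AX matrix_vector.minus_left)
      then show ?thesis using that by (simp add: matrix_vector.minus_right matrix_vector.scaleR_right)
    qed
    moreover have "?T \<noteq> {0}" using u by blast
    moreover have "?S \<noteq> {0}"
    proof
      assume "?S = {0}"
      then have "transpose (A $ k) *v u = 0" for k using AT[of u k] u(2) by blast
      then show False using balanced_annihilated(1)[OF A(1)] u(1) by blast
    qed
    ultimately have "canonically_decomposable A"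
      by (intro invariant_subspaces_decomposable[OF T _ _ S])
    then show False using A(2) by contradiction
  qed
  moreover from this have "Y = 0"
    using XA by (intro balanced_annihilated(4)[OF A(1)]) simp
  ultimately show ?thesis using c by simp
qed

text \<open>An endomorphism \<open>(E, F)\<close> of a balanced tuple is normal in the sense that its transpose is
  again an endomorphism: the squared distance of \<open>E\<^sup>T A\<^sub>k\<close> and \<open>A\<^sub>k F\<^sup>T\<close> sums up to zero.\<close>

lemma balanced_transpose_endomorphism:
  fixes A :: "real^'n::finite^'m::finite^'r::finite"
  assumes A: "balanced A" and eq: "\<And>k. E ** A $ k = A $ k ** F"
  shows "transpose E ** A $ k = A $ k ** transpose F"
proof -
  let ?m = "real CARD('m)" and ?n = "real CARD('n)"
  let ?D = "\<lambda>k. transpose E ** A $ k - A $ k ** transpose F"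
  have row: "(\<Sum>k\<in>UNIV. (X ** A $ k) \<bullet> (Z ** A $ k)) = ?n * (X \<bullet> Z)" for X Z :: "real^'m^'m"
  proof -
    have "(\<Sum>k\<in>UNIV. (X ** A $ k) \<bullet> (Z ** A $ k)) = (\<Sum>k\<in>UNIV. (transpose Z ** X ** A $ k) \<bullet> A $ k)"
      by (simp add: inner_matrix_mult_left matrix_mul_assoc)
    also have "\<dots> = (transpose Z ** X) \<bullet> row_gram A A"
      by (rule inner_row_gram[symmetric])
    also have "\<dots> = ?n * (X \<bullet> Z)"
      using A by (simp add: balanced_def inner_mat_1 inner_commute[of X] inner_eq_trace[of Z])
    finally show ?thesis .
  qed
  have col: "(\<Sum>k\<in>UNIV. (A $ k ** X) \<bullet> (A $ k ** Z)) = ?m * (X \<bullet> Z)" for X Z :: "real^'n^'n"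
  proof -
    have "(\<Sum>k\<in>UNIV. (A $ k ** X) \<bullet> (A $ k ** Z)) = (\<Sum>k\<in>UNIV. (A $ k ** (X ** transpose Z)) \<bullet> A $ k)"
      by (simp add: inner_matrix_mult_right matrix_mul_assoc)
    also have "\<dots> = (X ** transpose Z) \<bullet> col_gram A A"
      by (rule inner_col_gram[symmetric])
    also have "\<dots> = ?m * trace (X ** transpose Z)"
      using A by (simp add: balanced_def inner_mat_1)
    also have "trace (X ** transpose Z) = X \<bullet> Z"
      by (metis inner_commute inner_eq_trace trace_mul_sym)
    finally show ?thesis .
  qed
  \<comment> \<open>Moving \<open>transpose E\<close> to the other factor produces
    \<open>E ** A $ k\<close>, where the hypothesis \<open>eq\<close> applies.\<close>
  have cross: "(\<Sum>k\<in>UNIV. (transpose E ** A $ k) \<bullet> (A $ k ** transpose F)) = ?m * (F \<bullet> F)"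
  proof -
    have "(transpose E ** A $ k) \<bullet> (A $ k ** transpose F) = (A $ k ** F) \<bullet> (A $ k ** F)" for k
    proof -
      have "(transpose E ** A $ k) \<bullet> (A $ k ** transpose F) = (A $ k ** transpose F) \<bullet> (transpose E ** A $ k)"
        by (rule inner_commute)
      also have "\<dots> = (E ** (A $ k ** transpose F)) \<bullet> A $ k"
        by (simp add: inner_matrix_mult_left)
      also have "E ** (A $ k ** transpose F) = A $ k ** F ** transpose F"
        by (simp add: matrix_mul_assoc eq)
      also have "\<dots> \<bullet> A $ k = (A $ k ** F) \<bullet> (A $ k ** F)"
        by (simp add: inner_matrix_mult_right)
      finally show ?thesis .
    qed
    then show ?thesis by (simp add: col)
  qed
  have EF: "?n * (E \<bullet> E) = ?m * (F \<bullet> F)"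
    using row[of E E] col[of F F] by (simp add: eq)
  \<comment> \<open>By \<open>EF\<close> both squares equal the cross term, so the expansion is 1 -
    2 + 1 times the same number.\<close>
  have "(\<Sum>k\<in>UNIV. ?D k \<bullet> ?D k) =
      ?n * (transpose E \<bullet> transpose E) - 2 * (?m * (F \<bullet> F)) + ?m * (transpose F \<bullet> transpose F)"
    unfolding row[symmetric] col[of "transpose F" "transpose F", symmetric] cross[symmetric]
    by (simp add: inner_diff_left inner_diff_right inner_commute sum.distrib sum_subtractf algebra_simps
        sum_distrib_left)
  also have "\<dots> = 0" by (simp add: inner_transpose EF)
  finally have "?D k \<bullet> ?D k = 0" by (simp add: sum_nonneg_eq_0_iff)
  then show ?thesis by simp
qed

text \<open>Turns block diagonality into the relation
  \<open>initial_proj a ** N = N ** initial_proj b\<close>, which can be carried through a change of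
  bases.\<close>

definition initial_proj :: "nat \<Rightarrow> real^'a::{finite,linorder}^'a::{finite,linorder}" where
  "initial_proj a = (\<chi> i j. if i = j \<and> card {..<i} < a then 1 else 0)"

lemma initial_proj_mult: "(initial_proj a ** M) $ i $ j = (if card {..<i} < a then M $ i $ j else 0)"
  "(N ** initial_proj a) $ i $ j = (if card {..<j} < a then N $ i $ j else 0)"
proof -
  have "(\<Sum>k\<in>UNIV. (if i = k \<and> card {..<i} < a then 1 else 0) * M $ k $ j) =
      (\<Sum>k\<in>UNIV. if i = k then if card {..<i} < a then M $ k $ j else 0 else 0)"
    by (rule sum.cong) auto
  then show "(initial_proj a ** M) $ i $ j = (if card {..<i} < a then M $ i $ j else 0)"
    by (simp add: initial_proj_def matrix_matrix_mult_def)
  have "(\<Sum>k\<in>UNIV. N $ i $ k * (if k = j \<and> card {..<k} < a then 1 else 0)) =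
      (\<Sum>k\<in>UNIV. if k = j then if card {..<j} < a then N $ i $ k else 0 else 0)"
    by (rule sum.cong) auto
  then show "(N ** initial_proj a) $ i $ j = (if card {..<j} < a then N $ i $ j else 0)"
    by (simp add: initial_proj_def matrix_matrix_mult_def)
qed

lemma initial_proj_idem: "initial_proj a ** initial_proj a = initial_proj a"
  by (simp add: vec_eq_iff initial_proj_mult) (simp add: initial_proj_def)

lemma trace_initial_proj:
  "a \<le> CARD('a) \<Longrightarrow> trace (initial_proj a :: real^'a::{finite,linorder}^'a::{finite,linorder}) = real a"
  using card_initial_segment[of a, where 'a = 'a]
  by (simp add: trace_def initial_proj_def flip: sum.inter_filter)

lemma block_diagonal_commutes: "block_diagonal a b N \<Longrightarrow> initial_proj a ** N = N ** initial_proj b"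
  by (auto simp: block_diagonal_def vec_eq_iff initial_proj_mult)

lemma conjugate_initial_proj:
  fixes P :: "real^'a::{finite,linorder}^'a::{finite,linorder}"
  assumes "invertible P" "a \<le> CARD('a)"
  defines "E \<equiv> matrix_inv P ** initial_proj a ** P"
  shows "E ** E = E" "trace E = real a"
proof -
  have "E ** E = matrix_inv P ** initial_proj a ** (P ** matrix_inv P) ** initial_proj a ** P"
    by (simp only: E_def matrix_mul_assoc)
  also have "\<dots> = matrix_inv P ** (initial_proj a ** initial_proj a) ** P"
    unfolding matrix_inv_inverse[OF assms(1)] by (simp add: matrix_mul_assoc)
  finally show "E ** E = E" by (simp add: E_def initial_proj_idem)
  have "trace E = trace (P ** (matrix_inv P ** initial_proj a))"
    unfolding E_def by (rule trace_mul_sym)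
  then show "trace E = real a"
    by (simp add: matrix_mul_assoc matrix_inv_inverse[OF assms(1)] trace_initial_proj assms(2))
qed

text \<open>Conjugated coordinate projections \<open>(E, F)\<close> form an endomorphism of the
  tuple, and so does the transposed pair. Their sum is symmetric, and subtracting a common scalar
  makes both components trace-free; the sign of \<open>Y\<close> turns the commutation into the
  cokernel equation.\<close>

lemma decomposable_imp_irregular:
  fixes A :: "real^'n::{finite,linorder}^'m::{finite,linorder}^'r"
  assumes A: "balanced A" "canonically_decomposable A"
  obtains X Y where "transpose X = X" "trace X = 0" "transpose Y = Y" "trace Y = 0" "X \<noteq> 0"
    "\<And>k. X ** A $ k + A $ k ** Y = 0"
proof -
  obtain P :: "real^'m::{finite,linorder}^'m::{finite,linorder}" and Q :: "real^'n::{finite,linorder}^'n::{finite,linorder}" and a b where PQ: "invertible P" "invertible Q"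
    and ab: "1 \<le> a" "a \<le> CARD('m) - 1" "1 \<le> b" "b \<le> CARD('n) - 1"
    and block: "\<And>k. block_diagonal a b (P ** A $ k ** matrix_inv Q)"
    using A(2) unfolding canonically_decomposable_def by metis
  let ?m = "real CARD('m)" and ?n = "real CARD('n)"
  have a: "a \<le> CARD('m)" "real a < ?m" and b: "b \<le> CARD('n)" using ab by auto
  define E where "E = matrix_inv P ** initial_proj a ** P"
  define F where "F = matrix_inv Q ** initial_proj b ** Q"
  have E: "E ** E = E" "trace E = real a"
    unfolding E_def by (rule conjugate_initial_proj[OF PQ(1) a(1)])+
  have F: "trace F = real b"
    unfolding F_def by (rule conjugate_initial_proj[OF PQ(2) b])
  have EF: "E ** A $ k = A $ k ** F" for k
  proof -
    have "E ** A $ k = matrix_inv P ** (initial_proj a ** (P ** A $ k ** (matrix_inv Q ** Q)))"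
      by (simp add: E_def matrix_mul_assoc matrix_inv_inverse[OF PQ(2)])
    also have "\<dots> = matrix_inv P ** ((initial_proj a ** (P ** A $ k ** matrix_inv Q)) ** Q)"
      by (simp only: matrix_mul_assoc)
    also have "\<dots> = (matrix_inv P ** P) ** A $ k ** F"
      unfolding block_diagonal_commutes[OF block] F_def by (simp only: matrix_mul_assoc)
    finally show ?thesis by (simp add: matrix_inv_inverse[OF PQ(1)])
  qed
  have EF': "transpose E ** A $ k = A $ k ** transpose F" for k
    by (rule balanced_transpose_endomorphism[OF A(1) EF])
  \<comment> \<open>Traces of \<open>E A_k A_k^T = A_k F A_k^T\<close>, summed over
    \<open>k\<close>. The equal ratios let the same scalar \<open>?s\<close> remove both
    traces.\<close>
  have "?n * real a = ?m * real b"
    using trace_mult_grams(1)[OF A(1), of E] trace_mult_grams(2)[OF A(1), of F] by (simp add: EF E F)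
  then have ratio: "real a / ?m = real b / ?n" by (simp add: field_simps)
  let ?s = "2 * (real a / ?m)"
  define X where "X = E + transpose E - ?s *\<^sub>R mat 1"
  define Y where "Y = ?s *\<^sub>R mat 1 - F - transpose F"
  show thesis
  proof (rule that[of X Y])
    show "transpose X = X" "transpose Y = Y"
      by (simp_all add: X_def Y_def transpose_add transpose_diff transpose_scalar)
    show "trace X = 0"
      by (simp add: X_def trace_add trace_sub trace_scaleR trace_transpose trace_I E)
    show "trace Y = 0"
      by (simp add: Y_def ratio trace_sub trace_scaleR trace_transpose trace_I F)
    show "X ** A $ k + A $ k ** Y = 0" for k
      by (simp add: X_def Y_def matrix_mult.add_left matrix_mult.diff_left matrix_mult.diff_right
          matrix_mult.scaleR_left matrix_mult.scaleR_right EF EF')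
    show "X \<noteq> 0"
    proof
      assume "X = 0"
      \<comment> \<open>Then \<open>E - (a/m) I\<close> would be skew. Idempotence of
        \<open>E\<close> computes its squared norm as \<open>(a/m - 1) a\<close>, which is negative
        because \<open>0 < a < m\<close>.\<close>
      then have tE: "transpose E = ?s *\<^sub>R mat 1 - E" by (simp add: X_def algebra_simps)
      have EE: "E \<bullet> E = (?s - 1) * real a"
        unfolding inner_eq_trace tE
        by (simp add: matrix_mult.diff_left matrix_mult.scaleR_left trace_sub trace_scaleR E algebra_simps)
      define N where "N = (E - (real a / ?m) *\<^sub>R mat 1) \<bullet> (E - (real a / ?m) *\<^sub>R mat 1)"
      have "N = E \<bullet> E - ?s * real a + (real a / ?m) * real a"
        by (simp add: N_def inner_diff_left inner_diff_right inner_commute[of "mat 1"] inner_mat_1 E trace_I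
            trace_sub trace_scaleR)
      then have "N = (real a / ?m - 1) * real a"
        unfolding EE by (simp add: algebra_simps)
      moreover have "N \<ge> 0" by (simp add: N_def)
      moreover have "(real a / ?m - 1) * real a < 0"
        using ab(1) a(2) by (intro mult_neg_pos) auto
      ultimately show False by linarith
    qed
  qed
qed

lemma regular_iff_indecomposable:
  fixes A :: "real^'n::{finite,linorder}^'m::{finite,linorder}^'r"
  assumes "balanced A"
  shows "(\<forall>w. transpose (J A) *v w = 0 \<longrightarrow> correction *v w = 0 \<longrightarrow> w = 0) \<longleftrightarrow> \<not> canonically_decomposable A"
proof
  assume *: "\<forall>w. transpose (J A) *v w = 0 \<longrightarrow> correction *v w = 0 \<longrightarrow> w = 0"
  show "\<not> canonically_decomposable A"
  proof
    assume "canonically_decomposable A"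
    then obtain X Y where XY: "transpose X = X" "trace X = 0" "transpose Y = Y" "trace Y = 0" "X \<noteq> 0"
      "\<And>k. X ** A $ k + A $ k ** Y = 0"
      using decomposable_imp_irregular[OF assms] by metis
    have "transpose (J A) *v triple X Y 0 = 0"
      using J_transpose_kernel[OF XY(1-4), of A 0] XY(6) by simp
    moreover have "correction *v triple X Y 0 = 0"
      using XY(1-4) by (simp add: correction_mult skew_trace_eq_0[THEN iffD2] triple_0)
    ultimately have "triple X Y 0 = triple 0 0 0" using * triple_0 by metis
    then show False using XY(5) by (simp add: triple_eq_iff)
  qed
next
  assume ind: "\<not> canonically_decomposable A"
  show "\<forall>w. transpose (J A) *v w = 0 \<longrightarrow> correction *v w = 0 \<longrightarrow> w = 0"
  proof (intro allI impI)
    fix w assume w: "transpose (J A) *v w = 0" "correction *v w = 0"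
    obtain X Y c where w_eq: "w = triple X Y c" by (rule triple_cases)
    have "triple (skew_trace X) (skew_trace Y) 0 = triple 0 0 0"
      using w(2) by (simp add: w_eq correction_mult triple_0)
    then have XY: "transpose X = X" "trace X = 0" "transpose Y = Y" "trace Y = 0"
      by (simp_all add: triple_eq_iff skew_trace_eq_0)
    have "X ** A $ k + A $ k ** Y + (real (CARD('m) * CARD('n)) * c) *\<^sub>R A $ k = 0" for k
      using J_transpose_kernel[OF XY] w(1) unfolding w_eq by blast
    from indecomposable_imp_regular[OF assms ind XY this]
    show "w = 0" by (simp add: w_eq triple_0)
  qed
qed

section \<open>The core matrices as a regular level set\<close>

lemma D_set_iff:
  fixes A :: "real^'n::{finite,linorder}^'m::{finite,linorder}^'r"
  shows "A \<in> D_set \<longleftrightarrow> \<not> canonically_decomposable A \<and> rank (phi A) = CARD('r) \<and> balanced A"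
  by (auto simp: D_set_def balanced_def row_gram_def col_gram_def)

lemma C_set_iff: "x \<in> C_set \<longleftrightarrow> unphi x \<in> D_set"
  unfolding C_set_def by (metis imageE imageI phi_unphi unphi_phi)

text \<open>The defects determine the Gram matrices up to multiples of the identity; the third
  component of \<open>J B *v stacked B\<close> is twice \<open>B \<bullet> B\<close> and fixes those
  multiples.\<close>

lemma balanced_level:
  fixes A B :: "real^'n::finite^'m::finite^'r::finite"
  assumes "balanced A"
  shows "J B *v stacked B = J A *v stacked A \<longleftrightarrow> balanced B"
proof -
  have norm: "A \<bullet> A = real CARD('n) * real CARD('m)" if "balanced A" for A :: "real^'n^'m^'r"
    using that by (simp add: trace_row_gram[symmetric] balanced_def trace_scaleR trace_I)
  have p: "1 / real (CARD('m) * CARD('n)) \<noteq> 0" by simp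
  have "row_gram B B = row_gram A A \<and> col_gram B B = col_gram A A" if "J B *v stacked B = J A *v stacked A"
  proof -
    have eq: "row_defect B B = row_defect A A" "col_defect B B = col_defect A A" "B \<bullet> B = A \<bullet> A"
      using that by (simp_all add: J_mult triple_eq_iff)
    then show ?thesis
      by (simp add: row_defect_def col_defect_def flip: scaleR_2)
  qed
  moreover have "row_gram B B = row_gram A A \<and> col_gram B B = col_gram A A \<longleftrightarrow> balanced B"
    using assms by (simp add: balanced_def)
  moreover have "J B *v stacked B = J A *v stacked A" if "balanced B"
    using norm[OF that] norm[OF assms] that assms
    by (simp add: J_mult row_defect_def col_defect_def balanced_def)
  ultimately show ?thesis by blast
qed

text \<open>Full column rank means that the Gram determinant \<open>det (transpose y ** y)\<close>
  is nonzero, which persists nearby by continuity.\<close>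

lemma full_rank_near:
  fixes x :: "real^'a::finite^'b::finite"
  assumes "rank x = CARD('a)"
  shows "\<forall>\<^sub>F y in nhds x. rank y = CARD('a)"
proof -
  have iff: "rank y = CARD('a) \<longleftrightarrow> det (transpose y ** y) \<noteq> 0" for y :: "real^'a^'b"
    using det_corrected_normal_matrix[of "transpose y" 0]
    by (simp add: full_rank_injective matrix_left_invertible_injective[symmetric] matrix_left_invertible_ker transpose_zero)
  have id: "smooth_on UNIV (\<lambda>y :: real^'a^'b. y)"
    by (rule smooth_on_linear[OF open_UNIV bounded_linear_ident])
  have "continuous_on UNIV (\<lambda>y :: real^'a^'b. det (transpose y ** y))"
    by (intro smooth_on_imp_continuous_on smooth_on_det open_UNIV smooth_on_nth
        smooth_on_bilinear[OF bounded_bilinear_matrix_mult open_UNIV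
          smooth_on_linear_compose[OF open_UNIV bounded_linear_transpose id] id])
  then have "open {y :: real^'a^'b. det (transpose y ** y) \<noteq> 0}"
    using open_Collect_neq[of "\<lambda>y. det (transpose y ** y)" "\<lambda>_. 0"] continuous_on_const by blast
  then have "\<forall>\<^sub>F y in nhds x. y \<in> {y. det (transpose y ** y) \<noteq> 0}"
    using assms iff by (intro eventually_nhds_in_open) auto
  then show ?thesis by (simp add: iff)
qed

lemma gE_eq_inner: "gE = (\<lambda>_. inner)"
  by (simp add: fun_eq_iff gE_def inner_eq_trace)

text \<open>Each condition on a core matrix has its role: full rank is open, balance is the level
  equation, and indecomposability of a balanced tuple is regularity.\<close>

lemma C_set_quadratic_level_set:
  "quadratic_level_set
    (C_set :: ((real^'r)^('n::{finite,linorder} \<times> 'm::{finite,linorder})) set)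
    (\<lambda>x. J (unphi x)) vectorize unvectorize correction"
proof (rule quadratic_level_set.intro)
  show "linear (\<lambda>x :: (real^'r)^('n \<times> 'm). J (unphi x))"
    using linear_compose[OF linear_unphi linear_J] by (simp add: o_def)
  show "J (unphi x) *v vectorize y = J (unphi y) *v vectorize x" for x y :: "(real^'r)^('n \<times> 'm)"
    by (simp add: J_mult row_defect_sym col_defect_sym inner_commute flip: stacked_unphi)
  fix x :: "(real^'r)^('n \<times> 'm)" assume "x \<in> C_set"
  then have x: "\<not> canonically_decomposable (unphi x)" "rank x = CARD('r)" "balanced (unphi x)"
    by (simp_all add: C_set_iff D_set_iff phi_unphi)
  show "w = 0" if "transpose (J (unphi x)) *v w = 0" "correction *v w = 0" for w
    using regular_iff_indecomposable[OF x(3)] x(1) that by blast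
  show "J (unphi x) *v vectorize x = J (unphi y) *v vectorize y" if "y \<in> C_set"
    for y :: "(real^'r)^('n \<times> 'm)"
    using that balanced_level[OF x(3), of "unphi y"] by (simp add: C_set_iff D_set_iff stacked_unphi)
  show "\<forall>\<^sub>F y in nhds x. (\<forall>w. transpose (J (unphi y)) *v w = 0 \<longrightarrow> correction *v w = 0 \<longrightarrow> w = 0) \<longrightarrow>
      J (unphi y) *v vectorize y = J (unphi x) *v vectorize x \<longrightarrow> y \<in> C_set"
    using full_rank_near[OF x(2)]
  proof eventually_elim
    case (elim y)
    then show ?case
      using balanced_level[OF x(3), of "unphi y"] regular_iff_indecomposable[of "unphi y"]
      unfolding C_set_iff D_set_iff stacked_unphi phi_unphi by blast
  qed
qed (simp_all add: linear_vectorize linear_unvectorize vectorize_unvectorize inner_vectorize correction_J)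

theorem proposition5p7:
  fixes f F :: "(real^'r)^('n::{finite,linorder} \<times> 'm::{finite,linorder}) \<Rightarrow> real"
    and A V :: "(real^'r)^('n \<times> 'm)"
    and At Vt :: "real^'n::{finite,linorder}^'m::{finite,linorder}^'r"
    and U :: "((real^'r)^('n \<times> 'm)) set"
  assumes "2 \<le> CARD('m)" and "2 \<le> CARD('n)"
    and "real CARD('m) / real CARD('n) + real CARD('n) / real CARD('m) < real CARD('r)"
    and "CARD('r) \<le> CARD('m) * CARD('n)"
    and "smooth_fun C_set f"
    and "A \<in> C_set"
    and "V \<in> tangent_space C_set A"
    and "extends_near C_set f A U F"
    and "At = inv phi A" and "Vt = inv phi V"
  shows "vectorize (riem_grad C_set gE f A) =
           (mat 1 - pinv (J At) ** J At) *v vectorize (eucl_grad F A)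
       \<and> vectorize (riem_hess C_set gE f A V) =
           (mat 1 - pinv (J At) ** J At) *v vectorize (eucl_hess F A V)
           - ((mat 1 - pinv (J At) ** J At) ** transpose (J Vt) ** transpose (pinv (J At))
               ** pinv (J At) ** J At) *v vectorize (eucl_grad F A)"
proof -
  interpret quadratic_level_set C_set "\<lambda>x. J (unphi x :: real^'n::{finite,linorder}^'m::{finite,linorder}^'r)" vectorize unvectorize correction
    by (rule C_set_quadratic_level_set)
  show ?thesis
    unfolding assms(9,10) inv_phi gE_eq_inner
    using riem_grad_pinv[OF assms(6,8)] riem_hess_pinv[OF assms(5-8)] by blast
qed

end
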